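(* Let $N\ge 6$. Every tracial central state on $\mathrm{Pol}(S_N^+)$ is a convex combination of the counit $\varepsilon$ and the Haar state $h$.
   Context: For a compact quantum group $\mathbb{G}$ with Hopf $*$-algebra $\mathrm{Pol}(\mathbb{G})$ and unitary irreducible representatives $U^\alpha=(U^\alpha_{ij})_{i,j=1}^{d_\alpha}$, $\alpha\in\mathrm{Irr}(\mathbb{G})$: a linear functional $\phi:\mathrm{Pol}(\mathbb{G})\to\mathbb{C}$ is tracial if $\phi(ab)=\phi(ba)$ for all $a,b$, and central if for each $\alpha$ there is $c_\alpha\in\mathbb{C}$ with $\phi(U^\alpha_{ij})=c_\alpha\delta_{ij}$ for all $i,j$. A state is a functional with $\phi(1)=1$ and $\phi(x^*x)\ge0$ for all $x$; a tracial central state is a state that is both tracial and central. The counit satisfies $\varepsilon(U^\alpha_{ij})=\delta_{ij}$; the Haar state $h$ satisfies $h(1)=1$ and $h(U^\alpha_{ij})=0$ for all nontrivial $\alpha$. The quantum permutation group $S_N^+$: $\mathrm{Pol}(S_N^+)$ is the universal unital $*$-algebra generated by elements $p_{ij}$, $1\le i,j\le N$, with $p_{ij}=p_{ij}^*$, $p_{ij}p_{il}=\delta_{jl}p_{ij}$, $p_{ij}p_{lj}=\delta_{il}p_{ij}$, $\sum_k p_{kj}=1=\sum_k p_{ik}$ for all $i,j,l$, with coproduct $\Delta(p_{ij})=\sum_k p_{ik}\otimes p_{kj}$. *)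

theory Defs
  imports
    "HOL-Library.Poly_Mapping"
    "HOL-Library.Product_Plus"
    "HOL-Library.Cardinality"
    "HOL-Library.Complex_Order"
    "Jordan_Normal_Form.Matrix"
begin

section \<open>Complex algebras given by generators and relations\<close>

text \<open>For an additively written (not necessarily commutative) monoid \<open>'m\<close>, the type
  \<open>'m \<Rightarrow>\<^sub>0 complex\<close> is the monoid algebra with its convolution product: the monomial of \<open>w\<close> is
  \<open>Poly_Mapping.single w 1\<close>, and \<open>Poly_Mapping.single 0 c\<close> is the scalar \<open>c\<close>. \<open>ext_lin \<iota> f\<close> is the linear
  extension of \<open>f\<close>, where \<open>\<iota>\<close> is the embedding of the scalars into the target.\<close>

definition ext_lin :: "(complex \<Rightarrow> 'b) \<Rightarrow> ('m \<Rightarrow> 'b) \<Rightarrow> ('m \<Rightarrow>\<^sub>0 complex) \<Rightarrow> 'b::ring_1" where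
  "ext_lin \<iota> f x = (\<Sum>w\<in>Poly_Mapping.keys x. \<iota> (Poly_Mapping.lookup x w) * f w)"

locale scalar_embedding =
  fixes \<iota> :: "complex \<Rightarrow> 'b::ring_1"
  assumes emb_add: "\<iota> (a + b) = \<iota> a + \<iota> b"
    and emb_mult: "\<iota> (a * b) = \<iota> a * \<iota> b"
    and emb_1: "\<iota> 1 = 1"
    and emb_central: "\<iota> a * y = y * \<iota> a"
begin

lemma emb_0: "\<iota> 0 = 0"
  using emb_add[of 0 0] by simp

lemma ext_superset:
  assumes "finite S" "Poly_Mapping.keys x \<subseteq> S"
  shows "ext_lin \<iota> f x = (\<Sum>w\<in>S. \<iota> (Poly_Mapping.lookup x w) * f w)"
  unfolding ext_lin_def using assms
  by (intro sum.mono_neutral_left) (auto simp: in_keys_iff emb_0)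

lemma ext_zero [simp]: "ext_lin \<iota> f 0 = 0"
  by (simp add: ext_lin_def)

lemma ext_single [simp]: "ext_lin \<iota> f (Poly_Mapping.single w c) = \<iota> c * f w"
  by (cases "c = 0") (auto simp: ext_lin_def emb_0)

lemma ext_add: "ext_lin \<iota> f (x + y) = ext_lin \<iota> f x + ext_lin \<iota> f y"
proof -
  let ?S = "Poly_Mapping.keys x \<union> Poly_Mapping.keys y"
  have "Poly_Mapping.keys (x + y) \<subseteq> ?S" by (rule Poly_Mapping.keys_add)
  then show ?thesis
    by (simp add: ext_superset[of ?S] lookup_add emb_add algebra_simps sum.distrib)
qed

lemma ext_sum: "ext_lin \<iota> f (sum g A) = (\<Sum>a\<in>A. ext_lin \<iota> f (g a))"
  by (induction A rule: infinite_finite_induct) (auto simp: ext_add)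

lemma ext_uminus: "ext_lin \<iota> f (- x) = - ext_lin \<iota> f x"
  using ext_add[of f x "- x"] by (simp add: eq_neg_iff_add_eq_0 add.commute)

lemma ext_diff: "ext_lin \<iota> f (x - y) = ext_lin \<iota> f x - ext_lin \<iota> f y"
  using ext_add[of f x "- y"] by (simp add: ext_uminus)

end

lemma monomial_sum: "(x :: 'm \<Rightarrow>\<^sub>0 complex) = (\<Sum>w\<in>Poly_Mapping.keys x. Poly_Mapping.single w (Poly_Mapping.lookup x w))"
proof (rule poly_mapping_eqI)
  fix k
  show "Poly_Mapping.lookup x k = Poly_Mapping.lookup (\<Sum>w\<in>Poly_Mapping.keys x. Poly_Mapping.single w (Poly_Mapping.lookup x w)) k"
    by (auto simp: lookup_sum lookup_single when_def sum.delta in_keys_iff)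
qed

lemma (in scalar_embedding) ext_mult:
  fixes f :: "'m::monoid_add \<Rightarrow> 'b"
  assumes f: "\<And>u v. f (u + v) = f u * f v"
  shows "ext_lin \<iota> f (x * y) = ext_lin \<iota> f x * ext_lin \<iota> f y"
proof -
  have 1: "ext_lin \<iota> f (Poly_Mapping.single u c * Poly_Mapping.single v d)
      = ext_lin \<iota> f (Poly_Mapping.single u c) * ext_lin \<iota> f (Poly_Mapping.single v d)" for u v c d
    by (simp add: mult_single f emb_mult) (metis emb_central mult.assoc)
  have "ext_lin \<iota> f (x * y) = ext_lin \<iota> f
      ((\<Sum>u\<in>Poly_Mapping.keys x. Poly_Mapping.single u (Poly_Mapping.lookup x u)) * (\<Sum>v\<in>Poly_Mapping.keys y. Poly_Mapping.single v (Poly_Mapping.lookup y v)))"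
    by (simp flip: monomial_sum)
  also have "\<dots> = (\<Sum>u\<in>Poly_Mapping.keys x. \<Sum>v\<in>Poly_Mapping.keys y.
      ext_lin \<iota> f (Poly_Mapping.single u (Poly_Mapping.lookup x u)) * ext_lin \<iota> f (Poly_Mapping.single v (Poly_Mapping.lookup y v)))"
    by (simp add: sum_product ext_sum 1 del: ext_single)
  also have "\<dots> = ext_lin \<iota> f x * ext_lin \<iota> f y"
    by (simp add: sum_product[symmetric]) (simp add: ext_lin_def)
  finally show ?thesis .
qed

lemma (in scalar_embedding) ext_one:
  assumes "f 0 = 1" shows "ext_lin \<iota> f 1 = 1"
  using ext_single[of f 0 1] assms by (simp add: emb_1 del: ext_single)

lemma single0_central: "Poly_Mapping.single 0 c * (x :: 'm::monoid_add \<Rightarrow>\<^sub>0 complex) = x * Poly_Mapping.single 0 c"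
proof -
  have "Poly_Mapping.single 0 c * (\<Sum>w\<in>Poly_Mapping.keys x. Poly_Mapping.single w (Poly_Mapping.lookup x w))
      = (\<Sum>w\<in>Poly_Mapping.keys x. Poly_Mapping.single w (Poly_Mapping.lookup x w)) * Poly_Mapping.single 0 c"
    unfolding sum_distrib_left sum_distrib_right
    by (intro sum.cong) (auto simp: mult_single mult.commute)
  then show ?thesis by (simp flip: monomial_sum)
qed

global_interpretation emb_id: scalar_embedding "\<lambda>c. c"
  by standard (auto simp: algebra_simps)

global_interpretation emb_single: scalar_embedding "Poly_Mapping.single (0 :: 'm::monoid_add)"
  by standard (auto simp: single_add mult_single single0_central)

text \<open>A type of this class carries a set of relators in its monoid algebra together with
  a character of the monoid that kills them. The character becomes the counit of the
  quotient algebra; it also shows that \<open>0 \<noteq> 1\<close> there, as the class \<open>ring_1\<close> demands.\<close>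

class augmented_presentation = monoid_add +
  fixes relators :: "('a \<Rightarrow>\<^sub>0 complex) set"
    and aug :: "'a \<Rightarrow> complex"
  assumes aug_0: "aug 0 = 1"
    and aug_add: "aug (u + v) = aug u * aug v"
    and aug_relator: "r \<in> relators \<Longrightarrow> ext_lin (\<lambda>c. c) aug r = 0"

text \<open>The two-sided ideal generated by the relators.\<close>

inductive_set rel_ideal :: "('m::augmented_presentation \<Rightarrow>\<^sub>0 complex) set" where
  zero: "0 \<in> rel_ideal"
| gen: "r \<in> relators \<Longrightarrow> a * r * b \<in> rel_ideal"
| add: "x \<in> rel_ideal \<Longrightarrow> y \<in> rel_ideal \<Longrightarrow> x + y \<in> rel_ideal"

lemma rel_ideal_left: "x \<in> rel_ideal \<Longrightarrow> a * x \<in> rel_ideal"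
proof (induction rule: rel_ideal.induct)
  case (gen r a' b)
  then show ?case using rel_ideal.gen[OF gen, of "a * a'" b] by (simp add: mult.assoc)
qed (auto simp: distrib_left intro: rel_ideal.intros)

lemma rel_ideal_right: "x \<in> rel_ideal \<Longrightarrow> x * b \<in> rel_ideal"
proof (induction rule: rel_ideal.induct)
  case (gen r a b')
  then show ?case using rel_ideal.gen[OF gen, of a "b' * b"] by (simp add: mult.assoc)
qed (auto simp: distrib_right intro: rel_ideal.intros)

lemma rel_ideal_uminus: "x \<in> rel_ideal \<Longrightarrow> - x \<in> rel_ideal"
  using rel_ideal_left[of x "- 1"] by simp

lemma rel_ideal_diff: "x \<in> rel_ideal \<Longrightarrow> y \<in> rel_ideal \<Longrightarrow> x - y \<in> rel_ideal"
  using rel_ideal.add[OF _ rel_ideal_uminus, of x y] by simp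

lemma rel_ideal_relator: "r \<in> relators \<Longrightarrow> r \<in> rel_ideal"
  using rel_ideal.gen[of r 1 1] by simp

lemma aug_rel_ideal: "x \<in> rel_ideal \<Longrightarrow> ext_lin (\<lambda>c. c) aug x = 0"
  by (induction rule: rel_ideal.induct)
     (auto simp: emb_id.ext_add emb_id.ext_mult aug_add aug_relator)

quotient_type (overloaded) 'm alg = "'m::augmented_presentation \<Rightarrow>\<^sub>0 complex" / "\<lambda>x y. x - y \<in> rel_ideal"
proof (rule equivpI)
  show "reflp (\<lambda>x y :: 'm \<Rightarrow>\<^sub>0 complex. x - y \<in> rel_ideal)"
    by (auto intro!: reflpI rel_ideal.zero)
  show "symp (\<lambda>x y :: 'm \<Rightarrow>\<^sub>0 complex. x - y \<in> rel_ideal)"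
    by (auto intro!: sympI dest: rel_ideal_uminus)
  show "transp (\<lambda>x y :: 'm \<Rightarrow>\<^sub>0 complex. x - y \<in> rel_ideal)"
  proof (rule transpI)
    fix x y z :: "'m \<Rightarrow>\<^sub>0 complex"
    assume "x - y \<in> rel_ideal" "y - z \<in> rel_ideal"
    from rel_ideal.add[OF this] show "x - z \<in> rel_ideal" by simp
  qed
qed

lemma rel_ideal_mult_cong:
  assumes "x - x' \<in> rel_ideal" "y - y' \<in> rel_ideal"
  shows "x * y - x' * y' \<in> rel_ideal"
proof -
  have "x * y - x' * y' = (x - x') * y + x' * (y - y')" by (simp add: algebra_simps)
  then show ?thesis using assms by (auto intro: rel_ideal.add rel_ideal_left rel_ideal_right)
qed

instantiation alg :: (augmented_presentation) ring_1
begin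

lift_definition zero_alg :: "'a alg" is 0 .
lift_definition one_alg :: "'a alg" is 1 .
lift_definition plus_alg :: "'a alg \<Rightarrow> 'a alg \<Rightarrow> 'a alg" is "(+)"
proof -
  fix x x' y y' :: "'a \<Rightarrow>\<^sub>0 complex"
  assume "x - x' \<in> rel_ideal" "y - y' \<in> rel_ideal"
  from rel_ideal.add[OF this] show "x + y - (x' + y') \<in> rel_ideal" by (simp add: algebra_simps)
qed
lift_definition uminus_alg :: "'a alg \<Rightarrow> 'a alg" is uminus
  by (drule rel_ideal_uminus) simp
lift_definition minus_alg :: "'a alg \<Rightarrow> 'a alg \<Rightarrow> 'a alg" is "(-)"
proof -
  fix x x' y y' :: "'a \<Rightarrow>\<^sub>0 complex"
  assume "x - x' \<in> rel_ideal" "y - y' \<in> rel_ideal"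
  from rel_ideal_diff[OF this] show "x - y - (x' - y') \<in> rel_ideal" by (simp add: algebra_simps)
qed
lift_definition times_alg :: "'a alg \<Rightarrow> 'a alg \<Rightarrow> 'a alg" is "(*)"
  by (rule rel_ideal_mult_cong)

instance
proof
  have "(1 :: 'a \<Rightarrow>\<^sub>0 complex) \<notin> rel_ideal"
    using aug_rel_ideal[of "1 :: 'a \<Rightarrow>\<^sub>0 complex"]
      emb_id.ext_one[where f = "aug :: 'a \<Rightarrow> complex"] by (auto simp: aug_0)
  then show "(0 :: 'a alg) \<noteq> 1"
    by transfer (auto dest: rel_ideal_uminus)
  fix a b c :: "'a alg"
  show "a + b + c = a + (b + c)"
    by transfer (simp add: add.assoc rel_ideal.zero)
  show "a + b = b + a"
    by transfer (simp add: add.commute rel_ideal.zero)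
  show "0 + a = a" "- a + a = 0" "a - b = a + - b" "1 * a = a" "a * 1 = a"
    by (transfer, simp add: rel_ideal.zero)+
  show "a * b * c = a * (b * c)"
    by transfer (simp add: mult.assoc rel_ideal.zero)
  show "(a + b) * c = a * c + b * c"
    by transfer (simp add: distrib_right rel_ideal.zero)
  show "a * (b + c) = a * b + a * c"
    by transfer (simp add: distrib_left rel_ideal.zero)
qed

end

lift_definition scale :: "complex \<Rightarrow> 'm::augmented_presentation alg \<Rightarrow> 'm alg"
  is "\<lambda>c x. Poly_Mapping.single 0 c * x"
  by (simp add: rel_ideal_left flip: right_diff_distrib)

lemma vector_space_scale: "vector_space scale"
proof
  fix a b :: complex and x y :: "'m::augmented_presentation alg"
  show "scale a (x + y) = scale a x + scale a y"
    by transfer (simp add: algebra_simps rel_ideal.zero)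
  show "scale (a + b) x = scale a x + scale b x"
    by transfer (simp add: algebra_simps single_add rel_ideal.zero)
  show "scale a (scale b x) = scale (a * b) x"
    by transfer (simp add: mult_single rel_ideal.zero flip: mult.assoc)
  show "scale 1 x = x"
    by transfer (simp add: rel_ideal.zero)
qed

lemma scale_mult_left: "scale c x * y = scale c (x * y)"
  by transfer (simp add: mult.assoc rel_ideal.zero)

lemma scale_mult_right: "x * scale c y = scale c (x * y)"
proof (transfer, goal_cases)
  case (1 x c y)
  have "x * (Poly_Mapping.single 0 c * y) = Poly_Mapping.single 0 c * (x * y)"
    by (simp only: single0_central[of c x] flip: mult.assoc)
  then show ?case by (simp add: rel_ideal.zero)
qed

lift_definition counit :: "'m::augmented_presentation alg \<Rightarrow> complex" is "ext_lin (\<lambda>c. c) aug"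
  using aug_rel_ideal by (metis emb_id.ext_diff eq_iff_diff_eq_0)

lemma counit_mult: "counit (x * y) = counit x * counit y"
  by transfer (simp add: emb_id.ext_mult aug_add)

lemma counit_add: "counit (x + y) = counit x + counit y"
  by transfer (rule emb_id.ext_add)

lemma counit_one: "counit 1 = 1"
  by transfer (rule emb_id.ext_one, rule aug_0)

lemma counit_scale: "counit (scale c x) = c * counit x"
  by transfer (simp add: emb_id.ext_mult aug_add aug_0)

subsection \<open>Tensor products\<close>

text \<open>The monoid algebra of a product monoid is the algebraic tensor product of the monoid
  algebras, and the kernel of the map onto the tensor product of two quotients is
  generated by the relators \<open>r \<otimes> 1\<close> and \<open>1 \<otimes> s\<close>. Hence \<open>('m \<times> 'k) alg\<close> is the
  algebraic tensor product of \<open>'m alg\<close> and \<open>'k alg\<close>.\<close>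

definition in1 :: "('m::monoid_add \<Rightarrow>\<^sub>0 complex) \<Rightarrow> ('m \<times> 'k::monoid_add) \<Rightarrow>\<^sub>0 complex" where
  "in1 = ext_lin (Poly_Mapping.single 0) (\<lambda>u. Poly_Mapping.single (u, 0) 1)"

definition in2 :: "('k::monoid_add \<Rightarrow>\<^sub>0 complex) \<Rightarrow> ('m::monoid_add \<times> 'k) \<Rightarrow>\<^sub>0 complex" where
  "in2 = ext_lin (Poly_Mapping.single 0) (\<lambda>v. Poly_Mapping.single (0, v) 1)"

lemma in1_simps:
  "in1 0 = 0" "in1 1 = 1" "in1 (x + y) = in1 x + in1 y" "in1 (x - y) = in1 x - in1 y"
  "in1 (x * y) = in1 x * in1 y" "in1 (Poly_Mapping.single u c) = Poly_Mapping.single (u, 0) c"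
  "in1 (sum g A) = (\<Sum>a\<in>A. in1 (g a))"
  unfolding in1_def
  by (rule emb_single.ext_zero)
     (rule emb_single.ext_one, simp only: zero_prod_def[symmetric] single_one,
      rule emb_single.ext_add, rule emb_single.ext_diff,
      rule emb_single.ext_mult, simp only: mult_single add_Pair add_0_left mult_1_left,
      simp only: emb_single.ext_single mult_single add_0_left mult_1_right, rule emb_single.ext_sum)

lemma in2_simps:
  "in2 0 = 0" "in2 1 = 1" "in2 (x + y) = in2 x + in2 y" "in2 (x - y) = in2 x - in2 y"
  "in2 (x * y) = in2 x * in2 y" "in2 (Poly_Mapping.single u c) = Poly_Mapping.single (0, u) c"
  "in2 (sum g A) = (\<Sum>a\<in>A. in2 (g a))"
  unfolding in2_def
  by (rule emb_single.ext_zero)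
     (rule emb_single.ext_one, simp only: zero_prod_def[symmetric] single_one,
      rule emb_single.ext_add, rule emb_single.ext_diff,
      rule emb_single.ext_mult, simp only: mult_single add_Pair add_0_left mult_1_left,
      simp only: emb_single.ext_single mult_single add_0_left mult_1_right, rule emb_single.ext_sum)

instantiation prod :: (augmented_presentation, augmented_presentation) augmented_presentation
begin

definition relators_prod :: "('a \<times> 'b \<Rightarrow>\<^sub>0 complex) set" where
  "relators_prod = in1 ` relators \<union> in2 ` relators"

definition aug_prod :: "'a \<times> 'b \<Rightarrow> complex" where
  "aug_prod w = aug (fst w) * aug (snd w)"

instance
proof
  show "aug (0 :: 'a \<times> 'b) = 1" by (simp add: aug_prod_def aug_0)
  show "aug (u + v) = aug u * aug v" for u v :: "'a \<times> 'b"
    by (simp add: aug_prod_def aug_add)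
  have 1: "ext_lin (\<lambda>c. c) aug (in1 r :: 'a \<times> 'b \<Rightarrow>\<^sub>0 complex) = ext_lin (\<lambda>c. c) aug r" for r
    unfolding in1_def ext_lin_def[of "Poly_Mapping.single 0"]
    by (simp add: emb_id.ext_sum mult_single aug_prod_def aug_0 ext_lin_def[of "\<lambda>c. c" aug r])
  have 2: "ext_lin (\<lambda>c. c) aug (in2 r :: 'a \<times> 'b \<Rightarrow>\<^sub>0 complex) = ext_lin (\<lambda>c. c) aug r" for r
    unfolding in2_def ext_lin_def[of "Poly_Mapping.single 0"]
    by (simp add: emb_id.ext_sum mult_single aug_prod_def aug_0 ext_lin_def[of "\<lambda>c. c" aug r])
  show "ext_lin (\<lambda>c. c) aug r = 0" if "r \<in> relators" for r :: "'a \<times> 'b \<Rightarrow>\<^sub>0 complex"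
    using that by (auto simp: relators_prod_def 1 2 aug_relator)
qed

end

lemma in1_rel_ideal: "x \<in> rel_ideal \<Longrightarrow> in1 x \<in> rel_ideal"
  by (induction rule: rel_ideal.induct)
     (auto simp: in1_simps relators_prod_def intro: rel_ideal.intros)

lemma in2_rel_ideal: "x \<in> rel_ideal \<Longrightarrow> in2 x \<in> rel_ideal"
  by (induction rule: rel_ideal.induct)
     (auto simp: in2_simps relators_prod_def intro: rel_ideal.intros)

lift_definition tensor ::
  "'m::augmented_presentation alg \<Rightarrow> 'k::augmented_presentation alg \<Rightarrow> ('m \<times> 'k) alg"
  is "\<lambda>x y. in1 x * in2 y"
  by (intro rel_ideal_mult_cong)
     (auto simp: in1_rel_ideal in2_rel_ideal simp flip: in1_simps(4) in2_simps(4))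

lemma in1_in2_commute:
  "(in1 x :: 'm::monoid_add \<times> 'k::monoid_add \<Rightarrow>\<^sub>0 complex) * in2 y = in2 y * in1 x"
proof -
  have "in1 (\<Sum>u\<in>Poly_Mapping.keys x. Poly_Mapping.single u (Poly_Mapping.lookup x u)) * in2 (\<Sum>v\<in>Poly_Mapping.keys y. Poly_Mapping.single v (Poly_Mapping.lookup y v))
      = in2 (\<Sum>v\<in>Poly_Mapping.keys y. Poly_Mapping.single v (Poly_Mapping.lookup y v))
        * (in1 (\<Sum>u\<in>Poly_Mapping.keys x. Poly_Mapping.single u (Poly_Mapping.lookup x u)) :: 'm \<times> 'k \<Rightarrow>\<^sub>0 complex)"
    unfolding in1_simps in2_simps sum_product
    by (subst sum.swap) (simp add: mult_single mult.commute)
  then show ?thesis by (simp flip: monomial_sum)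
qed

lemma tensor_mult: "tensor x y * tensor x' y' = tensor (x * x') (y * y')"
proof (transfer, goal_cases)
  case (1 x y x' y')
  have "in1 x * in2 y * (in1 x' * in2 y') = in1 x * (in2 y * in1 x') * in2 y'"
    by (simp only: mult.assoc)
  also have "\<dots> = in1 x * (in1 x' * in2 y) * in2 y'"
    by (simp only: in1_in2_commute)
  also have "\<dots> = in1 (x * x') * in2 (y * y')"
    by (simp add: in1_simps in2_simps mult.assoc)
  finally show ?case by (simp add: rel_ideal.zero)
qed

lemma tensor_add_left: "tensor (x + x') y = tensor x y + tensor x' y"
  by transfer (simp add: in1_simps algebra_simps rel_ideal.zero)

lemma tensor_add_right: "tensor x (y + y') = tensor x y + tensor x y'"
  by transfer (simp add: in2_simps algebra_simps rel_ideal.zero)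

lemma tensor_zero [simp]: "tensor 0 y = 0" "tensor x 0 = 0"
  by (transfer, simp add: in1_simps in2_simps rel_ideal.zero)+

lemma tensor_one: "tensor 1 1 = 1"
  by transfer (simp add: in1_simps in2_simps rel_ideal.zero)

lemma tensor_sum_left: "tensor (sum f A) y = (\<Sum>a\<in>A. tensor (f a) y)"
  by (induction A rule: infinite_finite_induct) (auto simp: tensor_add_left)

lemma tensor_sum_right: "tensor x (sum f A) = (\<Sum>a\<in>A. tensor x (f a))"
  by (induction A rule: infinite_finite_induct) (auto simp: tensor_add_right)

section \<open>The algebra of the quantum permutation group\<close>

text \<open>Words in the letters \<open>p\<^sub>i\<^sub>j\<close>, with concatenation written as addition. The index set
  \<open>{1, \<dots>, N}\<close> is a finite type \<open>'n\<close> with \<open>N = CARD('n)\<close>.\<close>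

datatype 'n word = Word (letters: "('n \<times> 'n) list")

instantiation word :: (type) monoid_add
begin

definition zero_word :: "'a word" where "zero_word = Word []"

definition plus_word :: "'a word \<Rightarrow> 'a word \<Rightarrow> 'a word" where
  "plus_word u v = Word (letters u @ letters v)"

instance by standard (auto simp: zero_word_def plus_word_def)

end

text \<open>The generators are taken to be self-adjoint from the start, so that the free algebra
  on the letters, with the involution that reverses words, is the free *-algebra on
  self-adjoint generators; the relation \<open>p\<^sub>i\<^sub>j = p\<^sub>i\<^sub>j\<^sup>*\<close> is thereby built in.\<close>

definition letter :: "'n \<Rightarrow> 'n \<Rightarrow> 'n word \<Rightarrow>\<^sub>0 complex" where
  "letter i j = Poly_Mapping.single (Word [(i, j)]) 1"

instantiation word :: (finite) augmented_presentation
begin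

definition relators_word :: "('a word \<Rightarrow>\<^sub>0 complex) set" where
  "relators_word =
     {letter i j * letter i l - (if j = l then letter i j else 0) | i j l. True} \<union>
     {letter i j * letter l j - (if i = l then letter i j else 0) | i j l. True} \<union>
     {(\<Sum>k\<in>UNIV. letter k j) - 1 | j. True} \<union>
     {(\<Sum>k\<in>UNIV. letter i k) - 1 | i. True}"

definition aug_word :: "'a word \<Rightarrow> complex" where
  "aug_word w = (\<Prod>(i, j)\<leftarrow>letters w. if i = j then 1 else 0)"

instance
proof
  show a0: "aug (0 :: 'a word) = 1" by (simp add: aug_word_def zero_word_def)
  show a1: "aug (u + v) = aug u * aug v" for u v :: "'a word"
    by (simp add: aug_word_def plus_word_def)
  have a2: "ext_lin (\<lambda>c. c) aug (letter i j) = (if i = j then 1 else 0)" for i j :: 'a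
    by (simp add: letter_def aug_word_def)
  show "ext_lin (\<lambda>c. c) aug r = 0" if "r \<in> relators" for r :: "'a word \<Rightarrow>\<^sub>0 complex"
    using that
    by (auto simp: relators_word_def emb_id.ext_diff emb_id.ext_mult[OF a1] a2 emb_id.ext_sum
        emb_id.ext_one[where f = "aug :: 'a word \<Rightarrow> complex", OF a0] split: if_splits)
qed

end

type_synonym 'n pol = "'n word alg"
type_synonym 'n pol2 = "('n word \<times> 'n word) alg"

lift_definition pgen :: "'n::finite \<Rightarrow> 'n \<Rightarrow> 'n pol" is letter .

lemma alg_eq_0_iff: "abs_alg x = 0 \<longleftrightarrow> x \<in> rel_ideal"
  by (simp add: zero_alg_def alg.abs_eq_iff)

lemma abs_alg_sum: "abs_alg (sum f A) = (\<Sum>a\<in>A. abs_alg (f a))"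
  by (induction A rule: infinite_finite_induct)
     (auto simp: zero_alg.abs_eq[symmetric] plus_alg.abs_eq[symmetric])

lemma pgen_abs: "pgen i j = abs_alg (letter i j)"
  by (simp add: pgen_def)

lemma pgen_row: "pgen i j * pgen i l = (if j = l then pgen i j else 0)"
proof -
  have "abs_alg (letter i j * letter i l - (if j = l then letter i j else 0)) = 0"
    unfolding alg_eq_0_iff
    by (rule rel_ideal_relator) (unfold relators_word_def, blast)
  then show ?thesis
    by (cases "j = l") (simp_all add: pgen_abs flip: minus_alg.abs_eq times_alg.abs_eq)
qed

lemma pgen_col: "pgen i j * pgen l j = (if i = l then pgen i j else 0)"
proof -
  have "abs_alg (letter i j * letter l j - (if i = l then letter i j else 0)) = 0"
    unfolding alg_eq_0_iff
    by (rule rel_ideal_relator) (unfold relators_word_def, blast)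
  then show ?thesis
    by (cases "i = l") (simp_all add: pgen_abs flip: minus_alg.abs_eq times_alg.abs_eq)
qed

lemma pgen_sum_col: "(\<Sum>k\<in>UNIV. pgen k j) = 1"
proof -
  have "abs_alg ((\<Sum>k\<in>UNIV. letter k j) - 1) = 0"
    unfolding alg_eq_0_iff by (rule rel_ideal_relator) (auto simp: relators_word_def)
  then show ?thesis
    by (simp add: minus_alg.abs_eq[symmetric] abs_alg_sum one_alg_def pgen_abs)
qed

lemma pgen_sum_row: "(\<Sum>k\<in>UNIV. pgen i k) = 1"
proof -
  have "abs_alg ((\<Sum>k\<in>UNIV. letter i k) - 1) = 0"
    unfolding alg_eq_0_iff by (rule rel_ideal_relator) (auto simp: relators_word_def)
  then show ?thesis
    by (simp add: minus_alg.abs_eq[symmetric] abs_alg_sum one_alg_def pgen_abs)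
qed

lemma counit_pgen: "counit (pgen i j) = (if i = j then 1 else 0)"
  by transfer (simp add: letter_def aug_word_def)

subsection \<open>Involution\<close>

definition word_rev :: "'n word \<Rightarrow> 'n word" where
  "word_rev w = Word (rev (letters w))"

definition star_free :: "('n word \<Rightarrow>\<^sub>0 complex) \<Rightarrow> 'n word \<Rightarrow>\<^sub>0 complex" where
  "star_free x = (\<Sum>w\<in>Poly_Mapping.keys x. Poly_Mapping.single (word_rev w) (cnj (Poly_Mapping.lookup x w)))"

lemma star_free_superset:
  assumes "finite S" "Poly_Mapping.keys x \<subseteq> S"
  shows "star_free x = (\<Sum>w\<in>S. Poly_Mapping.single (word_rev w) (cnj (Poly_Mapping.lookup x w)))"
  unfolding star_free_def using assms
  by (intro sum.mono_neutral_left) (auto simp: in_keys_iff)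

lemma star_free_add: "star_free (x + y) = star_free x + star_free y"
proof -
  let ?S = "Poly_Mapping.keys x \<union> Poly_Mapping.keys y"
  have "Poly_Mapping.keys (x + y) \<subseteq> ?S" by (rule Poly_Mapping.keys_add)
  then show ?thesis
    by (simp add: star_free_superset[of ?S] lookup_add single_add sum.distrib)
qed

lemma star_free_0 [simp]: "star_free 0 = 0"
  by (simp add: star_free_def)

lemma star_free_single [simp]: "star_free (Poly_Mapping.single w c) = Poly_Mapping.single (word_rev w) (cnj c)"
  by (cases "c = 0") (auto simp: star_free_def)

lemma word_rev_zero: "word_rev 0 = 0"
  by (simp add: word_rev_def zero_word_def)

lemma star_free_1 [simp]: "star_free 1 = 1"
  using star_free_single[of 0 1] by (simp add: word_rev_zero del: star_free_single)

lemma star_free_sum: "star_free (sum g A) = (\<Sum>a\<in>A. star_free (g a))"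
  by (induction A rule: infinite_finite_induct) (auto simp: star_free_add)

lemma star_free_diff: "star_free (x - y) = star_free x - star_free y"
  by (metis add_diff_cancel diff_add_cancel star_free_add)

lemma star_free_mult: "star_free (x * y) = star_free y * star_free x"
proof -
  have 1: "star_free (Poly_Mapping.single u c * Poly_Mapping.single v d) = star_free (Poly_Mapping.single v d) * star_free (Poly_Mapping.single u c)"
    for u v :: "'a word" and c d
    by (simp add: mult_single word_rev_def plus_word_def mult.commute)
  have "star_free (x * y) = star_free
      ((\<Sum>u\<in>Poly_Mapping.keys x. Poly_Mapping.single u (Poly_Mapping.lookup x u)) * (\<Sum>v\<in>Poly_Mapping.keys y. Poly_Mapping.single v (Poly_Mapping.lookup y v)))"
    by (simp flip: monomial_sum)
  also have "\<dots> = (\<Sum>u\<in>Poly_Mapping.keys x. \<Sum>v\<in>Poly_Mapping.keys y.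
      star_free (Poly_Mapping.single v (Poly_Mapping.lookup y v)) * star_free (Poly_Mapping.single u (Poly_Mapping.lookup x u)))"
    by (simp add: sum_product star_free_sum 1 del: star_free_single)
  also have "\<dots> = star_free y * star_free x"
    by (subst sum.swap) (simp add: sum_product[symmetric], simp add: star_free_def)
  finally show ?thesis .
qed

lemma star_free_letter: "star_free (letter i j) = letter i j"
  by (simp add: letter_def word_rev_def)

lemma star_free_rel_ideal:
  "x \<in> rel_ideal \<Longrightarrow> star_free x \<in> (rel_ideal :: ('n::finite word \<Rightarrow>\<^sub>0 complex) set)"
proof (induction rule: rel_ideal.induct)
  case (gen r a b)
  have "star_free r \<in> relators"
    using gen unfolding relators_word_def
    by (auto simp: star_free_diff star_free_mult star_free_letter star_free_sum; metis)
  then show ?case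
    by (auto simp: star_free_mult simp flip: mult.assoc intro: rel_ideal.gen)
qed (auto simp: star_free_add intro: rel_ideal.intros)

lift_definition star :: "'n::finite pol \<Rightarrow> 'n pol" is star_free
  using star_free_rel_ideal by (metis star_free_diff)

lemma star_pgen: "star (pgen i j) = pgen i j"
  by transfer (simp add: star_free_letter rel_ideal.zero)

lemma star_star: "star (star x) = x"
proof (transfer, goal_cases)
  case (1 x)
  have "star_free (star_free x) = (\<Sum>w\<in>Poly_Mapping.keys x. Poly_Mapping.single w (Poly_Mapping.lookup x w))"
    unfolding star_free_def[of x] star_free_sum by (simp add: word_rev_def)
  then show ?case by (simp add: rel_ideal.zero flip: monomial_sum)
qed

lemma star_mult: "star (x * y) = star y * star x"
  by transfer (simp add: star_free_mult rel_ideal.zero)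

lemma star_add: "star (x + y) = star x + star y"
  by transfer (simp add: star_free_add rel_ideal.zero)

lemma star_one: "star 1 = 1"
  by transfer (simp add: rel_ideal.zero)

lemma star_scale: "star (scale c x) = scale (cnj c) (star x)"
  by transfer (simp add: star_free_mult word_rev_zero single0_central[symmetric] rel_ideal.zero)

subsection \<open>Coproduct\<close>

definition comult_word :: "'n::finite word \<Rightarrow> ('n word \<times> 'n word) \<Rightarrow>\<^sub>0 complex" where
  "comult_word w = (\<Prod>(i, j)\<leftarrow>letters w. \<Sum>k\<in>UNIV. in1 (letter i k) * in2 (letter k j))"

definition comult_free ::
  "('n::finite word \<Rightarrow>\<^sub>0 complex) \<Rightarrow> ('n word \<times> 'n word) \<Rightarrow>\<^sub>0 complex" where
  "comult_free = ext_lin (Poly_Mapping.single 0) comult_word"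

lemma comult_free_mult: "comult_free (x * y) = comult_free x * comult_free y"
  unfolding comult_free_def
  by (rule emb_single.ext_mult) (simp add: comult_word_def plus_word_def)

lemma comult_free_one: "comult_free 1 = 1"
  unfolding comult_free_def
  by (rule emb_single.ext_one) (simp add: comult_word_def zero_word_def)

lemma comult_free_letter:
  "comult_free (letter i j) = (\<Sum>k\<in>UNIV. in1 (letter i k) * in2 (letter k j))"
  by (simp add: comult_free_def letter_def comult_word_def)

lemmas comult_free_linear =
  emb_single.ext_add[of comult_word, folded comult_free_def]
  emb_single.ext_diff[of comult_word, folded comult_free_def]
  emb_single.ext_sum[of comult_word, folded comult_free_def]

lemma comult_free_zero: "comult_free 0 = 0"
  by (simp add: comult_free_def)

lemma abs_comult_letter:
  "abs_alg (comult_free (letter i j)) = (\<Sum>k\<in>UNIV. tensor (pgen i k) (pgen k j))"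
  by (simp add: comult_free_letter abs_alg_sum pgen_abs tensor.abs_eq)

lemma comult_relator:
  assumes "r \<in> relators"
  shows "comult_free (r :: 'n::finite word \<Rightarrow>\<^sub>0 complex) \<in> rel_ideal"
proof -
  let ?D = "\<lambda>i j :: 'n. \<Sum>k\<in>UNIV. tensor (pgen i k) (pgen k j)"
  have row: "?D i j * ?D i l = (if j = l then ?D i j else 0)" for i j l
  proof -
    have "?D i j * ?D i l
        = (\<Sum>k\<in>UNIV. \<Sum>m\<in>UNIV. if k = m then tensor (pgen i k) (pgen k j * pgen m l) else 0)"
      unfolding sum_product tensor_mult pgen_row by (intro sum.cong) auto
    also have "\<dots> = (if j = l then ?D i j else 0)"
      by (simp add: pgen_row)
    finally show ?thesis .
  qed
  have col: "?D i j * ?D l j = (if i = l then ?D i j else 0)" for i j l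
  proof -
    have "?D i j * ?D l j
        = (\<Sum>k\<in>UNIV. \<Sum>m\<in>UNIV. if k = m then tensor (pgen i k * pgen l m) (pgen k j) else 0)"
      unfolding sum_product tensor_mult pgen_col by (intro sum.cong) auto
    also have "\<dots> = (if i = l then ?D i j else 0)"
      by (simp add: pgen_col)
    finally show ?thesis .
  qed
  have scol: "(\<Sum>i\<in>UNIV. ?D i j) = 1" for j
  proof -
    have "(\<Sum>i\<in>UNIV. ?D i j) = (\<Sum>k\<in>UNIV. tensor (\<Sum>i\<in>UNIV. pgen i k) (pgen k j))"
      unfolding tensor_sum_left by (rule sum.swap)
    also have "\<dots> = (\<Sum>k\<in>UNIV. tensor 1 (pgen k j))"
      by (simp only: pgen_sum_col)
    also have "\<dots> = tensor 1 (\<Sum>k\<in>UNIV. pgen k j)"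
      by (rule tensor_sum_right[symmetric])
    finally show ?thesis by (simp add: pgen_sum_col tensor_one)
  qed
  have srow: "(\<Sum>j\<in>UNIV. ?D i j) = 1" for i
  proof -
    have "(\<Sum>j\<in>UNIV. ?D i j) = (\<Sum>k\<in>UNIV. tensor (pgen i k) (\<Sum>j\<in>UNIV. pgen k j))"
      unfolding tensor_sum_right by (rule sum.swap)
    also have "\<dots> = (\<Sum>k\<in>UNIV. tensor (pgen i k) 1)"
      by (simp only: pgen_sum_row)
    also have "\<dots> = tensor (\<Sum>k\<in>UNIV. pgen i k) 1"
      by (rule tensor_sum_left[symmetric])
    finally show ?thesis by (simp add: pgen_sum_row tensor_one)
  qed
  have "abs_alg (comult_free r) = 0"
    using assms unfolding relators_word_def
    by (auto simp: comult_free_linear comult_free_mult comult_free_one comult_free_zero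
        times_alg.abs_eq[symmetric] minus_alg.abs_eq[symmetric] one_alg.abs_eq[symmetric]
        zero_alg.abs_eq[symmetric] abs_alg_sum abs_comult_letter row col scol srow)
  then show ?thesis by (simp add: alg_eq_0_iff)
qed

lemma comult_rel_ideal: "x \<in> rel_ideal \<Longrightarrow> comult_free x \<in> rel_ideal"
proof (induction rule: rel_ideal.induct)
  case (gen r a b)
  then show ?case
    by (simp add: comult_free_mult comult_relator rel_ideal_left rel_ideal_right)
qed (auto simp: comult_free_linear comult_free_zero intro: rel_ideal.intros)

lift_definition comult :: "'n::finite pol \<Rightarrow> 'n pol2" is comult_free
  using comult_rel_ideal by (metis comult_free_linear(2))

lemma comult_pgen: "comult (pgen i j) = (\<Sum>k\<in>UNIV. tensor (pgen i k) (pgen k j))"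
  unfolding pgen_abs[of i j] comult.abs_eq by (rule abs_comult_letter)

lemma comult_mult: "comult (x * y) = comult x * comult y"
  by transfer (simp add: comult_free_mult rel_ideal.zero)

lemma comult_one: "comult 1 = 1"
  by transfer (simp add: comult_free_one rel_ideal.zero)

lemma comult_add: "comult (x + y) = comult x + comult y"
  by transfer (simp add: comult_free_linear rel_ideal.zero)

section \<open>Unitary irreducible representations\<close>

definition representation :: "nat \<Rightarrow> 'n::finite pol mat \<Rightarrow> bool" where
  "representation d U \<longleftrightarrow> U \<in> carrier_mat d d \<and>
     (\<forall>i<d. \<forall>j<d. comult (U $$ (i, j)) = (\<Sum>k<d. tensor (U $$ (i, k)) (U $$ (k, j))))"

definition unitary :: "nat \<Rightarrow> 'n::finite pol mat \<Rightarrow> bool" where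
  "unitary d U \<longleftrightarrow> U \<in> carrier_mat d d \<and>
     U * map_mat star (transpose_mat U) = 1\<^sub>m d \<and> map_mat star (transpose_mat U) * U = 1\<^sub>m d"

text \<open>A subspace of \<open>\<complex>\<^sup>d\<close> with orthogonal projection \<open>P\<close> is invariant under \<open>U\<close> if
  \<open>U (P \<otimes> 1) = (P \<otimes> 1) U (P \<otimes> 1)\<close>.\<close>

definition invariant_projection :: "nat \<Rightarrow> 'n::finite pol mat \<Rightarrow> complex mat \<Rightarrow> bool" where
  "invariant_projection d U P \<longleftrightarrow> P \<in> carrier_mat d d \<and>
     P * P = P \<and> map_mat cnj (transpose_mat P) = P \<and>
     (let Q = map_mat (\<lambda>c. scale c 1) P in U * Q = Q * (U * Q))"

definition irreducible_rep :: "nat \<Rightarrow> 'n::finite pol mat \<Rightarrow> bool" where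
  "irreducible_rep d U \<longleftrightarrow> 0 < d \<and> representation d U \<and>
     (\<forall>P. invariant_projection d U P \<longrightarrow> P = 0\<^sub>m d d \<or> P = 1\<^sub>m d)"

definition unitary_irrep :: "nat \<Rightarrow> 'n::finite pol mat \<Rightarrow> bool" where
  "unitary_irrep d U \<longleftrightarrow> unitary d U \<and> irreducible_rep d U"

section \<open>Functionals\<close>

definition tracial :: "('n::finite pol \<Rightarrow> complex) \<Rightarrow> bool" where
  "tracial \<phi> \<longleftrightarrow> (\<forall>a b. \<phi> (a * b) = \<phi> (b * a))"

text \<open>All unitary irreducible representations are used instead of one from each
  class. This is the same condition, as \<open>c\<close> times the identity matrix is
  fixed under conjugation by unitary matrices.\<close>

definition central :: "('n::finite pol \<Rightarrow> complex) \<Rightarrow> bool" where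
  "central \<phi> \<longleftrightarrow> (\<forall>d U. unitary_irrep d U \<longrightarrow>
     (\<exists>c. \<forall>i<d. \<forall>j<d. \<phi> (U $$ (i, j)) = (if i = j then c else 0)))"

text \<open>The order on \<open>complex\<close> is the one of \<open>Complex_Order\<close>: \<open>0 \<le> z\<close> means that \<open>z\<close> is
  real and nonnegative.\<close>

definition state :: "('n::finite pol \<Rightarrow> complex) \<Rightarrow> bool" where
  "state \<phi> \<longleftrightarrow> Vector_Spaces.linear scale (*) \<phi> \<and> \<phi> 1 = 1 \<and> (\<forall>x. 0 \<le> \<phi> (star x * x))"

definition tracial_central_state :: "('n::finite pol \<Rightarrow> complex) \<Rightarrow> bool" where
  "tracial_central_state \<phi> \<longleftrightarrow> state \<phi> \<and> tracial \<phi> \<and> central \<phi>"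

text \<open>An irreducible representation is equivalent to the trivial one iff it is equal to the
  one-by-one matrix with entry 1.\<close>

definition haar_state :: "('n::finite pol \<Rightarrow> complex) \<Rightarrow> bool" where
  "haar_state h \<longleftrightarrow> state h \<and>
     (\<forall>d U. unitary_irrep d U \<and> U \<noteq> 1\<^sub>m 1 \<longrightarrow> (\<forall>i<d. \<forall>j<d. h (U $$ (i, j)) = 0))"

end

theory Submission
  imports Defs
begin

text \<open>Inside \<open>u\<^bsup>\<otimes>k\<^esup>\<close> take the functions \<open>f\<close> on words of length \<open>k\<close> that sum to zero in each
  variable and vanish when two adjacent letters agree. The functional sending the matrix
  \<open>u\<^bsup>\<otimes>k\<^esup>\<close> to the projection onto the span of the non-crossing partitions respects the
  defining relations. A non-crossing partition of \<open>2k\<close> points can pair two such functions only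
  through the nested pairing, which yields Schur orthogonality; hence these functions carry an
  irreducible representation \<open>U\<^sup>k\<close>, and a functional is determined by its values on the
  coefficients of all \<open>U\<^sup>k\<close>. A central \<open>\<phi>\<close> is a scalar \<open>c\<^sub>k\<close> on \<open>U\<^sup>k\<close>.

  If \<open>\<phi>\<close> is tracial, \<open>\<phi>(u\<^bsup>\<otimes>n\<^esup>)\<close> commutes with the cyclic rotation of the tensor factors. Doubling
  the last letter of a vector of \<open>U\<^sup>k\<close>, or appending \<open>\<Sum>\<^sub>j e\<^sub>j \<otimes> e\<^sub>j\<close>, and rotating once gives an
  eigenvector with eigenvalue \<open>c\<^sub>k\<close>. It is not orthogonal to \<open>U\<^bsup>k+1\<^esup>\<close> or \<open>U\<^bsup>k+2\<^esup>\<close>, as one sees by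
  pairing with a tensor \<open>a \<otimes> b \<otimes> a \<otimes> \<dots>\<close> of vectors with disjoint supports of three points each
  (here \<open>N \<ge> 6\<close> enters). So all \<open>c\<^sub>k\<close> with \<open>k > 0\<close> equal one number \<open>t\<close>, and
  \<open>\<phi> = t\<epsilon> + (1 - t)h\<close>. Positivity on an off-diagonal and on a diagonal coefficient of \<open>U\<^sup>k\<close> gives
  \<open>t \<le> 1\<close> and \<open>t + (1 - t) / dim U\<^sup>k \<ge> 0\<close>, and the dimensions are unbounded.\<close>

section \<open>Orthonormal bases of function spaces\<close>

definition ip :: "'x set \<Rightarrow> ('x \<Rightarrow> complex) \<Rightarrow> ('x \<Rightarrow> complex) \<Rightarrow> complex" where
  "ip X f g = (\<Sum>x\<in>X. cnj (f x) * g x)"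

definition orthonormal :: "'x set \<Rightarrow> nat \<Rightarrow> (nat \<Rightarrow> 'x \<Rightarrow> complex) \<Rightarrow> bool" where
  "orthonormal X d v \<longleftrightarrow> (\<forall>a<d. \<forall>b<d. ip X (v a) (v b) = (if a = b then 1 else 0))"

text \<open>Functions are total on their type but matter only on \<open>X\<close>; hence the
  expansion is demanded at points of \<open>X\<close> alone.\<close>

definition onb :: "'x set \<Rightarrow> ('x \<Rightarrow> complex) set \<Rightarrow> nat \<Rightarrow> (nat \<Rightarrow> 'x \<Rightarrow> complex) \<Rightarrow> bool" where
  "onb X S d v \<longleftrightarrow> (\<forall>a<d. v a \<in> S) \<and> orthonormal X d v \<and>
     (\<forall>f\<in>S. \<forall>x\<in>X. f x = (\<Sum>a<d. ip X (v a) f * v a x))"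

definition function_subspace :: "('x \<Rightarrow> complex) set \<Rightarrow> bool" where
  "function_subspace S \<longleftrightarrow> (\<lambda>_. 0) \<in> S \<and>
     (\<forall>f\<in>S. \<forall>g\<in>S. (\<lambda>x. f x + g x) \<in> S) \<and> (\<forall>f\<in>S. \<forall>c. (\<lambda>x. c * f x) \<in> S)"

lemma onb_mem: "onb X S d v \<Longrightarrow> a < d \<Longrightarrow> v a \<in> S"
  by (simp add: onb_def)

lemma onb_orthonormal: "onb X S d v \<Longrightarrow> orthonormal X d v"
  by (simp add: onb_def)

lemma onb_expand:
  assumes "onb X S d v" "f \<in> S" "x \<in> X"
  shows "f x = (\<Sum>a<d. ip X (v a) f * v a x)"
  using assms unfolding onb_def by blast

lemma function_subspace_add:
  "function_subspace S \<Longrightarrow> f \<in> S \<Longrightarrow> g \<in> S \<Longrightarrow> (\<lambda>x. f x + g x) \<in> S"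
  by (simp add: function_subspace_def)

lemma function_subspace_scale:
  "function_subspace S \<Longrightarrow> f \<in> S \<Longrightarrow> (\<lambda>x. c * f x) \<in> S"
  by (simp add: function_subspace_def)

lemma function_subspace_sum:
  assumes "function_subspace S" "\<And>a. a \<in> A \<Longrightarrow> f a \<in> S"
  shows "(\<lambda>x. \<Sum>a\<in>A. c a * f a x) \<in> S"
  using assms by (induction A rule: infinite_finite_induct) (auto simp: function_subspace_def)

lemma ip_cnj: "cnj (ip X f g) = ip X g f"
  by (simp add: ip_def mult.commute)

lemma ip_sum_right: "ip X f (\<lambda>x. \<Sum>a\<in>A. c a * g a x) = (\<Sum>a\<in>A. c a * ip X f (g a))"
  unfolding ip_def sum_distrib_left by (subst sum.swap) (simp add: algebra_simps)

lemma ip_diff_right: "ip X f (\<lambda>x. g x - g' x) = ip X f g - ip X f g'"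
  by (simp add: ip_def algebra_simps sum_subtractf)

lemma ip_scale_left: "ip X (\<lambda>x. c * f x) g = cnj c * ip X f g"
  by (simp add: ip_def algebra_simps sum_distrib_left)

lemma ip_scale_right: "ip X f (\<lambda>x. c * g x) = c * ip X f g"
  by (simp add: ip_def algebra_simps sum_distrib_left)

lemma ip_self: "ip X f f = of_real (\<Sum>x\<in>X. (cmod (f x))\<^sup>2)"
  by (simp add: ip_def complex_norm_square mult.commute del: of_real_power)

text \<open>Bessel's inequality for the point mass at \<open>x\<close>: its projection
  \<open>g\<close> onto the span has squared norm \<open>r\<close> and takes the value
  \<open>r\<close> at \<open>x\<close>, so \<open>r\<^sup>2 \<le> r\<close>.\<close>

lemma orthonormal_bessel:
  assumes "finite X" "orthonormal X d v" "x \<in> X"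
  shows "(\<Sum>a<d. (cmod (v a x))\<^sup>2) \<le> 1"
proof -
  define r where "r = (\<Sum>a<d. (cmod (v a x))\<^sup>2)"
  define g where "g = (\<lambda>y. \<Sum>a<d. cnj (v a x) * v a y)"
  have r: "of_real r = (\<Sum>a<d. v a x * cnj (v a x))"
    by (simp add: r_def complex_norm_square del: of_real_power)
  have gx: "g x = of_real r" by (simp add: g_def r mult.commute)
  have vg: "ip X (v b) g = cnj (v b x)" if "b < d" for b
  proof -
    have "ip X (v b) g = (\<Sum>a<d. if a = b then cnj (v a x) else 0)"
      unfolding g_def ip_sum_right using assms(2) that
      by (intro sum.cong) (auto simp: orthonormal_def)
    then show ?thesis using that by simp
  qed
  have "ip X g g = (\<Sum>a<d. cnj (v a x) * ip X g (v a))"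
    unfolding g_def[of] ip_sum_right by (simp add: g_def)
  also have "\<dots> = (\<Sum>a<d. cnj (v a x) * v a x)"
    using vg ip_cnj[of X _ g] by (intro sum.cong) (auto simp flip: ip_cnj[of X _ g])
  also have "\<dots> = of_real r" by (simp add: r mult.commute)
  finally have "(\<Sum>y\<in>X. (cmod (g y))\<^sup>2) = r" by (metis ip_self of_real_eq_iff)
  moreover have "(cmod (g x))\<^sup>2 \<le> (\<Sum>y\<in>X. (cmod (g y))\<^sup>2)"
    using assms by (intro member_le_sum) auto
  ultimately have "r\<^sup>2 \<le> r" by (simp add: gx)
  moreover have "0 \<le> r" by (simp add: r_def sum_nonneg)
  ultimately have "r \<le> 1"
    using mult_strict_left_mono[of 1 r r] by (cases "r \<le> 1") (auto simp: power2_eq_square)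
  then show ?thesis by (simp add: r_def)
qed

text \<open>The squared moduli are summed in both orders: the norms add up to \<open>d\<close>,
  while Bessel allows at most one for each point.\<close>

lemma orthonormal_dim_le:
  assumes "finite X" "orthonormal X d v" shows "d \<le> card X"
proof -
  have "(\<Sum>x\<in>X. (cmod (v a x))\<^sup>2) = 1" if "a < d" for a
  proof -
    have "of_real (\<Sum>x\<in>X. (cmod (v a x))\<^sup>2) = (1::complex)"
      using assms(2) that by (simp add: orthonormal_def del: of_real_sum flip: ip_self)
    then show ?thesis by (simp only: of_real_eq_1_iff)
  qed
  then have "real d = (\<Sum>a<d. \<Sum>x\<in>X. (cmod (v a x))\<^sup>2)" by simp
  also have "\<dots> = (\<Sum>x\<in>X. \<Sum>a<d. (cmod (v a x))\<^sup>2)" by (rule sum.swap)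
  also have "\<dots> \<le> (\<Sum>x\<in>X. 1)"
    using orthonormal_bessel[OF assms] by (intro sum_mono) auto
  finally show ?thesis by simp
qed

text \<open>Orthonormal families in \<open>S\<close> have bounded length, so a longest one exists.
  If an expansion failed at some point, the normalised remainder could be adjoined. The bound
  \<open>d0 \<le> d\<close> serves to show later that dimensions grow.\<close>

lemma onb_extend:
  assumes fin: "finite X" and S: "function_subspace S"
    and v0: "orthonormal X d0 v0" "\<And>a. a < d0 \<Longrightarrow> v0 a \<in> S"
  shows "\<exists>d v. onb X S d v \<and> d0 \<le> d"
proof -
  define P where "P = (\<lambda>d. \<exists>v. orthonormal X d v \<and> (\<forall>a<d. v a \<in> S))"
  have P0: "P d0" using v0 by (auto simp: P_def)
  have bd: "\<forall>d. P d \<longrightarrow> d \<le> card X" using orthonormal_dim_le[OF fin] by (auto simp: P_def)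
  define d where "d = Greatest P"
  have Pd: "P d" unfolding d_def by (rule GreatestI_nat[where P = P, OF P0]) (use bd in blast)
  have le: "d' \<le> d" if "P d'" for d' unfolding d_def
    by (rule Greatest_le_nat[where P = P, OF that]) (use bd in blast)
  obtain v where v: "orthonormal X d v" "\<And>a. a < d \<Longrightarrow> v a \<in> S"
    using Pd by (auto simp: P_def)
  have "f x = (\<Sum>a<d. ip X (v a) f * v a x)" if f: "f \<in> S" and x: "x \<in> X" for f x
  proof (rule ccontr)
    assume ne: "f x \<noteq> (\<Sum>a<d. ip X (v a) f * v a x)"
    define r where "r = (\<lambda>y. f y - (\<Sum>a<d. ip X (v a) f * v a y))"
    have "(\<lambda>y. \<Sum>a<d. ip X (v a) f * v a y) \<in> S"
      using function_subspace_sum[OF S, of "{..<d}" v "\<lambda>a. ip X (v a) f"] v(2) by simp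
    from function_subspace_scale[OF S this, of "- 1"]
    have "(\<lambda>y. f y + (- 1) * (\<Sum>a<d. ip X (v a) f * v a y)) \<in> S"
      by (rule function_subspace_add[OF S f])
    then have rS: "r \<in> S" by (simp add: r_def)
    have vr: "ip X (v b) r = 0" if "b < d" for b
    proof -
      have "(\<Sum>a<d. ip X (v a) f * ip X (v b) (v a)) = (\<Sum>a<d. if a = b then ip X (v a) f else 0)"
        using v(1) that by (intro sum.cong) (auto simp: orthonormal_def)
      then show ?thesis using that by (simp add: r_def ip_diff_right ip_sum_right)
    qed
    then have rv: "ip X r (v b) = 0" if "b < d" for b
      using that ip_cnj[of X "v b" r] by simp
    define n where "n = (\<Sum>y\<in>X. (cmod (r y))\<^sup>2)"
    have "0 < (cmod (r x))\<^sup>2" using ne by (simp add: r_def)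
    also have "\<dots> \<le> n" unfolding n_def using fin x by (intro member_le_sum) auto
    finally have n: "0 < n" .
    define c where "c = complex_of_real (1 / sqrt n)"
    have cc: "c * (cnj c * of_real n) = 1"
      using n by (simp add: c_def field_simps flip: of_real_mult)
    define w where "w = (\<lambda>a. if a < d then v a else (\<lambda>y. c * r y))"
    have "orthonormal X (Suc d) w"
      unfolding orthonormal_def w_def using v(1) vr rv cc
      by (auto simp: orthonormal_def ip_scale_left ip_scale_right ip_self[of X r] less_Suc_eq
          simp flip: n_def)
    moreover have "w a \<in> S" if "a < Suc d" for a
      using v(2) rS S by (auto simp: w_def function_subspace_def)
    ultimately have "P (Suc d)" by (auto simp: P_def)
    then show False using le by fastforce
  qed
  then have "onb X S d v" using v by (auto simp: onb_def)
  then show ?thesis using le[OF P0] by blast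
qed

lemma onb_exists:
  assumes "finite X" "function_subspace S"
  shows "\<exists>d v. onb X S d v"
  using onb_extend[OF assms, of 0] by (auto simp: orthonormal_def)

text \<open>If \<open>A\<close> maps \<open>S\<close> to \<open>S'\<close> and its adjoint \<open>B\<close> maps \<open>S'\<close> to \<open>S\<close>, then \<open>A\<close> intertwines the
  orthogonal projections onto \<open>S\<close> and \<open>S'\<close>.\<close>

lemma onb_intertwine:
  assumes v: "onb X S d v" and w: "onb Y S' d' w"
    and A: "\<And>f. f \<in> S \<Longrightarrow> A f \<in> S'" and B: "\<And>g. g \<in> S' \<Longrightarrow> B g \<in> S"
    and adj: "\<And>f g. f \<in> S \<Longrightarrow> g \<in> S' \<Longrightarrow> ip Y g (A f) = ip X (B g) f"
    and x: "x \<in> X" and y: "y \<in> Y"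
  shows "(\<Sum>a<d. A (v a) y * cnj (v a x)) = (\<Sum>b<d'. w b y * cnj (B (w b) x))"
proof -
  have vS: "v a \<in> S" if "a < d" for a using v that by (auto simp: onb_def)
  have wS: "w a \<in> S'" if "a < d'" for a using w that by (auto simp: onb_def)
  have "(\<Sum>a<d. A (v a) y * cnj (v a x)) = (\<Sum>a<d. (\<Sum>b<d'. ip Y (w b) (A (v a)) * w b y) * cnj (v a x))"
    using w A[OF vS] y by (intro sum.cong) (auto simp: onb_def)
  also have "\<dots> = (\<Sum>a<d. \<Sum>b<d'. w b y * cnj (ip X (v a) (B (w b)) * v a x))"
    by (auto intro!: sum.cong simp: adj vS wS sum_distrib_left ip_cnj mult_ac)
  also have "\<dots> = (\<Sum>b<d'. w b y * cnj (\<Sum>a<d. ip X (v a) (B (w b)) * v a x))"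
    by (subst sum.swap) (simp add: sum_distrib_left)
  also have "\<dots> = (\<Sum>b<d'. w b y * cnj (B (w b) x))"
  proof (intro sum.cong refl)
    fix b assume "b \<in> {..<d'}"
    then have "B (w b) \<in> S" using B wS by auto
    then have "B (w b) x = (\<Sum>a<d. ip X (v a) (B (w b)) * v a x)"
      using v x by (auto simp: onb_def)
    then show "w b y * cnj (\<Sum>a<d. ip X (v a) (B (w b)) * v a x) = w b y * cnj (B (w b) x)"
      by simp
  qed
  finally show ?thesis .
qed

section \<open>Functions on words\<close>

definition words :: "nat \<Rightarrow> 'n list set" where
  "words k = {w. length w = k}"

lemma in_words [simp]: "w \<in> words k \<longleftrightarrow> length w = k"
  by (simp add: words_def)

lemma finite_words [simp]: "finite (words k :: 'n::finite list set)"
  using finite_lists_length_eq[of "UNIV :: 'n set" k] by (simp add: words_def)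

lemma words_0 [simp]: "words 0 = {[]}"
  by (auto simp: words_def)

lemma sum_words_append:
  "(\<Sum>w\<in>words (a + b). f w) = (\<Sum>l\<in>words a. \<Sum>m\<in>words b. f (l @ m))"
proof -
  have "(\<Sum>w\<in>words (a + b). f w) = (\<Sum>(l, m)\<in>words a \<times> words b. f (l @ m))"
    by (rule sum.reindex_bij_witness[of _ "\<lambda>(l, m). l @ m" "\<lambda>w. (take a w, drop a w)"]) auto
  then show ?thesis by (simp add: sum.cartesian_product)
qed

lemma sum_words_1: "(\<Sum>w\<in>words (Suc 0). f w) = (\<Sum>x\<in>UNIV. f [x])"
  by (rule sum.reindex_bij_witness[of _ "\<lambda>x. [x]" hd]) (auto simp: length_Suc_conv)

lemma sum_words_Suc: "(\<Sum>w\<in>words (Suc b). f w) = (\<Sum>x\<in>UNIV. \<Sum>m\<in>words b. f (x # m))"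
  using sum_words_append[of f "Suc 0" b] by (simp add: sum_words_1)

lemma sum_words_snoc: "(\<Sum>w\<in>words (Suc a). f w) = (\<Sum>l\<in>words a. \<Sum>x\<in>UNIV. f (l @ [x]))"
  using sum_words_append[of f a "Suc 0"] by (simp add: sum_words_1)

lemma sum_words_split:
  "(\<Sum>w\<in>words (Suc (a + b)). f w) = (\<Sum>l\<in>words a. \<Sum>m\<in>words b. \<Sum>x\<in>UNIV. f (l @ x # m))"
proof -
  have "(\<Sum>w\<in>words (Suc (a + b)). f w) = (\<Sum>l\<in>words a. \<Sum>m\<in>words (Suc b). f (l @ m))"
    using sum_words_append[of f a "Suc b"] by simp
  also have "\<dots> = (\<Sum>l\<in>words a. \<Sum>m\<in>words b. \<Sum>x\<in>UNIV. f (l @ x # m))"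
    unfolding sum_words_Suc by (subst (2) sum.swap) simp
  finally show ?thesis .
qed

text \<open>These functions carry the irreducible representation of highest weight in \<open>u\<^bsup>\<otimes>k\<^esup>\<close>.\<close>

definition reduced :: "nat \<Rightarrow> ('n::finite list \<Rightarrow> 'b::comm_monoid_add) \<Rightarrow> bool" where
  "reduced k f \<longleftrightarrow>
     (\<forall>l m. length l + length m + 1 = k \<longrightarrow> (\<Sum>x\<in>UNIV. f (l @ x # m)) = 0) \<and>
     (\<forall>l x m. length l + length m + 2 = k \<longrightarrow> f (l @ x # x # m) = 0)"

lemma reducedD_sum:
  "reduced k f \<Longrightarrow> length l + length m + 1 = k \<Longrightarrow> (\<Sum>x\<in>UNIV. f (l @ x # m)) = 0"
  by (simp add: reduced_def)

lemma reducedD_eq: "reduced k f \<Longrightarrow> length l + length m + 2 = k \<Longrightarrow> f (l @ x # x # m) = 0"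
  by (simp add: reduced_def)

lemma function_subspace_reduced: "function_subspace {f. reduced k f}"
  by (auto simp: function_subspace_def reduced_def sum.distrib simp flip: sum_distrib_left)

lemma reduced_cnj: "reduced k f \<Longrightarrow> reduced k (\<lambda>w. cnj (f w))"
  by (auto simp: reduced_def simp flip: cnj_sum)

lemma reduced_snoc: "reduced (Suc k) f \<Longrightarrow> reduced k (\<lambda>w. f (w @ [x]))"
  by (auto simp: reduced_def)

section \<open>Non-crossing functions\<close>

definition del :: "nat \<Rightarrow> 'a list \<Rightarrow> 'a list" where
  "del p w = take p w @ drop (Suc p) w"

definition dupl :: "nat \<Rightarrow> 'a list \<Rightarrow> 'a list" where
  "dupl p w = take (Suc p) w @ drop p w"

definition ins :: "nat \<Rightarrow> 'a \<Rightarrow> 'a list \<Rightarrow> 'a list" where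
  "ins p x w = take p w @ x # drop p w"

lemma length_del [simp]: "p < length w \<Longrightarrow> length (del p w) = length w - 1"
  by (auto simp: del_def)

lemma length_dupl [simp]: "p < length w \<Longrightarrow> length (dupl p w) = Suc (length w)"
  by (auto simp: dupl_def)

lemma length_ins [simp]: "p \<le> length w \<Longrightarrow> length (ins p x w) = Suc (length w)"
  by (auto simp: ins_def)

lemma nth_del: "p < length w \<Longrightarrow> i < length w - 1 \<Longrightarrow> del p w ! i = (if i < p then w ! i else w ! Suc i)"
  by (auto simp: del_def nth_append min_def)

lemma nth_dupl: "p < length w \<Longrightarrow> i < Suc (length w) \<Longrightarrow> dupl p w ! i = (if i \<le> p then w ! i else w ! (i - 1))"
  by (cases "p = length w - 1") (auto simp: dupl_def nth_append min_def less_Suc_eq_le)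

lemma nth_ins: "p \<le> length w \<Longrightarrow> i < Suc (length w) \<Longrightarrow>
    ins p x w ! i = (if i < p then w ! i else if i = p then x else w ! (i - 1))"
  by (auto simp: ins_def nth_append min_def nth_Cons')

lemma del_append: "length l = p \<Longrightarrow> del p (l @ x # m) = l @ m"
  by (auto simp: del_def)

lemma dupl_append: "length l = p \<Longrightarrow> dupl p (l @ x # m) = l @ x # x # m"
  by (auto simp: dupl_def)

lemma ins_append: "length l = p \<Longrightarrow> ins p x (l @ m) = l @ x # m"
  by (auto simp: ins_def)

text \<open>Deletion and doubling obey the simplicial identities, and deletion and insertion obey
  similar ones. They let a contraction move past the last operation that built a non-crossing
  function.\<close>

lemma del_dupl_same:
  assumes "p < length w" "q = p \<or> q = Suc p" shows "del q (dupl p w) = w"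
  using assms by (auto simp: del_def dupl_def min_def Cons_nth_drop_Suc simp flip: append_assoc take_Suc_conv_app_nth)

lemma del_dupl_less:
  assumes "p < length w" "q < p" shows "del q (dupl p w) = dupl (p - 1) (del q w)"
proof (rule nth_equalityI)
  fix i assume "i < length (del q (dupl p w))"
  then show "del q (dupl p w) ! i = dupl (p - 1) (del q w) ! i"
    using assms by (cases "i < q"; cases "i < p") (simp_all add: nth_del nth_dupl, arith+)
qed (use assms in simp)

lemma del_dupl_greater:
  assumes "q \<le> length w" "Suc p < q" shows "del q (dupl p w) = dupl p (del (q - 1) w)"
proof (rule nth_equalityI)
  fix i assume "i < length (del q (dupl p w))"
  then show "del q (dupl p w) ! i = dupl p (del (q - 1) w) ! i"
    using assms by (cases "i < q"; cases "i \<le> p") (simp_all add: nth_del nth_dupl, arith+)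
qed (use assms in simp)

lemma del_ins_same: "p \<le> length w \<Longrightarrow> del p (ins p x w) = w"
  by (simp add: del_def ins_def min_def)

lemma del_ins_less:
  assumes "p \<le> length w" "q < p" shows "del q (ins p x w) = ins (p - 1) x (del q w)"
proof (rule nth_equalityI)
  fix i assume "i < length (del q (ins p x w))"
  then show "del q (ins p x w) ! i = ins (p - 1) x (del q w) ! i"
    using assms by (cases "i < q"; cases "i < p") (simp_all add: nth_del nth_ins, arith+)
qed (use assms in simp)

lemma del_ins_greater:
  assumes "q \<le> length w" "p < q" shows "del q (ins p x w) = ins p x (del (q - 1) w)"
proof (rule nth_equalityI)
  fix i assume "i < length (del q (ins p x w))"
  then show "del q (ins p x w) ! i = ins p x (del (q - 1) w) ! i"
    using assms by (cases "i < q"; cases "i \<le> p") (simp_all add: nth_del nth_ins, arith+)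
qed (use assms in simp)

lemmas del_dupl = del_dupl_same del_dupl_less del_dupl_greater
lemmas del_ins = del_ins_same del_ins_less del_ins_greater

text \<open>The span of the indicator functions of the non-crossing partitions of \<open>n\<close> points: every
  such partition arises by inserting singletons and by doubling points.\<close>

inductive noncrossing :: "nat \<Rightarrow> ('n::finite list \<Rightarrow> complex) \<Rightarrow> bool" where
  unit: "noncrossing 0 (\<lambda>_. 1)"
| insert: "noncrossing n f \<Longrightarrow> p \<le> n \<Longrightarrow> noncrossing (Suc n) (\<lambda>w. f (del p w))"
| double: "noncrossing n f \<Longrightarrow> p < n \<Longrightarrow>
    noncrossing (Suc n) (\<lambda>w. if w ! p = w ! Suc p then f (del p w) else 0)"
| zero: "noncrossing n (\<lambda>_. 0)"
| add: "noncrossing n f \<Longrightarrow> noncrossing n g \<Longrightarrow> noncrossing n (\<lambda>w. f w + g w)"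
| scale: "noncrossing n f \<Longrightarrow> noncrossing n (\<lambda>w. c * f w)"
| cong: "noncrossing n f \<Longrightarrow> (\<And>w. length w = n \<Longrightarrow> g w = f w) \<Longrightarrow> noncrossing n g"

lemma function_subspace_noncrossing: "function_subspace {f. noncrossing n f}"
  by (auto simp: function_subspace_def intro: noncrossing.intros)

text \<open>These are the adjoints of doubling and of inserting a singleton. By induction on the
  construction, an adjoint either cancels against the last generating operation or commutes with it.
  Invariance under the adjoints is what \<open>onb_intertwine\<close> requires.\<close>

lemma noncrossing_contract:
  assumes "noncrossing n g"
  shows "\<And>m p. n = Suc m \<Longrightarrow> p < m \<Longrightarrow> noncrossing m (\<lambda>w. g (dupl p w))"
    and "\<And>m p. n = Suc m \<Longrightarrow> p \<le> m \<Longrightarrow> noncrossing m (\<lambda>w. \<Sum>x\<in>UNIV. g (ins p x w))"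
  using assms
proof (induction rule: noncrossing.induct)
  case (insert n f q)
  { case (1 m p)
    then have n: "m = n" by simp
    consider "q = p \<or> q = Suc p" | "q < p" | "Suc p < q" by linarith
    then show ?case
    proof cases
      case 1
      show ?thesis unfolding n
        by (rule noncrossing.cong[OF insert.hyps(1)]) (use 1 \<open>p < m\<close> n in \<open>auto simp: del_dupl\<close>)
    next
      case 2
      with \<open>p < m\<close> n obtain m' where m': "n = Suc m'" "p - 1 < m'" by (cases n) auto
      show ?thesis unfolding n m'(1)
        by (rule noncrossing.cong[OF noncrossing.insert[OF insert.IH(1)[OF m'], of q]])
          (use 2 \<open>p < m\<close> n m' in \<open>auto simp: del_dupl\<close>)
    next
      case 3
      with \<open>p < m\<close> \<open>q \<le> n\<close> n obtain m' where m': "n = Suc m'" "p < m'" by (cases n) auto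
      show ?thesis unfolding n m'(1)
        by (rule noncrossing.cong[OF noncrossing.insert[OF insert.IH(1)[OF m'], of "q - 1"]])
          (use 3 \<open>q \<le> n\<close> n m' in \<open>auto simp: del_dupl\<close>)
    qed
  next
    case (2 m p)
    then have n: "m = n" by simp
    consider "q = p" | "q < p" | "p < q" by linarith
    then show ?case
    proof cases
      case 1
      \<comment> \<open>Summing out an isolated point only produces the number of letters as a
        factor.\<close>
      show ?thesis unfolding n
        by (rule noncrossing.cong[OF noncrossing.scale[OF insert.hyps(1), of "of_nat CARD('a)"]])
          (use 1 2 n in \<open>auto simp: del_ins\<close>)
    next
      case q: 2
      with \<open>p \<le> m\<close> n obtain m' where m': "n = Suc m'" "p - 1 \<le> m'" by (cases n) auto
      show ?thesis unfolding n m'(1)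
        by (rule noncrossing.cong[OF noncrossing.insert[OF insert.IH(2)[OF m'], of q]])
          (use q \<open>p \<le> m\<close> n m' in \<open>auto simp: del_ins\<close>)
    next
      case q: 3
      with \<open>p \<le> m\<close> \<open>q \<le> n\<close> n obtain m' where m': "n = Suc m'" "p \<le> m'" by (cases n) auto
      show ?thesis unfolding n m'(1)
        by (rule noncrossing.cong[OF noncrossing.insert[OF insert.IH(2)[OF m'], of "q - 1"]])
          (use q \<open>q \<le> n\<close> n m' in \<open>auto simp: del_ins\<close>)
    qed
  }
next
  case (double n f q)
  { case (1 m p)
    then have n: "m = n" by simp
    consider "q = p" | "q < p" | "p < q" by linarith
    then show ?case
    proof cases
      case 1
      show ?thesis unfolding n
        by (rule noncrossing.cong[OF double.hyps(1)]) (use 1 \<open>p < m\<close> n in \<open>auto simp: del_dupl nth_dupl\<close>)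
    next
      case 2
      with \<open>p < m\<close> n obtain m' where m': "n = Suc m'" "p - 1 < m'" by (cases n) auto
      show ?thesis unfolding n m'(1)
        by (rule noncrossing.cong[OF noncrossing.double[OF double.IH(1)[OF m'], of q]])
          (use 2 \<open>p < m\<close> n m' in \<open>auto simp: del_dupl nth_dupl\<close>)
    next
      case 3
      with \<open>p < m\<close> \<open>q < n\<close> n obtain m' where m': "n = Suc m'" "p < m'" by (cases n) auto
      \<comment> \<open>For \<open>q = Suc p\<close> the deletion undoes the doubling and leaves
        \<open>f w\<close>, which has to be brought into the form
        \<open>f (dupl p (del p w))\<close>; the condition that two letters agree permits
        this.\<close>
      have fx: "dupl p (del p w) = w" if "w ! p = w ! Suc p" "Suc p < length w" for w :: "'a list"
        using that by (intro nth_equalityI) (auto simp: nth_del nth_dupl not_le le_Suc_eq)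
      have "(if dupl p w ! q = dupl p w ! Suc q then f (del q (dupl p w)) else 0)
          = (if w ! (q - 1) = w ! Suc (q - 1) then f (dupl p (del (q - 1) w)) else 0)"
        if "length w = n" for w
        using that 3 \<open>q < n\<close> by (cases "q = Suc p") (auto simp: del_dupl nth_dupl fx)
      then show ?thesis unfolding n m'(1)
        by (intro noncrossing.cong[OF noncrossing.double[OF double.IH(1)[OF m'], of "q - 1"]])
          (use 3 \<open>q < n\<close> n m' in auto)
    qed
  next
    case (2 m p)
    then have n: "m = n" by simp
    consider "q = p" | "p = Suc q" | "Suc q < p" | "p < q" by linarith
    then show ?case
    proof cases
      case 1
      \<comment> \<open>If the summed point is one of the two compared points, here or in the next
        case, only the letter equal to its partner survives, and the sum collapses to
        \<open>f w\<close>.\<close>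
      show ?thesis unfolding n
        by (rule noncrossing.cong[OF double.hyps(1)])
          (use 1 \<open>q < n\<close> n in \<open>auto simp: del_ins nth_ins\<close>)
    next
      case q: 2
      have fx: "ins q (w ! q) (del q w) = w" if "q < length w" for w :: "'a list"
        using that by (intro nth_equalityI) (auto simp: nth_del nth_ins)
      show ?thesis unfolding n
        by (rule noncrossing.cong[OF double.hyps(1)])
          (use q \<open>q < n\<close> n in \<open>auto simp: del_ins nth_ins fx\<close>)
    next
      case q: 3
      with \<open>p \<le> m\<close> n obtain m' where m': "n = Suc m'" "p - 1 \<le> m'" by (cases n) auto
      show ?thesis unfolding n m'(1)
        by (rule noncrossing.cong[OF noncrossing.double[OF double.IH(2)[OF m'], of q]])
          (use q \<open>p \<le> m\<close> n m' in \<open>auto simp: del_ins nth_ins\<close>)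
    next
      case q: 4
      with \<open>p \<le> m\<close> \<open>q < n\<close> n obtain m' where m': "n = Suc m'" "p \<le> m'" by (cases n) auto
      show ?thesis unfolding n m'(1)
        by (rule noncrossing.cong[OF noncrossing.double[OF double.IH(2)[OF m'], of "q - 1"]])
          (use q \<open>q < n\<close> n m' in \<open>auto simp: del_ins nth_ins\<close>)
    qed
  }
next
  case (add n f g)
  { case 1 then show ?case using add by (auto intro: noncrossing.add) next
    case 2 then show ?case using add by (auto simp: sum.distrib intro: noncrossing.add) }
next
  case (scale n f c)
  { case 1 then show ?case using scale by (auto intro: noncrossing.scale) next
    case 2 then show ?case using scale by (auto simp flip: sum_distrib_left intro: noncrossing.scale) }
next
  case (cong n f g)
  { case (1 m p)
    show ?case by (rule noncrossing.cong[OF cong.IH(1)[OF 1]]) (use 1 cong in auto)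
  next
    case (2 m p)
    show ?case by (rule noncrossing.cong[OF cong.IH(2)[OF 2]]) (use 2 cong in auto) }
qed (auto intro: noncrossing.zero)

section \<open>Pairing reduced functions through non-crossing functions\<close>

lemma del_append1: "q < length v \<Longrightarrow> del q (v @ u) = del q v @ u"
  by (simp add: del_def)

lemma del_append2: "length v \<le> q \<Longrightarrow> del q (v @ u) = v @ del (q - length v) u"
  by (simp add: del_def Suc_diff_le)

lemma del_rev: "q < length w \<Longrightarrow> del q (rev w) = rev (del (length w - Suc q) w)"
  by (simp add: del_def take_rev drop_rev Suc_diff_Suc)

text \<open>The factor \<open>G (del q v)\<close> does not depend on the letter at \<open>q\<close>,
  and a reduced function sums to zero in that letter.\<close>

lemma reduced_sum_del:
  fixes f :: "'n::finite list \<Rightarrow> complex"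
  assumes "reduced a f" "q < a"
  shows "(\<Sum>v\<in>words a. f v * G (del q v)) = 0"
proof -
  obtain r where a: "a = Suc (q + r)" using assms(2) less_iff_Suc_add by blast
  have "(\<Sum>x\<in>UNIV. f (l @ x # m)) = 0" if "length l = q" "length m = r" for l m
    using reducedD_sum[OF assms(1), of l m] that a by simp
  then show ?thesis
    unfolding a sum_words_split by (simp add: del_append flip: sum_distrib_right)
qed

lemma reduced_nth_eq:
  assumes "reduced a f" "Suc q < a" "length v = a" "v ! q = v ! Suc q"
  shows "f v = 0"
proof -
  have "v = take q v @ v ! q # v ! Suc q # drop (Suc (Suc q)) v"
    using assms by (metis Cons_nth_drop_Suc Suc_lessD append_take_drop_id)
  then have "f v = f (take q v @ v ! q # v ! q # drop (Suc (Suc q)) v)"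
    using assms(4) by simp
  also have "\<dots> = 0" using assms by (intro reducedD_eq[OF assms(1)]) auto
  finally show ?thesis .
qed

text \<open>A non-crossing function on \<open>a + b\<close> points can pair reduced functions \<open>f\<^sub>1\<close>, \<open>f\<^sub>2\<close> only
  through the partition that joins the \<open>i\<close>-th point of \<open>f\<^sub>1\<close> with the \<open>i\<close>-th point of \<open>f\<^sub>2\<close>. The
  second statement is the intermediate stage where the innermost points are already
  identified.\<close>

lemma noncrossing_pairing:
  fixes g :: "'n::finite list \<Rightarrow> complex"
  assumes "noncrossing n g"
  shows noncrossing_pairing_even: "\<And>a b. a + b = n \<Longrightarrow> \<exists>c. \<forall>f1 f2. reduced a f1 \<longrightarrow> reduced b f2 \<longrightarrow>
      (\<Sum>v\<in>words a. \<Sum>w\<in>words b. f1 v * f2 w * g (v @ rev w))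
        = (if a = b then c * (\<Sum>v\<in>words a. f1 v * f2 v) else 0)"
    and "\<And>a b. Suc (a + b) = n \<Longrightarrow> \<exists>c. \<forall>f1 f2. reduced (Suc a) f1 \<longrightarrow> reduced (Suc b) f2 \<longrightarrow>
      (\<Sum>v\<in>words a. \<Sum>w\<in>words b. \<Sum>x\<in>UNIV. f1 (v @ [x]) * f2 (w @ [x]) * g (v @ x # rev w))
        = (if a = b then c * (\<Sum>v\<in>words (Suc a). f1 v * f2 v) else 0)"
  using assms
proof (induction rule: noncrossing.induct)
  case unit
  { case (1 a b) then show ?case by auto next
    case (2 a b) then show ?case by auto }
next
  case (insert n f q)
  { case (1 a b)
    have "(\<Sum>v\<in>words a. \<Sum>w\<in>words b. f1 v * f2 w * f (del q (v @ rev w))) = 0"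
      if f1: "reduced a f1" and f2: "reduced b f2" for f1 f2
    proof (cases "q < a")
      case True
      have "(\<Sum>v\<in>words a. \<Sum>w\<in>words b. f1 v * f2 w * f (del q (v @ rev w)))
          = (\<Sum>v\<in>words a. f1 v * (\<Sum>w\<in>words b. f2 w * f (del q v @ rev w)))"
        using True by (simp add: del_append1 sum_distrib_left mult.assoc)
      then show ?thesis
        using reduced_sum_del[OF f1 True, of "\<lambda>v. \<Sum>w\<in>words b. f2 w * f (v @ rev w)"] by simp
    next
      case False
      \<comment> \<open>The second word enters reversed, so position \<open>q\<close> of
        \<open>v @ rev w\<close> is position \<open>b - Suc (q - a)\<close> of
        \<open>w\<close>.\<close>
      with 1 insert.hyps(2) have q: "b - Suc (q - a) < b" "q - a < b" by auto
      have "(\<Sum>v\<in>words a. \<Sum>w\<in>words b. f1 v * f2 w * f (del q (v @ rev w)))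
          = (\<Sum>v\<in>words a. \<Sum>w\<in>words b. f2 w * (f1 v * f (v @ rev (del (b - Suc (q - a)) w))))"
        using False q by (simp add: del_append2 del_rev mult_ac)
      then show ?thesis
        using reduced_sum_del[OF f2 q(1), of "\<lambda>w. f1 v * f (v @ rev w)" for v] by simp
    qed
    then show ?case by (intro exI[of _ 0]) simp
  next
    case (2 a b)
    then have n: "a + b = n" by simp
    from insert.IH(1)[OF n] obtain c where c: "\<forall>f1 f2. reduced a f1 \<longrightarrow> reduced b f2 \<longrightarrow>
      (\<Sum>v\<in>words a. \<Sum>w\<in>words b. f1 v * f2 w * f (v @ rev w))
        = (if a = b then c * (\<Sum>v\<in>words a. f1 v * f2 v) else 0)" by blast
    have "(\<Sum>v\<in>words a. \<Sum>w\<in>words b. \<Sum>x\<in>UNIV. f1 (v @ [x]) * f2 (w @ [x]) * f (del q (v @ x # rev w)))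
        = (if a = b then (if q = a then c else 0) * (\<Sum>v\<in>words (Suc a). f1 v * f2 v) else 0)"
      (is "?L = ?R") if f1: "reduced (Suc a) f1" and f2: "reduced (Suc b) f2" for f1 f2
    proof -
      have L: "?L = (\<Sum>x\<in>UNIV. \<Sum>v\<in>words a. \<Sum>w\<in>words b.
          f1 (v @ [x]) * f2 (w @ [x]) * f (del q (v @ x # rev w)))"
        by (simp only: sum.swap[of _ UNIV])
      note f1' = reduced_snoc[OF f1] and f2' = reduced_snoc[OF f2]
      consider "q < a" | "q = a" | "a < q" by linarith
      then show ?thesis
      proof cases
        case q: 1
        have "(\<Sum>v\<in>words a. \<Sum>w\<in>words b. f1 (v @ [x]) * f2 (w @ [x]) * f (del q (v @ x # rev w))) = 0" for x
        proof -
          have "(\<Sum>v\<in>words a. \<Sum>w\<in>words b. f1 (v @ [x]) * f2 (w @ [x]) * f (del q (v @ x # rev w)))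
              = (\<Sum>v\<in>words a. f1 (v @ [x]) * (\<Sum>w\<in>words b. f2 (w @ [x]) * f (del q v @ x # rev w)))"
            using q by (simp add: del_append1 sum_distrib_left mult.assoc)
          then show ?thesis
            using reduced_sum_del[OF f1' q, of x "\<lambda>v. \<Sum>w\<in>words b. f2 (w @ [x]) * f (v @ x # rev w)"] by simp
        qed
        then show ?thesis unfolding L using q by simp
      next
        case q: 2
        \<comment> \<open>The singleton is the shared innermost point. For fixed \<open>x\<close>
          the first statement applies to the functions with last letter \<open>x\<close>; summing
          over \<open>x\<close> restores words of length \<open>Suc a\<close>.\<close>
        have "?L = (\<Sum>x\<in>UNIV. if a = b then c * (\<Sum>v\<in>words a. f1 (v @ [x]) * f2 (v @ [x])) else 0)"
          unfolding L using c f1' f2' by (intro sum.cong refl) (simp add: q del_append)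
        also have "\<dots> = ?R"
          by (simp add: q sum_words_snoc sum.swap[of _ UNIV] flip: sum_distrib_left)
        finally show ?thesis .
      next
        case q: 3
        with n insert.hyps(2) have q': "b - Suc (q - Suc a) < b" "q - Suc a < b" by auto
        have "(\<Sum>v\<in>words a. \<Sum>w\<in>words b. f1 (v @ [x]) * f2 (w @ [x]) * f (del q (v @ x # rev w))) = 0" for x
        proof -
          have d: "del q (v @ x # rev w) = v @ x # rev (del (b - Suc (q - Suc a)) w)"
            if "length v = a" "length w = b" for v w
            using that q q' del_append2[of "v @ [x]" q "rev w"] by (simp add: del_rev)
          have "(\<Sum>v\<in>words a. \<Sum>w\<in>words b. f1 (v @ [x]) * f2 (w @ [x]) * f (del q (v @ x # rev w)))
              = (\<Sum>v\<in>words a. \<Sum>w\<in>words b. f2 (w @ [x]) * (f1 (v @ [x]) * f (v @ x # rev (del (b - Suc (q - Suc a)) w))))"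
            by (intro sum.cong refl) (simp add: d mult_ac)
          then show ?thesis
            using reduced_sum_del[OF f2' q'(1), of x "\<lambda>w. f1 (v @ [x]) * f (v @ x # rev w)" for v] by simp
        qed
        then show ?thesis unfolding L using q by simp
      qed
    qed
    then show ?case by blast
  }
next
  case (double n f q)
  { case (1 a b)
    show ?case
    proof (cases "Suc q = a")
      case True
      \<comment> \<open>The doubled point joins the last letters of the two words, which is the
        situation of the second statement.\<close>
      with 1 double.hyps(2) obtain b' where b: "b = Suc b'" "Suc (q + b') = n" by (cases b) auto
      from double.IH(2)[OF b(2)] obtain c where c: "\<forall>f1 f2. reduced (Suc q) f1 \<longrightarrow> reduced (Suc b') f2 \<longrightarrow>
        (\<Sum>v\<in>words q. \<Sum>w\<in>words b'. \<Sum>x\<in>UNIV. f1 (v @ [x]) * f2 (w @ [x]) * f (v @ x # rev w))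
          = (if q = b' then c * (\<Sum>v\<in>words (Suc q). f1 v * f2 v) else 0)" by blast
      have e: "(\<Sum>v\<in>words a. \<Sum>w\<in>words b. f1 v * f2 w *
          (if (v @ rev w) ! q = (v @ rev w) ! Suc q then f (del q (v @ rev w)) else 0))
        = (\<Sum>v\<in>words q. \<Sum>w\<in>words b'. \<Sum>x\<in>UNIV. f1 (v @ [x]) * f2 (w @ [x]) * f (v @ x # rev w))" for f1 f2
      proof -
        have "(\<Sum>v\<in>words a. \<Sum>w\<in>words b. f1 v * f2 w *
            (if (v @ rev w) ! q = (v @ rev w) ! Suc q then f (del q (v @ rev w)) else 0))
          = (\<Sum>v\<in>words q. \<Sum>x\<in>UNIV. \<Sum>w\<in>words b'. \<Sum>y\<in>UNIV.
              if x = y then f1 (v @ [x]) * f2 (w @ [y]) * f (v @ y # rev w) else 0)"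
          unfolding True[symmetric] b(1) sum_words_snoc
          by (intro sum.cong refl) (simp add: nth_append del_append)
        then show ?thesis by (simp add: sum.swap[of _ UNIV])
      qed
      show ?thesis unfolding e using c True b by auto
    next
      case False
      \<comment> \<open>Elsewhere both compared letters lie in one word, and reduced functions
        vanish when adjacent letters agree.\<close>
      have z: "f1 v * f2 w * (if (v @ rev w) ! q = (v @ rev w) ! Suc q then f (del q (v @ rev w)) else 0) = 0"
        if f1: "reduced a f1" and f2: "reduced b f2" and len: "length v = a" "length w = b" for f1 f2 v w
      proof (cases "q < a")
        case True
        then show ?thesis using False reduced_nth_eq[OF f1, of q v] len by (auto simp: nth_append)
      next
        case q: False
        with 1 double.hyps(2) have "Suc (q - a) < b" by linarith
        then show ?thesis using q reduced_nth_eq[OF f2, of "b - Suc (Suc (q - a))" w] len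
          by (auto simp: nth_append rev_nth Suc_diff_le Suc_diff_Suc)
      qed
      show ?thesis by (intro exI[of _ 0]) (auto simp: z intro!: sum.neutral)
    qed
  next
    case (2 a b)
    then have n: "a + b = n" by simp
    \<comment> \<open>The shared letter ends both extended words, so any two adjacent points lie
      within \<open>v @ [x]\<close> or within \<open>w @ [x]\<close>, and one of the reduced
      functions vanishes.\<close>
    have z: "f1 (v @ [x]) * f2 (w @ [x]) *
        (if (v @ x # rev w) ! q = (v @ x # rev w) ! Suc q then f (del q (v @ x # rev w)) else 0) = 0"
      if f1: "reduced (Suc a) f1" and f2: "reduced (Suc b) f2" and len: "length v = a" "length w = b" for f1 f2 v w x
    proof (cases "q < a")
      case True
      then have "(v @ x # rev w) ! q = (v @ [x]) ! q" "(v @ x # rev w) ! Suc q = (v @ [x]) ! Suc q"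
        using len by (auto simp: nth_append nth_Cons')
      then show ?thesis using True reduced_nth_eq[OF f1, of q "v @ [x]"] len by auto
    next
      case q: False
      define i where "i = q - a"
      with q n double.hyps(2) have i: "q = a + i" "i < b" by auto
      have "(v @ x # rev w) ! q = rev (w @ [x]) ! i" "(v @ x # rev w) ! Suc q = rev (w @ [x]) ! Suc i"
        using len i by (auto simp: nth_append)
      then have "(v @ x # rev w) ! q = (w @ [x]) ! (b - i)" "(v @ x # rev w) ! Suc q = (w @ [x]) ! (b - Suc i)"
        using len i rev_nth[of i "w @ [x]"] rev_nth[of "Suc i" "w @ [x]"] by (simp_all del: rev_append)
      then show ?thesis using i reduced_nth_eq[OF f2, of "b - Suc i" "w @ [x]"] len
        by (auto simp: Suc_diff_Suc)
    qed
    show ?case by (intro exI[of _ 0]) (auto simp: z intro!: sum.neutral)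
  }
next
  case (zero n)
  { case 1 then show ?case by (intro exI[of _ 0]) simp next
    case 2 then show ?case by (intro exI[of _ 0]) simp }
next
  case (add n f g)
  { case (1 a b)
    from add.IH(1)[OF 1] add.IH(3)[OF 1] show ?case
      by (elim exE, rule_tac x = "c + ca" in exI) (simp add: distrib_left sum.distrib distrib_right)
  next
    case (2 a b)
    from add.IH(2)[OF 2] add.IH(4)[OF 2] show ?case
      by (elim exE, rule_tac x = "c + ca" in exI) (simp add: distrib_left sum.distrib distrib_right) }
next
  case (scale n f c)
  { case (1 a b)
    from scale.IH(1)[OF 1] obtain c' where c': "\<forall>f1 f2. reduced a f1 \<longrightarrow> reduced b f2 \<longrightarrow>
      (\<Sum>v\<in>words a. \<Sum>w\<in>words b. f1 v * f2 w * f (v @ rev w))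
        = (if a = b then c' * (\<Sum>v\<in>words a. f1 v * f2 v) else 0)" by blast
    have e: "f1 v * f2 w * (c * f (v @ rev w)) = c * (f1 v * f2 w * f (v @ rev w))" for f1 f2 v w
      by (simp add: mult_ac)
    show ?case unfolding e using c' by (intro exI[of _ "c * c'"]) (auto simp flip: sum_distrib_left)
  next
    case (2 a b)
    from scale.IH(2)[OF 2] obtain c' where c': "\<forall>f1 f2. reduced (Suc a) f1 \<longrightarrow> reduced (Suc b) f2 \<longrightarrow>
      (\<Sum>v\<in>words a. \<Sum>w\<in>words b. \<Sum>x\<in>UNIV. f1 (v @ [x]) * f2 (w @ [x]) * f (v @ x # rev w))
        = (if a = b then c' * (\<Sum>v\<in>words (Suc a). f1 v * f2 v) else 0)" by blast
    have e: "f1 (v @ [x]) * f2 (w @ [x]) * (c * f (v @ x # rev w))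
        = c * (f1 (v @ [x]) * f2 (w @ [x]) * f (v @ x # rev w))" for f1 f2 v w x
      by (simp add: mult_ac)
    show ?case unfolding e using c' by (intro exI[of _ "c * c'"]) (auto simp flip: sum_distrib_left) }
next
  case (cong n f g)
  { case (1 a b)
    have "(\<Sum>v\<in>words a. \<Sum>w\<in>words b. f1 v * f2 w * g (v @ rev w))
        = (\<Sum>v\<in>words a. \<Sum>w\<in>words b. f1 v * f2 w * f (v @ rev w))" for f1 f2
      by (intro sum.cong refl) (use cong.hyps 1 in auto)
    then show ?case using cong.IH(1)[OF 1] by simp
  next
    case (2 a b)
    have "(\<Sum>v\<in>words a. \<Sum>w\<in>words b. \<Sum>x\<in>UNIV. f1 (v @ [x]) * f2 (w @ [x]) * g (v @ x # rev w))
        = (\<Sum>v\<in>words a. \<Sum>w\<in>words b. \<Sum>x\<in>UNIV. f1 (v @ [x]) * f2 (w @ [x]) * f (v @ x # rev w))" for f1 f2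
      by (intro sum.cong refl) (use cong.hyps 2 in auto)
    then show ?case using cong.IH(2)[OF 2] by simp }
qed

section \<open>The functional of non-crossing partitions\<close>

text \<open>Matrix entries of the orthogonal projection onto the span of the non-crossing functions,
  written in a chosen orthonormal basis. They will be the values of the Haar state on the
  coefficients of the tensor powers of u.\<close>

definition nc_proj :: "'n::finite list \<Rightarrow> 'n list \<Rightarrow> complex" where
  "nc_proj i j = (let (d, v) = (SOME (d, v). onb (words (length i)) {f. noncrossing (length i) f} d v)
     in \<Sum>a<d. v a i * cnj (v a j))"

lemma nc_proj_onb:
  "\<exists>d v. onb (words n) {f. noncrossing n f} d v \<and>
    (\<forall>i j :: 'n::finite list. length i = n \<longrightarrow> nc_proj i j = (\<Sum>a<d. v a i * cnj (v a j)))"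
proof -
  define P where "P = (\<lambda>(d, v). onb (words n) {f :: 'n list \<Rightarrow> complex. noncrossing n f} d v)"
  obtain d v where dv: "(SOME s. P s) = (d, v)" by fastforce
  have "\<exists>s. P s"
    using onb_exists[OF finite_words function_subspace_noncrossing] by (auto simp: P_def)
  then have "P (d, v)" unfolding dv[symmetric] by (rule someI_ex)
  moreover have "nc_proj i j = (\<Sum>a<d. v a i * cnj (v a j))" if "length i = n" for i j
    using dv that by (simp add: nc_proj_def P_def)
  ultimately show ?thesis by (auto simp: P_def)
qed

lemma nc_proj_cnj:
  assumes "length i = length j" shows "cnj (nc_proj i j) = nc_proj j i"
proof -
  obtain d v where "onb (words (length j)) {f. noncrossing (length j) f} d v"
      "\<forall>i' j' :: 'a list. length i' = length j \<longrightarrow> nc_proj i' j' = (\<Sum>a<d. v a i' * cnj (v a j'))"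
    using nc_proj_onb[of "length j"] by blast
  then show ?thesis using assms by (simp add: mult.commute)
qed

lemma nc_proj_Nil: "nc_proj [] [] = 1"
proof -
  obtain d v where v: "onb (words 0) {f. noncrossing 0 f} d v"
      "\<forall>i' j' :: 'a list. length i' = 0 \<longrightarrow> nc_proj i' j' = (\<Sum>a<d. v a i' * cnj (v a j'))"
    using nc_proj_onb[of 0] by blast
  have "(\<lambda>w :: 'a list. 1) \<in> {f. noncrossing 0 f}" by (simp add: noncrossing.unit)
  then have "1 = (\<Sum>a<d. ip (words 0) (v a) (\<lambda>w. 1) * v a [])"
    by (rule onb_expand[OF v(1)]) simp
  then show ?thesis using v(2)[rule_format, of "[]" "[]"] by (simp add: ip_def mult.commute)
qed

lemma nc_proj_noncrossing: "noncrossing n (\<lambda>i. nc_proj i j)"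
proof -
  obtain d v where v: "onb (words n) {f. noncrossing n f} d v"
      "\<forall>i' j' :: 'a list. length i' = n \<longrightarrow> nc_proj i' j' = (\<Sum>a<d. v a i' * cnj (v a j'))"
    using nc_proj_onb[of n] by blast
  have "(\<lambda>i. \<Sum>a<d. cnj (v a j) * v a i) \<in> {f. noncrossing n f}"
    by (rule function_subspace_sum[OF function_subspace_noncrossing]) (use onb_mem[OF v(1)] in simp)
  then have "noncrossing n (\<lambda>i. \<Sum>a<d. cnj (v a j) * v a i)" by simp
  then show ?thesis by (rule noncrossing.cong) (simp add: v mult.commute)
qed

text \<open>The row relation of the generators, read for the projection. Restriction to doubled
  words and its adjoint preserve the non-crossing spans, so \<open>onb_intertwine\<close> moves the
  doubling from one index to the other.\<close>

lemma nc_proj_double: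
  assumes l: "length l = length l'" and m: "length m = length m'"
  shows "nc_proj (l @ x # x # m) (l' @ y # z # m') = (if y = z then nc_proj (l @ x # m) (l' @ y # m') else 0)"
proof -
  define p where "p = length l"
  define n where "n = Suc (p + length m)"
  let ?A = "\<lambda>f w. f (dupl p w) :: complex"
  let ?B = "\<lambda>f w. if w ! p = w ! Suc p then f (del p w) else 0 :: complex"
  obtain d v where v: "onb (words (Suc n)) {f. noncrossing (Suc n) f} d v"
      "\<forall>i j :: 'a list. length i = Suc n \<longrightarrow> nc_proj i j = (\<Sum>a<d. v a i * cnj (v a j))"
    using nc_proj_onb[of "Suc n"] by blast
  obtain d' v' where v': "onb (words n) {f. noncrossing n f} d' v'"
      "\<forall>i j :: 'a list. length i = n \<longrightarrow> nc_proj i j = (\<Sum>a<d'. v' a i * cnj (v' a j))"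
    using nc_proj_onb[of n] by blast
  have "(\<Sum>a<d. ?A (v a) (l @ x # m) * cnj (v a (l' @ y # z # m')))
      = (\<Sum>b<d'. v' b (l @ x # m) * cnj (?B (v' b) (l' @ y # z # m')))"
  proof (rule onb_intertwine[OF v(1) v'(1)])
    show "ip (words n) g (?A f) = ip (words (Suc n)) (?B g) f" for f g :: "'a list \<Rightarrow> complex"
    proof -
      have e1: "ip (words n) g (?A f) = (\<Sum>l\<in>words p. \<Sum>m'\<in>words (length m). \<Sum>x\<in>UNIV.
          cnj (g (l @ x # m')) * f (l @ x # x # m'))"
        unfolding ip_def n_def sum_words_split by (simp add: dupl_append)
      have "ip (words (Suc n)) (?B g) f = (\<Sum>w\<in>words (Suc (p + Suc (length m))). cnj (?B g w) * f w)"
        by (simp add: ip_def n_def)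
      also have "\<dots> = (\<Sum>l\<in>words p. \<Sum>y\<in>UNIV. \<Sum>m'\<in>words (length m). \<Sum>x\<in>UNIV.
          if x = y then cnj (g (l @ y # m')) * f (l @ x # y # m') else 0)"
        by (subst sum_words_split, unfold sum_words_Suc, intro sum.cong refl) (auto simp: nth_append del_append intro!: sum.cong)
      also have "\<dots> = (\<Sum>l\<in>words p. \<Sum>y\<in>UNIV. \<Sum>m'\<in>words (length m). cnj (g (l @ y # m')) * f (l @ y # y # m'))"
        by simp
      also have "\<dots> = ip (words n) g (?A f)"
        unfolding e1 by (intro sum.cong refl sum.swap)
      finally show ?thesis by (rule sym)
    qed
  next
    show "?A f \<in> {f. noncrossing n f}" if "f \<in> {f. noncrossing (Suc n) f}" for f
      using noncrossing_contract(1)[of "Suc n" f n p] that by (simp add: n_def)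
    show "?B g \<in> {f. noncrossing (Suc n) f}" if "g \<in> {f. noncrossing n f}" for g
      using noncrossing.double[of n g p] that by (simp add: n_def)
  qed (use l m in \<open>simp_all add: n_def p_def\<close>)
  moreover have "dupl p (l @ x # m) = l @ x # x # m" "del p (l' @ y # z # m') = l' @ z # m'"
      "(l' @ y # z # m') ! p = y" "(l' @ y # z # m') ! Suc p = z"
    using l by (simp_all add: p_def dupl_append del_append nth_append)
  moreover have "length (l @ x # x # m) = Suc n" "length (l @ x # m) = n"
    by (simp_all add: p_def n_def)
  ultimately show ?thesis by (cases "y = z") (simp_all add: v(2) v'(2))
qed

text \<open>The relation that columns sum to one, read for the projection: summing out a letter and
  inserting a singleton are adjoint to each other.\<close>

lemma nc_proj_sum:
  assumes l: "length l = length l'" and m: "length m = length m'"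
  shows "(\<Sum>x\<in>UNIV. nc_proj (l @ x # m) (l' @ y # m')) = nc_proj (l @ m) (l' @ m')"
proof -
  define p where "p = length l"
  define n where "n = p + length m"
  let ?A = "\<lambda>f w. \<Sum>x\<in>UNIV. f (ins p x w) :: complex"
  let ?B = "\<lambda>f w. f (del p w) :: complex"
  obtain d v where v: "onb (words (Suc n)) {f. noncrossing (Suc n) f} d v"
      "\<forall>i j :: 'a list. length i = Suc n \<longrightarrow> nc_proj i j = (\<Sum>a<d. v a i * cnj (v a j))"
    using nc_proj_onb[of "Suc n"] by blast
  obtain d' v' where v': "onb (words n) {f. noncrossing n f} d' v'"
      "\<forall>i j :: 'a list. length i = n \<longrightarrow> nc_proj i j = (\<Sum>a<d'. v' a i * cnj (v' a j))"
    using nc_proj_onb[of n] by blast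
  have "(\<Sum>a<d. ?A (v a) (l @ m) * cnj (v a (l' @ y # m')))
      = (\<Sum>b<d'. v' b (l @ m) * cnj (?B (v' b) (l' @ y # m')))"
  proof (rule onb_intertwine[OF v(1) v'(1)])
    show "ip (words n) g (?A f) = ip (words (Suc n)) (?B g) f" for f g :: "'a list \<Rightarrow> complex"
      unfolding ip_def n_def sum_words_split sum_words_append
      by (simp add: ins_append del_append sum_distrib_left)
  next
    show "?A f \<in> {f. noncrossing n f}" if "f \<in> {f. noncrossing (Suc n) f}" for f
      using noncrossing_contract(2)[of "Suc n" f n p] that by (simp add: n_def)
    show "?B g \<in> {f. noncrossing (Suc n) f}" if "g \<in> {f. noncrossing n f}" for g
      using noncrossing.insert[of n g p] that by (simp add: n_def)
  qed (use l m in \<open>simp_all add: n_def p_def\<close>)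
  moreover have "ins p x (l @ m) = l @ x # m" "del p (l' @ y # m') = l' @ m'" for x
    using l by (simp_all add: p_def ins_append del_append)
  moreover have "length (l @ x # m) = Suc n" "length (l @ m) = n" for x
    by (simp_all add: p_def n_def)
  ultimately have "(\<Sum>a<d. \<Sum>x\<in>UNIV. v a (l @ x # m) * cnj (v a (l' @ y # m'))) = nc_proj (l @ m) (l' @ m')"
    and len: "\<And>x. length (l @ x # m) = Suc n" by (simp_all add: v'(2) sum_distrib_right)
  then show ?thesis unfolding v(2)[rule_format, OF len] by (subst sum.swap)
qed

text \<open>The projection is Hermitian, so conjugation exchanges the roles of rows and columns,
  here and in the next lemma.\<close>

lemma nc_proj_double':
  assumes "length l = length l'" "length m = length m'"
  shows "nc_proj (l' @ y # z # m') (l @ x # x # m) = (if y = z then nc_proj (l' @ y # m') (l @ x # m) else 0)"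
  using arg_cong[OF nc_proj_double[OF assms, of x y z], of cnj] assms
  by (simp add: nc_proj_cnj split: if_splits)

lemma nc_proj_sum':
  assumes "length l = length l'" "length m = length m'"
  shows "(\<Sum>x\<in>UNIV. nc_proj (l' @ y # m') (l @ x # m)) = nc_proj (l' @ m') (l @ m)"
  using arg_cong[OF nc_proj_sum[OF assms, of y], of cnj] assms by (simp add: nc_proj_cnj)

section \<open>Descent of the projection entries to a functional on the algebra\<close>

definition nc_word :: "'n::finite word \<Rightarrow> complex" where
  "nc_word w = nc_proj (map fst (letters w)) (map snd (letters w))"

lemma nc_word_relator:
  assumes "r \<in> relators"
  shows "ext_lin (\<lambda>c. c) nc_word (Poly_Mapping.single u c * r * Poly_Mapping.single v d) = 0"
proof -
  let ?e = "\<lambda>r. ext_lin (\<lambda>c. c) nc_word (Poly_Mapping.single u c * r * Poly_Mapping.single v d)"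
  \<comment> \<open>\<open>k z\<close> is the value on the word \<open>z\<close> flanked by
    \<open>u\<close> and \<open>v\<close>; each kind of relator becomes one identity for
    \<open>k\<close>.\<close>
  define k where "k = (\<lambda>z. nc_proj (map fst (letters u) @ map fst z @ map fst (letters v))
    (map snd (letters u) @ map snd z @ map snd (letters v)))"
  have diff: "?e (x - y) = ?e x - ?e y" for x y
    by (simp add: emb_id.ext_diff left_diff_distrib right_diff_distrib)
  have e1: "ext_lin (\<lambda>c. c) nc_word (Poly_Mapping.single u c * Poly_Mapping.single v d) = c * d * k []"
    by (simp add: mult_single nc_word_def plus_word_def k_def)
  have e2: "?e (letter i j) = c * d * k [(i, j)]" for i j
    by (simp add: letter_def mult_single nc_word_def plus_word_def k_def)
  have e3: "?e (letter i j * letter i' j') = c * d * k [(i, j), (i', j')]" for i j i' j'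
    by (simp add: letter_def mult_single nc_word_def plus_word_def k_def)
  have e4: "?e (sum f A) = (\<Sum>a\<in>A. ?e (f a))" for f and A :: "'a set"
    by (simp add: emb_id.ext_sum sum_distrib_left sum_distrib_right)
  have e0: "?e 0 = 0" by simp
  have r1: "k [(i, j), (i, j')] = (if j = j' then k [(i, j)] else 0)" for i j j'
    by (simp add: k_def nc_proj_double)
  have r2: "k [(i, j), (i', j)] = (if i = i' then k [(i, j)] else 0)" for i i' j
    by (simp add: k_def nc_proj_double')
  have r3: "(\<Sum>x\<in>UNIV. k [(x, j)]) = k []" for j
    by (simp add: k_def nc_proj_sum)
  have r4: "(\<Sum>x\<in>UNIV. k [(i, x)]) = k []" for i
    by (simp add: k_def nc_proj_sum')
  show ?thesis
    using assms unfolding relators_word_def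
    by (auto simp: diff e1 e2 e3 e4 r1 r2 r3 r4 simp flip: sum_distrib_left)
qed

lemma nc_word_rel_ideal: "x \<in> rel_ideal \<Longrightarrow> ext_lin (\<lambda>c. c) nc_word x = 0"
proof (induction rule: rel_ideal.induct)
  case (gen r a b)
  have "a * r * b = (\<Sum>u\<in>Poly_Mapping.keys a. Poly_Mapping.single u (Poly_Mapping.lookup a u)) * r
      * (\<Sum>v\<in>Poly_Mapping.keys b. Poly_Mapping.single v (Poly_Mapping.lookup b v))"
    by (simp flip: monomial_sum)
  then show ?case
    by (simp add: sum_distrib_left sum_distrib_right emb_id.ext_sum nc_word_relator[OF gen])
qed (simp_all add: emb_id.ext_add)

lift_definition nc_fun :: "'n::finite pol \<Rightarrow> complex" is "ext_lin (\<lambda>c. c) nc_word"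
  using nc_word_rel_ideal by (metis emb_id.ext_diff eq_iff_diff_eq_0)

section \<open>Linear functionals and coefficients of tensor powers\<close>

abbreviation linear_functional :: "('n::finite pol \<Rightarrow> complex) \<Rightarrow> bool" where
  "linear_functional \<equiv> Vector_Spaces.linear scale (*)"

lemma ext_lin_id_scale:
  "ext_lin (\<lambda>c. c) f (Poly_Mapping.single 0 c * x) = c * ext_lin (\<lambda>c. c) f (x :: 'm::monoid_add \<Rightarrow>\<^sub>0 complex)"
proof -
  have "ext_lin (\<lambda>c. c) f (Poly_Mapping.single 0 c *
      (\<Sum>w\<in>Poly_Mapping.keys x. Poly_Mapping.single w (Poly_Mapping.lookup x w))) = c * ext_lin (\<lambda>c. c) f x"
    by (simp add: sum_distrib_left mult_single emb_id.ext_sum mult.assoc ext_lin_def[of "\<lambda>c. c" f x])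
  then show ?thesis by (simp flip: monomial_sum)
qed

lemma vector_space_complex: "vector_space ((*) :: complex \<Rightarrow> complex \<Rightarrow> complex)"
  by standard (auto simp: algebra_simps)

lemma linear_functionalI:
  assumes "\<And>x y. f (x + y) = f x + f y" "\<And>c x. f (scale c x) = c * f x"
  shows "linear_functional f"
  unfolding Vector_Spaces.linear_iff using assms vector_space_scale vector_space_complex by blast

lemma linear_nc_fun: "linear_functional nc_fun"
proof (rule linear_functionalI)
  show "nc_fun (x + y) = nc_fun x + nc_fun y" for x y :: "'a pol"
    by transfer (rule emb_id.ext_add)
  show "nc_fun (scale c x) = c * nc_fun x" for c and x :: "'a pol"
    by transfer (rule ext_lin_id_scale)
qed

lemma linear_counit: "linear_functional counit"
  by (rule linear_functionalI) (auto simp: counit_add counit_scale)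

text \<open>For words of length \<open>k\<close> these are the matrix coefficients of \<open>u\<^bsup>\<otimes>k\<^esup>\<close>.\<close>

definition coef :: "'n::finite list \<Rightarrow> 'n list \<Rightarrow> 'n pol" where
  "coef i j = prod_list (map2 pgen i j)"

lemma coef_abs: "coef i j = abs_alg (Poly_Mapping.single (Word (zip i j)) 1)"
proof -
  have "prod_list (map (\<lambda>(i, j). pgen i j) z) = abs_alg (Poly_Mapping.single (Word z) 1)"
    for z :: "('a \<times> 'a) list"
  proof (induction z)
    case Nil
    then show ?case by (simp add: one_alg.abs_eq flip: zero_word_def)
  next
    case (Cons x z)
    then show ?case
      by (cases x) (simp add: pgen_abs letter_def times_alg.abs_eq mult_single plus_word_def)
  qed
  then show ?thesis by (simp add: coef_def)
qed

lemma nc_fun_coef: "length i = length j \<Longrightarrow> nc_fun (coef i j) = nc_proj i j"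
  by (simp add: coef_abs nc_fun.abs_eq nc_word_def)

interpretation alg: vector_space scale
  by (rule vector_space_scale)

lemma coef_Nil [simp]: "coef [] [] = 1"
  by (simp add: coef_def)

lemma coef_Cons [simp]: "coef (x # i) (y # j) = pgen x y * coef i j"
  by (simp add: coef_def)

lemma coef_append: "length i = length j \<Longrightarrow> coef (i @ i') (j @ j') = coef i j * coef i' j'"
  by (simp add: coef_def)

lemma star_coef: "length i = length j \<Longrightarrow> star (coef i j) = coef (rev i) (rev j)"
  by (induction i j rule: list_induct2) (simp_all add: star_one star_mult star_pgen coef_append)

lemma counit_coef: "length i = length j \<Longrightarrow> counit (coef i j) = (if i = j then 1 else 0)"
  by (induction i j rule: list_induct2) (simp_all add: counit_one counit_mult counit_pgen)

lemma sum_coef_col: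
  assumes "length l = length l'"
  shows "(\<Sum>x\<in>UNIV. coef (l @ x # m) (l' @ y # m')) = coef (l @ m) (l' @ m')"
  using assms
  by (simp add: coef_append pgen_sum_col flip: sum_distrib_left sum_distrib_right)

lemma sum_coef_row:
  assumes "length l = length l'"
  shows "(\<Sum>x\<in>UNIV. coef (l' @ y # m') (l @ x # m)) = coef (l' @ m') (l @ m)"
  using assms
  by (simp add: coef_append pgen_sum_row flip: sum_distrib_left sum_distrib_right)

lemma coef_double_row:
  assumes "length l = length l'"
  shows "coef (l @ x # x # m) (l' @ y # z # m') = (if y = z then coef (l @ x # m) (l' @ y # m') else 0)"
  using assms pgen_row[of x y z] by (simp add: coef_append flip: mult.assoc)

lemma coef_double_col:
  assumes "length l = length l'"
  shows "coef (l' @ y # z # m') (l @ x # x # m) = (if y = z then coef (l' @ y # m') (l @ x # m) else 0)"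
  using assms pgen_col[of y x z] by (simp add: coef_append flip: mult.assoc)

text \<open>\<open>star\<close> reverses products, so the first letters stand outermost. Once the
  inner sum is a scalar, they meet, collapse by the column relation, and sum to one along a
  row.\<close>

lemma coef_mult_star:
  assumes "length i = k" "length m = k"
  shows "(\<Sum>j\<in>words k. coef i j * star (coef m j)) = (if i = m then 1 else 0)"
  using assms
proof (induction k arbitrary: i m)
  case (Suc k)
  then obtain x i' z m' where im: "i = x # i'" "m = z # m'" "length i' = k" "length m' = k"
    by (auto simp: length_Suc_conv)
  have "(\<Sum>j\<in>words (Suc k). coef i j * star (coef m j))
      = (\<Sum>y\<in>UNIV. pgen x y * (\<Sum>j\<in>words k. coef i' j * star (coef m' j)) * pgen z y)"
    unfolding sum_words_Suc
    by (simp add: im star_mult star_pgen sum_distrib_left sum_distrib_right mult.assoc)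
  then show ?case using Suc.IH[OF im(3,4)]
    by (cases "x = z") (simp_all add: im pgen_col pgen_sum_row)
qed (simp add: star_one)

text \<open>This is unitarity of the entrywise adjoint matrix rather than of the matrix itself; it
  evaluates the trace in Schur orthogonality.\<close>

lemma mult_coef_star:
  assumes "length j = k" "length l = k"
  shows "(\<Sum>i\<in>words k. coef i j * star (coef i l)) = (if j = l then 1 else 0)"
  using assms
proof (induction k arbitrary: j l)
  case (Suc k)
  then obtain y j' z l' where jl: "j = y # j'" "l = z # l'" "length j' = k" "length l' = k"
    by (auto simp: length_Suc_conv)
  have "(\<Sum>i\<in>words (Suc k). coef i j * star (coef i l))
      = (\<Sum>x\<in>UNIV. pgen x y * (\<Sum>i\<in>words k. coef i j' * star (coef i l')) * pgen x z)"
    unfolding sum_words_Suc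
    by (simp add: jl star_mult star_pgen sum_distrib_left sum_distrib_right mult.assoc)
  then show ?case using Suc.IH[OF jl(3,4)]
    by (cases "y = z") (simp_all add: jl pgen_row pgen_sum_col)
qed (simp add: star_one)

lemma star_mult_coef:
  assumes "length j = k" "length l = k"
  shows "(\<Sum>i\<in>words k. star (coef i j) * coef i l) = (if j = l then 1 else 0)"
  using assms
proof (induction k arbitrary: j l)
  case (Suc k)
  then obtain y j' z l' where jl: "j = y # j'" "l = z # l'" "length j' = k" "length l' = k"
    by (auto simp: length_Suc_conv)
  have "(\<Sum>i\<in>words (Suc k). star (coef i j) * coef i l)
      = (\<Sum>i\<in>words k. star (coef i j') * (\<Sum>x\<in>UNIV. pgen x y * pgen x z) * coef i l')"
    unfolding sum_words_Suc
    by (subst sum.swap) (simp add: jl star_mult star_pgen sum_distrib_left sum_distrib_right mult.assoc)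
  then show ?case using Suc.IH[OF jl(3,4)]
    by (cases "y = z") (simp_all add: jl pgen_row pgen_sum_col)
qed (simp add: star_one)

lemma comult_coef:
  assumes "length i = k" "length j = k"
  shows "comult (coef i j) = (\<Sum>l\<in>words k. tensor (coef i l) (coef l j))"
  using assms
proof (induction k arbitrary: i j)
  case (Suc k)
  then obtain x i' y j' where ij: "i = x # i'" "j = y # j'" "length i' = k" "length j' = k"
    by (auto simp: length_Suc_conv)
  show ?case unfolding sum_words_Suc
    by (simp add: ij comult_mult comult_pgen Suc.IH sum_product tensor_mult)
qed (simp add: comult_one tensor_one)

lemma star_sum: "star (sum f A) = (\<Sum>a\<in>A. star (f a))"
proof -
  have "star (0 :: 'a pol) = 0" using star_add[of 0 "0 :: 'a pol"] by simp
  then show ?thesis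
    by (induction A rule: infinite_finite_induct) (auto simp: star_add)
qed

lemma comult_sum: "comult (sum f A) = (\<Sum>a\<in>A. comult (f a))"
proof -
  have "comult (0 :: 'a pol) = 0" using comult_add[of 0 "0 :: 'a pol"] by simp
  then show ?thesis
    by (induction A rule: infinite_finite_induct) (auto simp: comult_add)
qed

lemma comult_scale: "comult (scale c x) = scale c (comult x)"
proof (transfer, goal_cases)
  case (1 c x)
  have "comult_free (Poly_Mapping.single 0 c :: 'a word \<Rightarrow>\<^sub>0 complex) = Poly_Mapping.single 0 c"
    by (simp add: comult_free_def comult_word_def zero_word_def)
  then show ?case by (simp add: comult_free_mult rel_ideal.zero)
qed

lemma tensor_scale_left: "tensor (scale c x) y = scale c (tensor x y)"
  by transfer (simp add: in1_simps zero_prod_def mult.assoc rel_ideal.zero)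

lemma tensor_scale_right: "tensor x (scale c y) = scale c (tensor x y)"
proof (transfer, goal_cases)
  case (1 x c y)
  have "in1 x * in2 (Poly_Mapping.single 0 c * y) = Poly_Mapping.single 0 c * (in1 x * in2 y)"
    unfolding in2_simps by (metis mult.assoc single0_central zero_prod_def)
  then show ?case by (simp add: rel_ideal.zero)
qed

context
  fixes \<psi> :: "'n::finite pol \<Rightarrow> complex"
  assumes \<psi>: "linear_functional \<psi>"
begin

lemma functional_add: "\<psi> (x + y) = \<psi> x + \<psi> y"
  using \<psi> by (simp add: Vector_Spaces.linear_iff)

lemma functional_scale: "\<psi> (scale c x) = c * \<psi> x"
  using \<psi> by (simp add: Vector_Spaces.linear_iff)

lemma functional_zero: "\<psi> 0 = 0"
  using functional_scale[of 0 0] by simp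

lemma functional_sum: "\<psi> (sum f A) = (\<Sum>a\<in>A. \<psi> (f a))"
  by (induction A rule: infinite_finite_induct) (auto simp: functional_add functional_zero)

text \<open>The coefficients are the classes of the monomials, hence they span the algebra.\<close>

lemma functional_eq_zeroI:
  assumes "\<And>i j. length i = length j \<Longrightarrow> \<psi> (coef i j) = 0"
  shows "\<psi> x = 0"
proof (induct x rule: alg.abs_induct)
  case (1 y)
  have "abs_alg (Poly_Mapping.single w c) = scale c (coef (map fst (letters w)) (map snd (letters w)))"
    for w :: "'n word" and c
    by (simp add: coef_abs scale.abs_eq mult_single zip_map_fst_snd)
  then have "abs_alg y = (\<Sum>w\<in>Poly_Mapping.keys y. scale (Poly_Mapping.lookup y w) (coef (map fst (letters w)) (map snd (letters w))))"
    using arg_cong[OF monomial_sum[of y], of abs_alg] by (simp add: abs_alg_sum)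
  then show ?case by (simp add: functional_sum functional_scale assms)
qed

end

text \<open>Transfers basis expansions from complex valued to algebra valued functions; a nonzero
  difference is linearly independent and thus detected by some functional.\<close>

lemma functional_separate:
  assumes "\<And>\<psi>. linear_functional \<psi> \<Longrightarrow> \<psi> x = \<psi> (y :: 'n::finite pol)"
  shows "x = y"
proof (rule ccontr)
  assume "x \<noteq> y"
  interpret vector_space_pair "scale :: complex \<Rightarrow> 'n pol \<Rightarrow> 'n pol" "(*) :: complex \<Rightarrow> complex \<Rightarrow> complex"
    using vector_space_scale vector_space_complex by (simp add: vector_space_pair_def)
  have "\<not> alg.dependent {x - y}" using \<open>x \<noteq> y\<close> by simp
  from linear_independent_extend[OF this, of "\<lambda>_. 1"]
  obtain \<psi> where \<psi>: "linear_functional \<psi>" "\<psi> (x - y) = 1" by auto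
  have "\<psi> x = \<psi> (x - y) + \<psi> y" using functional_add[OF \<psi>(1), of "x - y" y] by simp
  then show False using assms[OF \<psi>(1)] \<psi>(2) by simp
qed

section \<open>The irreducible representations on reduced functions\<close>

text \<open>Invariance of the reduced functions: summing out a row letter removes the matching
  column letter, where \<open>f\<close> then sums to zero; a repeated row letter forces equal
  adjacent column letters, where \<open>f\<close> vanishes.\<close>

lemma reduced_coef_row:
  fixes f :: "'n::finite list \<Rightarrow> complex"
  assumes "reduced k f"
  shows "reduced k (\<lambda>i. \<Sum>j\<in>words k. scale (f j) (coef i j))"
  unfolding reduced_def
proof (intro conjI allI impI)
  fix l m :: "'n list"
  assume k: "length l + length m + 1 = k"
  have "(\<Sum>x\<in>UNIV. \<Sum>j\<in>words k. scale (f j) (coef (l @ x # m) j))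
      = (\<Sum>j\<in>words (Suc (length l + length m)). scale (f j) (\<Sum>x\<in>UNIV. coef (l @ x # m) j))"
    using k by (subst sum.swap) (simp add: alg.scale_sum_right)
  also have "\<dots> = (\<Sum>l'\<in>words (length l). \<Sum>m'\<in>words (length m).
      scale (\<Sum>y\<in>UNIV. f (l' @ y # m')) (coef (l @ m) (l' @ m')))"
    unfolding sum_words_split by (simp add: sum_coef_col alg.scale_sum_left)
  also have "\<dots> = 0" using k by (simp add: reducedD_sum[OF assms])
  finally show "(\<Sum>x\<in>UNIV. \<Sum>j\<in>words k. scale (f j) (coef (l @ x # m) j)) = 0" .
next
  fix l m :: "'n list" and x
  assume k: "length l + length m + 2 = k"
  have "(\<Sum>j\<in>words (Suc (length l + Suc (length m))). scale (f j) (coef (l @ x # x # m) j)) = 0"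
    by (subst sum_words_split, unfold sum_words_Suc, intro sum.neutral ballI)
      (use k in \<open>auto simp: coef_double_row reducedD_eq[OF assms]\<close>)
  then show "(\<Sum>j\<in>words k. scale (f j) (coef (l @ x # x # m) j)) = 0" using k by simp
qed

text \<open>The same invariance for the transposed matrix; together the two let the projection onto
  reduced functions be absorbed on either side.\<close>

lemma reduced_coef_col:
  fixes f :: "'n::finite list \<Rightarrow> complex"
  assumes "reduced k f"
  shows "reduced k (\<lambda>j. \<Sum>i\<in>words k. scale (f i) (coef i j))"
  unfolding reduced_def
proof (intro conjI allI impI)
  fix l m :: "'n list"
  assume k: "length l + length m + 1 = k"
  have "(\<Sum>x\<in>UNIV. \<Sum>i\<in>words k. scale (f i) (coef i (l @ x # m)))
      = (\<Sum>i\<in>words (Suc (length l + length m)). scale (f i) (\<Sum>x\<in>UNIV. coef i (l @ x # m)))"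
    using k by (subst sum.swap) (simp add: alg.scale_sum_right)
  also have "\<dots> = (\<Sum>l'\<in>words (length l). \<Sum>m'\<in>words (length m).
      scale (\<Sum>y\<in>UNIV. f (l' @ y # m')) (coef (l' @ m') (l @ m)))"
    unfolding sum_words_split by (simp add: sum_coef_row alg.scale_sum_left)
  also have "\<dots> = 0" using k by (simp add: reducedD_sum[OF assms])
  finally show "(\<Sum>x\<in>UNIV. \<Sum>i\<in>words k. scale (f i) (coef i (l @ x # m))) = 0" .
next
  fix l m :: "'n list" and x
  assume k: "length l + length m + 2 = k"
  have "(\<Sum>i\<in>words (Suc (length l + Suc (length m))). scale (f i) (coef i (l @ x # x # m))) = 0"
    by (subst sum_words_split, unfold sum_words_Suc, intro sum.neutral ballI)
      (use k in \<open>auto simp: coef_double_col reducedD_eq[OF assms]\<close>)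
  then show "(\<Sum>i\<in>words k. scale (f i) (coef i (l @ x # x # m))) = 0" using k by simp
qed

lemma reduced_functional:
  assumes "linear_functional \<psi>" "reduced k F"
  shows "reduced k (\<lambda>w. \<psi> (F w))"
  using assms(2)
  by (auto simp: reduced_def functional_zero[OF assms(1)] simp flip: functional_sum[OF assms(1)])

locale reduced_basis =
  fixes k d :: nat and v :: "nat \<Rightarrow> 'n::finite list \<Rightarrow> complex"
  assumes basis: "onb (words k) {f. reduced k f} d v"
begin

lemma basis_reduced: "a < d \<Longrightarrow> reduced k (v a)"
  using onb_mem[OF basis] by simp

lemma basis_orthonormal:
  "a < d \<Longrightarrow> b < d \<Longrightarrow> (\<Sum>i\<in>words k. cnj (v a i) * v b i) = (if a = b then 1 else 0)"
  using onb_orthonormal[OF basis] by (simp add: orthonormal_def ip_def)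

lemma expand:
  assumes "reduced k f" "length w = k"
  shows "f w = (\<Sum>a<d. v a w * (\<Sum>i\<in>words k. cnj (v a i) * f i))"
  using onb_expand[OF basis, of f w] assms by (simp add: ip_def mult.commute)

text \<open>Reduced functions are closed under conjugation, so the conjugated basis expands them as
  well.\<close>

lemma expand_cnj:
  assumes "reduced k f" "length w = k"
  shows "f w = (\<Sum>a<d. cnj (v a w) * (\<Sum>i\<in>words k. v a i * f i))"
proof -
  have "cnj (f w) = (\<Sum>a<d. v a w * (\<Sum>i\<in>words k. cnj (v a i) * cnj (f i)))"
    by (rule expand[OF reduced_cnj[OF assms(1)] assms(2)])
  from arg_cong[OF this, of cnj] show ?thesis by simp
qed

lemma expand_alg:
  fixes F :: "'n list \<Rightarrow> 'n pol"
  assumes "reduced k F" "length w = k"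
  shows "(\<Sum>a<d. scale (v a w) (\<Sum>i\<in>words k. scale (cnj (v a i)) (F i))) = F w"
proof (rule functional_separate)
  fix \<psi> :: "'n pol \<Rightarrow> complex"
  assume \<psi>: "linear_functional \<psi>"
  show "\<psi> (\<Sum>a<d. scale (v a w) (\<Sum>i\<in>words k. scale (cnj (v a i)) (F i))) = \<psi> (F w)"
    using expand[OF reduced_functional[OF \<psi> assms(1)] assms(2)]
    by (simp add: functional_sum[OF \<psi>] functional_scale[OF \<psi>])
qed

lemma expand_alg_cnj:
  fixes F :: "'n list \<Rightarrow> 'n pol"
  assumes "reduced k F" "length w = k"
  shows "(\<Sum>a<d. scale (cnj (v a w)) (\<Sum>i\<in>words k. scale (v a i) (F i))) = F w"
proof (rule functional_separate)
  fix \<psi> :: "'n pol \<Rightarrow> complex"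
  assume \<psi>: "linear_functional \<psi>"
  show "\<psi> (\<Sum>a<d. scale (cnj (v a w)) (\<Sum>i\<in>words k. scale (v a i) (F i))) = \<psi> (F w)"
    using expand_cnj[OF reduced_functional[OF \<psi> assms(1)] assms(2)]
    by (simp add: functional_sum[OF \<psi>] functional_scale[OF \<psi>])
qed

definition col :: "nat \<Rightarrow> 'n list \<Rightarrow> 'n pol" where
  "col b i = (\<Sum>j\<in>words k. scale (v b j) (coef i j))"

definition row :: "nat \<Rightarrow> 'n list \<Rightarrow> 'n pol" where
  "row a j = (\<Sum>i\<in>words k. scale (cnj (v a i)) (coef i j))"

text \<open>The matrix of the representation U^k in the basis \<open>v\<close>; \<open>col\<close>
  and \<open>row\<close> keep one index a word.\<close>

definition ucoef :: "nat \<Rightarrow> nat \<Rightarrow> 'n pol" where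
  "ucoef a b = (\<Sum>i\<in>words k. scale (cnj (v a i)) (col b i))"

lemma ucoef_row: "ucoef a b = (\<Sum>j\<in>words k. scale (v b j) (row a j))"
  unfolding ucoef_def col_def row_def alg.scale_sum_right
  by (subst sum.swap) (simp add: mult.commute)

text \<open>By invariance, compressing to the reduced functions loses nothing, so the word index can
  be recovered.\<close>

lemma col_expand: "b < d \<Longrightarrow> length i = k \<Longrightarrow> (\<Sum>a<d. scale (v a i) (ucoef a b)) = col b i"
  unfolding ucoef_def
  by (rule expand_alg) (simp_all add: col_def reduced_coef_row basis_reduced)

lemma row_expand: "a < d \<Longrightarrow> length j = k \<Longrightarrow> (\<Sum>b<d. scale (cnj (v b j)) (ucoef a b)) = row a j"
  unfolding ucoef_row
  by (rule expand_alg_cnj) (simp_all add: row_def reduced_coef_col basis_reduced reduced_cnj)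

lemma ucoef_functional:
  assumes "linear_functional \<psi>"
  shows "\<psi> (ucoef a b) = (\<Sum>i\<in>words k. \<Sum>j\<in>words k. cnj (v a i) * v b j * \<psi> (coef i j))"
  by (simp add: ucoef_def col_def functional_sum[OF assms] functional_scale[OF assms]
      sum_distrib_left mult.assoc)

text \<open>The sum over the inner basis index is absorbed by \<open>col_expand\<close>, which
  leaves the formula for the full tensor power. The three unitarity relations below follow the same
  pattern with \<open>row_expand\<close> or \<open>col_expand\<close>.\<close>

lemma comult_ucoef:
  assumes "a < d" "b < d"
  shows "comult (ucoef a b) = (\<Sum>c<d. tensor (ucoef a c) (ucoef c b))"
proof -
  have "(\<Sum>c<d. tensor (ucoef a c) (ucoef c b))
      = (\<Sum>c<d. \<Sum>l\<in>words k. tensor (row a l) (scale (v c l) (ucoef c b)))"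
    unfolding ucoef_row[of a] by (simp add: tensor_sum_left tensor_scale_left tensor_scale_right)
  also have "\<dots> = (\<Sum>l\<in>words k. tensor (row a l) (\<Sum>c<d. scale (v c l) (ucoef c b)))"
    by (subst sum.swap) (simp add: tensor_sum_right)
  also have "\<dots> = (\<Sum>l\<in>words k. tensor (row a l) (col b l))"
    using assms by (intro sum.cong refl) (simp add: col_expand)
  also have "\<dots> = (\<Sum>l\<in>words k. \<Sum>j\<in>words k. \<Sum>i\<in>words k.
      scale (cnj (v a i) * v b j) (tensor (coef i l) (coef l j)))"
    by (simp add: row_def col_def tensor_sum_left tensor_sum_right tensor_scale_left tensor_scale_right
        alg.scale_sum_right mult.commute)
  also have "\<dots> = (\<Sum>j\<in>words k. \<Sum>i\<in>words k. \<Sum>l\<in>words k.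
      scale (cnj (v a i) * v b j) (tensor (coef i l) (coef l j)))"
    by (subst sum.swap) (intro sum.cong refl sum.swap)
  also have "\<dots> = (\<Sum>i\<in>words k. \<Sum>j\<in>words k. \<Sum>l\<in>words k.
      scale (cnj (v a i) * v b j) (tensor (coef i l) (coef l j)))"
    by (rule sum.swap)
  also have "\<dots> = comult (ucoef a b)"
    by (simp add: ucoef_def col_def comult_sum comult_scale comult_coef alg.scale_sum_right)
  finally show ?thesis by (rule sym)
qed

lemma ucoef_mult_star:
  assumes "a < d" "b < d"
  shows "(\<Sum>c<d. ucoef a c * star (ucoef b c)) = (if a = b then 1 else 0)"
proof -
  have "(\<Sum>c<d. ucoef a c * star (ucoef b c))
      = (\<Sum>c<d. \<Sum>j\<in>words k. scale (cnj (v c j)) (ucoef a c) * star (row b j))"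
    unfolding ucoef_row[of b] by (simp add: star_sum star_scale sum_distrib_left scale_mult_left scale_mult_right)
  also have "\<dots> = (\<Sum>j\<in>words k. (\<Sum>c<d. scale (cnj (v c j)) (ucoef a c)) * star (row b j))"
    by (subst sum.swap) (simp add: sum_distrib_right)
  also have "\<dots> = (\<Sum>j\<in>words k. row a j * star (row b j))"
    using assms by (intro sum.cong refl) (simp add: row_expand)
  also have "\<dots> = (\<Sum>j\<in>words k. \<Sum>i\<in>words k. \<Sum>m\<in>words k.
      scale (cnj (v a i) * v b m) (coef i j * star (coef m j)))"
    by (simp add: row_def star_sum star_scale sum_product scale_mult_left scale_mult_right mult.commute)
  also have "\<dots> = (\<Sum>i\<in>words k. \<Sum>m\<in>words k. \<Sum>j\<in>words k.
      scale (cnj (v a i) * v b m) (coef i j * star (coef m j)))"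
    by (subst sum.swap) (intro sum.cong refl sum.swap)
  also have "\<dots> = (\<Sum>i\<in>words k. \<Sum>m\<in>words k. if i = m then scale (cnj (v a i) * v b m) 1 else 0)"
    by (intro sum.cong refl) (simp add: coef_mult_star flip: alg.scale_sum_right)
  also have "\<dots> = scale (\<Sum>i\<in>words k. cnj (v a i) * v b i) 1"
    by (simp add: alg.scale_sum_left)
  finally show ?thesis using assms by (simp add: basis_orthonormal)
qed

lemma star_mult_ucoef:
  assumes "a < d" "b < d"
  shows "(\<Sum>c<d. star (ucoef c a) * ucoef c b) = (if a = b then 1 else 0)"
proof -
  have "(\<Sum>c<d. star (ucoef c a) * ucoef c b)
      = (\<Sum>c<d. \<Sum>i\<in>words k. star (col a i) * scale (v c i) (ucoef c b))"
    unfolding ucoef_def[of _ a] by (simp add: star_sum star_scale sum_distrib_right scale_mult_left scale_mult_right)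
  also have "\<dots> = (\<Sum>i\<in>words k. star (col a i) * (\<Sum>c<d. scale (v c i) (ucoef c b)))"
    by (subst sum.swap) (simp add: sum_distrib_left)
  also have "\<dots> = (\<Sum>i\<in>words k. star (col a i) * col b i)"
    using assms by (intro sum.cong refl) (simp add: col_expand)
  also have "\<dots> = (\<Sum>i\<in>words k. \<Sum>j\<in>words k. \<Sum>l\<in>words k.
      scale (cnj (v a j) * v b l) (star (coef i j) * coef i l))"
    by (simp add: col_def star_sum star_scale sum_product scale_mult_left scale_mult_right mult.commute)
  also have "\<dots> = (\<Sum>j\<in>words k. \<Sum>l\<in>words k. \<Sum>i\<in>words k.
      scale (cnj (v a j) * v b l) (star (coef i j) * coef i l))"
    by (subst sum.swap) (intro sum.cong refl sum.swap)
  also have "\<dots> = (\<Sum>j\<in>words k. \<Sum>l\<in>words k. if j = l then scale (cnj (v a j) * v b l) 1 else 0)"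
    by (intro sum.cong refl) (simp add: star_mult_coef flip: alg.scale_sum_right)
  also have "\<dots> = scale (\<Sum>i\<in>words k. cnj (v a i) * v b i) 1"
    by (simp add: alg.scale_sum_left)
  finally show ?thesis using assms by (simp add: basis_orthonormal)
qed

lemma mult_ucoef_star:
  assumes "b < d" "e < d"
  shows "(\<Sum>a<d. ucoef a b * star (ucoef a e)) = (if b = e then 1 else 0)"
proof -
  have "(\<Sum>a<d. ucoef a b * star (ucoef a e))
      = (\<Sum>a<d. \<Sum>i\<in>words k. scale (v a i) (ucoef a b) * star (col e i))"
    unfolding ucoef_def[of _ e] by (simp add: star_sum star_scale sum_distrib_left scale_mult_left scale_mult_right)
  also have "\<dots> = (\<Sum>i\<in>words k. (\<Sum>a<d. scale (v a i) (ucoef a b)) * star (col e i))"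
    by (subst sum.swap) (simp add: sum_distrib_right)
  also have "\<dots> = (\<Sum>i\<in>words k. col b i * star (col e i))"
    using assms by (intro sum.cong refl) (simp add: col_expand)
  also have "\<dots> = (\<Sum>i\<in>words k. \<Sum>j\<in>words k. \<Sum>l\<in>words k.
      scale (v b j * cnj (v e l)) (coef i j * star (coef i l)))"
    by (simp add: col_def star_sum star_scale sum_product scale_mult_left scale_mult_right mult.commute)
  also have "\<dots> = (\<Sum>j\<in>words k. \<Sum>l\<in>words k. \<Sum>i\<in>words k.
      scale (v b j * cnj (v e l)) (coef i j * star (coef i l)))"
    by (subst sum.swap) (intro sum.cong refl sum.swap)
  also have "\<dots> = (\<Sum>j\<in>words k. \<Sum>l\<in>words k. if j = l then scale (v b j * cnj (v e l)) 1 else 0)"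
    by (intro sum.cong refl) (simp add: mult_coef_star flip: alg.scale_sum_right)
  also have "\<dots> = scale (\<Sum>i\<in>words k. cnj (v e i) * v b i) 1"
    by (simp add: alg.scale_sum_left mult.commute)
  finally show ?thesis using assms by (simp add: basis_orthonormal)
qed

lemma counit_ucoef: "a < d \<Longrightarrow> b < d \<Longrightarrow> counit (ucoef a b) = (if a = b then 1 else 0)"
  using basis_orthonormal[of a b] by (simp add: ucoef_functional[OF linear_counit] counit_coef if_distrib cong: if_cong)

text \<open>The pairing with reduced functions turns Schur orthogonality into the evaluation of a
  single scalar, which the trace determines.\<close>

lemma nc_fun_schur:
  assumes "a < d" "b < d" "c < d" "e < d"
  shows "nc_fun (ucoef a c * star (ucoef b e)) = (if a = b \<and> c = e then 1 / of_nat d else 0)"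
proof -
  \<comment> \<open>A combination of columns of the projection, hence non-crossing. The reversal
    coming from \<open>star\<close> matches the nested order of the pairing.\<close>
  define g where "g = (\<lambda>w. \<Sum>j\<in>words k. \<Sum>l\<in>words k. v c j * cnj (v e l) * nc_proj w (j @ rev l))"
  note lin = functional_sum[OF linear_nc_fun] functional_scale[OF linear_nc_fun]
  have g: "nc_fun (col c i * star (col e m)) = g (i @ rev m)" if "length i = k" "length m = k" for i m
    using that
    by (simp add: col_def g_def star_sum star_scale sum_product scale_mult_left scale_mult_right lin
        star_coef nc_fun_coef mult_ac flip: coef_append)
  have "g = (\<lambda>w. \<Sum>(j, l)\<in>words k \<times> words k. (v c j * cnj (v e l)) * nc_proj w (j @ rev l))"
    by (simp add: g_def sum.cartesian_product)
  then have "g \<in> {f. noncrossing (k + k) f}"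
    using function_subspace_sum[OF function_subspace_noncrossing, of "words k \<times> words k"
        "\<lambda>p w. nc_proj w (fst p @ rev (snd p))" "k + k" "\<lambda>p. v c (fst p) * cnj (v e (snd p))"]
    by (simp add: case_prod_unfold nc_proj_noncrossing)
  then have "noncrossing (k + k) g" by simp
  from noncrossing_pairing_even[OF this refl] obtain s where s: "\<forall>f1 f2. reduced k f1 \<longrightarrow> reduced k f2 \<longrightarrow>
      (\<Sum>v\<in>words k. \<Sum>w\<in>words k. f1 v * f2 w * g (v @ rev w)) = s * (\<Sum>v\<in>words k. f1 v * f2 v)"
    by auto
  have val: "nc_fun (ucoef a c * star (ucoef b e)) = s * (if a = b then 1 else 0)" if "a < d" "b < d" for a b
  proof -
    have "nc_fun (ucoef a c * star (ucoef b e))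
        = (\<Sum>i\<in>words k. \<Sum>m\<in>words k. cnj (v a i) * v b m * g (i @ rev m))"
      by (simp add: ucoef_def star_sum star_scale sum_product scale_mult_left scale_mult_right lin g mult_ac)
    then show ?thesis
      using s that by (simp add: basis_reduced reduced_cnj basis_orthonormal)
  qed
  \<comment> \<open>Summing over the diagonal \<open>a = b\<close> yields the unitarity relation of
    the entrywise adjoint matrix, which fixes \<open>s\<close>.\<close>
  have "s * of_nat d = (\<Sum>a<d. nc_fun (ucoef a c * star (ucoef a e)))"
    using val by simp
  also have "\<dots> = nc_fun (\<Sum>a<d. ucoef a c * star (ucoef a e))"
    by (simp add: lin(1))
  also have "\<dots> = nc_fun (if c = e then 1 else 0 :: 'n pol)"
    using assms by (simp only: mult_ucoef_star)
  also have "\<dots> = (if c = e then 1 else 0)"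
    using nc_fun_coef[of "[] :: 'n list" "[]"] by (simp add: nc_proj_Nil functional_zero[OF linear_nc_fun])
  finally have "s = (if c = e then 1 / of_nat d else 0)"
    using assms by (auto simp: field_simps split: if_splits)
  then show ?thesis using val[OF assms(1,2)] by auto
qed

text \<open>A reduced function of positive length is paired with a function of length zero, and
  pairings between different lengths vanish.\<close>

lemma nc_fun_ucoef:
  assumes "a < d" "b < d" "0 < k"
  shows "nc_fun (ucoef a b) = 0"
proof -
  define g where "g = (\<lambda>w. \<Sum>j\<in>words k. v b j * nc_proj w j)"
  have "g \<in> {f. noncrossing k f}" unfolding g_def
    by (rule function_subspace_sum[OF function_subspace_noncrossing]) (simp add: nc_proj_noncrossing)
  then have "noncrossing k g" by simp
  from noncrossing_pairing_even[OF this, of k 0] assms(3)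
  have "reduced k f1 \<Longrightarrow> reduced 0 f2 \<Longrightarrow> (\<Sum>i\<in>words k. f1 i * f2 [] * g i) = 0" for f1 f2 :: "'n list \<Rightarrow> complex"
    by auto
  from this[of "\<lambda>w. cnj (v a w)" "\<lambda>_. 1"] assms have "(\<Sum>i\<in>words k. cnj (v a i) * g i) = 0"
    by (simp add: basis_reduced reduced_cnj) (simp add: reduced_def)
  then show ?thesis
    by (simp add: ucoef_functional[OF linear_nc_fun] nc_fun_coef g_def sum_distrib_left mult.assoc)
qed

definition umat :: "'n pol mat" where
  "umat = mat d d (\<lambda>(a, b). ucoef a b)"

lemma umat_carrier [simp]: "umat \<in> carrier_mat d d" "dim_row umat = d" "dim_col umat = d"
  by (simp_all add: umat_def)

lemma umat_index [simp]: "a < d \<Longrightarrow> b < d \<Longrightarrow> umat $$ (a, b) = ucoef a b"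
  by (simp add: umat_def)

lemma unitary_umat: "unitary d umat"
  unfolding unitary_def
  by (auto intro!: eq_matI simp: scalar_prod_def ucoef_mult_star star_mult_ucoef
      simp flip: lessThan_atLeast0)

lemma representation_umat: "representation d umat"
  by (simp add: representation_def comult_ucoef)

text \<open>Write \<open>W\<close> for U P and \<open>t\<close> for the trace of \<open>P\<close>.
  Testing \<open>W = P W\<close> against adjoint coefficients, Schur orthogonality gives that
  \<open>t / d\<close> times the identity equals \<open>t / d\<close> times \<open>P\<close>. If
  \<open>t\<close> is nonzero then \<open>P\<close> is the identity; otherwise \<open>P\<close> is
  zero, because the trace of an orthogonal projection is the sum of the squared moduli of its
  entries.\<close>

lemma invariant_projection_umat:
  assumes "invariant_projection d umat P"
  shows "P = 0\<^sub>m d d \<or> P = 1\<^sub>m d"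
proof -
  define p where "p = (\<lambda>a b. P $$ (a, b))"
  have P: "P \<in> carrier_mat d d" "P * P = P" "map_mat cnj (transpose_mat P) = P"
    "umat * map_mat (\<lambda>c. scale c 1) P = map_mat (\<lambda>c. scale c 1) P * (umat * map_mat (\<lambda>c. scale c 1) P)"
    using assms by (auto simp: invariant_projection_def Let_def)
  have dims [simp]: "dim_row P = d" "dim_col P = d" using P(1) by auto
  define W where "W = (\<lambda>a e. \<Sum>c<d. scale (p c e) (ucoef a c))"
  have W: "W a e = (\<Sum>b<d. scale (p a b) (W b e))" if "a < d" "e < d" for a e
  proof -
    have "(umat * map_mat (\<lambda>c. scale c 1) P) $$ (a, e) = W a e" if "a < d" "e < d" for a e
      using that by (simp add: scalar_prod_def W_def p_def scale_mult_right lessThan_atLeast0)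
    moreover have "(map_mat (\<lambda>c. scale c 1) P * (umat * map_mat (\<lambda>c. scale c 1) P)) $$ (a, e)
        = (\<Sum>b<d. scale (p a b) (W b e))"
      using that calculation
      by (simp add: scalar_prod_def p_def scale_mult_left lessThan_atLeast0 del: index_mult_mat(1))
         (simp add: scalar_prod_def p_def scale_mult_left lessThan_atLeast0)
    ultimately show ?thesis using P(4) that by simp
  qed
  define t where "t = (\<Sum>c<d. p c c)"
  have tr: "(\<Sum>e<d. nc_fun (W b e * star (ucoef f e))) = (if b = f then t / of_nat d else 0)"
    if "b < d" "f < d" for b f
    using that
    by (simp add: W_def sum_distrib_right scale_mult_left functional_sum[OF linear_nc_fun]
        functional_scale[OF linear_nc_fun] nc_fun_schur t_def sum_divide_distrib if_distrib cong: if_cong)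
  have eq: "(if a = f then t / of_nat d else 0) = p a f * (t / of_nat d)" if "a < d" "f < d" for a f
  proof -
    have "(\<Sum>e<d. nc_fun (W a e * star (ucoef f e)))
        = (\<Sum>e<d. \<Sum>b<d. p a b * nc_fun (W b e * star (ucoef f e)))"
      using that by (intro sum.cong refl) (subst W, auto simp: sum_distrib_right scale_mult_left
          functional_sum[OF linear_nc_fun] functional_scale[OF linear_nc_fun])
    also have "\<dots> = (\<Sum>b<d. p a b * (\<Sum>e<d. nc_fun (W b e * star (ucoef f e))))"
      by (subst sum.swap) (simp add: sum_distrib_left)
    also have "\<dots> = (\<Sum>b<d. if b = f then p a b * (t / of_nat d) else 0)"
      using that by (intro sum.cong refl) (simp add: tr)
    finally show ?thesis using that by (simp add: tr)
  qed
  show ?thesis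
  proof (cases "t = 0")
    case False
    have "P = 1\<^sub>m d"
    proof (rule eq_matI)
      fix a f assume af: "a < dim_row (1\<^sub>m d)" "f < dim_col (1\<^sub>m d :: complex mat)"
      then show "P $$ (a, f) = 1\<^sub>m d $$ (a, f)"
        using eq[of a f] False by (auto simp: p_def split: if_splits)
    qed auto
    then show ?thesis ..
  next
    case True
    have herm: "cnj (p b a) = p a b" if "a < d" "b < d" for a b
      using arg_cong[OF P(3), of "\<lambda>M. M $$ (a, b)"] that by (simp add: p_def)
    have "p a a = (\<Sum>b<d. p a b * p b a)" if "a < d" for a
      using arg_cong[OF P(2), of "\<lambda>M. M $$ (a, a)"] that
      by (simp add: p_def scalar_prod_def lessThan_atLeast0)
    then have "t = (\<Sum>a<d. \<Sum>b<d. p a b * cnj (p a b))"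
      using herm by (simp add: t_def)
    also have "\<dots> = of_real (\<Sum>a<d. \<Sum>b<d. (cmod (p a b))\<^sup>2)"
      by (simp add: complex_norm_square del: of_real_power)
    finally have "(\<Sum>a<d. \<Sum>b<d. (cmod (p a b))\<^sup>2) = 0"
      using True by (metis of_real_eq_0_iff)
    then have "p a b = 0" if "a < d" "b < d" for a b
      using that by (simp add: sum_nonneg_eq_0_iff sum_nonneg)
    then have "P = 0\<^sub>m d d" by (intro eq_matI) (auto simp: p_def)
    then show ?thesis ..
  qed
qed

lemma unitary_irrep_umat: "0 < d \<Longrightarrow> unitary_irrep d umat"
  by (simp add: unitary_irrep_def irreducible_rep_def unitary_umat representation_umat
      invariant_projection_umat)

end

section \<open>Functionals and their values on the irreducible representations\<close>

lemma reduced_basis_exists: "\<exists>d v. reduced_basis k d v"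
  using onb_exists[OF finite_words function_subspace_reduced[of k]] by (auto simp: reduced_basis_def)

lemma linear_functional_combination:
  assumes "linear_functional \<psi>" "linear_functional \<psi>'"
  shows "linear_functional (\<lambda>x. \<psi> x + c * \<psi>' x)"
  by (rule linear_functionalI)
    (simp_all add: functional_add[OF assms(1)] functional_add[OF assms(2)]
      functional_scale[OF assms(1)] functional_scale[OF assms(2)] algebra_simps)

text \<open>Summing out a row letter, or letting two adjacent ones agree, turns a coefficient into a
  shorter one or into zero, so the induction hypothesis applies.\<close>

lemma reduced_functional_coef:
  assumes \<psi>: "linear_functional \<psi>" and k: "length j = k"
    and IH: "\<And>i' j'. length i' < k \<Longrightarrow> length i' = length j' \<Longrightarrow> \<psi> (coef i' j') = 0"
  shows "reduced k (\<lambda>i. \<psi> (coef i j))"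
  unfolding reduced_def
proof (intro conjI allI impI)
  fix l m :: "'a list"
  assume "length l + length m + 1 = k"
  then have "length j = length l + Suc (length m)" using k by simp
  then obtain l' y m' where j: "j = l' @ y # m'" "length l' = length l" "length m' = length m"
    by (metis append_eq_append_conv_if append_take_drop_id length_Suc_conv length_append add_left_cancel
        length_drop length_take min_absorb2 diff_add_inverse le_add1)
  have "(\<Sum>x\<in>UNIV. \<psi> (coef (l @ x # m) j)) = \<psi> (coef (l @ m) (l' @ m'))"
    unfolding j(1) using j(2) by (subst sum_coef_col[symmetric]) (simp_all add: functional_sum[OF \<psi>])
  also have "\<dots> = 0" using j k by (intro IH) auto
  finally show "(\<Sum>x\<in>UNIV. \<psi> (coef (l @ x # m) j)) = 0" .
next
  fix l m :: "'a list" and x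
  assume "length l + length m + 2 = k"
  then have "length j = length l + Suc (Suc (length m))" using k by simp
  then obtain l' r where "j = l' @ r" "length l' = length l" "length r = Suc (Suc (length m))"
    by (metis append_take_drop_id length_drop length_take min_absorb2 diff_add_inverse le_add1)
  then obtain y z m' where j: "j = l' @ y # z # m'" "length l' = length l" "length m' = length m"
    by (auto simp: length_Suc_conv)
  have "coef (l @ x # x # m) j = (if y = z then coef (l @ x # m) (l' @ y # m') else 0)"
    unfolding j(1) using j(2) by (intro coef_double_row) simp
  moreover have "\<psi> (coef (l @ x # m) (l' @ y # m')) = 0" using j k by (intro IH) auto
  ultimately show "\<psi> (coef (l @ x # x # m) j) = 0"
    by (cases "y = z") (simp_all add: functional_zero[OF \<psi>])
qed

text \<open>Every matrix \<open>\<psi>(u\<^bsup>\<otimes>k\<^esup>)\<close> whose predecessors vanish is supported on reduced functions, where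
  its entries are the values on the coefficients of the irreducible representation.\<close>

lemma functional_eq_zero_irreps:
  fixes \<psi> :: "'n::finite pol \<Rightarrow> complex"
  assumes \<psi>: "linear_functional \<psi>" "\<psi> 1 = 0"
    and U: "\<And>k. 0 < k \<Longrightarrow> \<exists>d v. reduced_basis k d v \<and> (\<forall>a<d. \<forall>b<d. \<psi> (reduced_basis.ucoef k v a b) = 0)"
  shows "\<psi> x = 0"
proof (rule functional_eq_zeroI[OF \<psi>(1)])
  fix i j :: "'n list"
  assume "length i = length j"
  then show "\<psi> (coef i j) = 0"
  proof (induction "length i" arbitrary: i j rule: less_induct)
    case less
    show ?case
    proof (cases "length i = 0")
      case True
      then show ?thesis using less.prems \<psi>(2) by simp
    next
      case False
      define k where "k = length i"
      then have k: "0 < k" "length i = k" "length j = k" using False less.prems by auto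
      from U[OF k(1)] obtain d v where dv: "reduced_basis k d v"
        and z: "\<And>a b. a < d \<Longrightarrow> b < d \<Longrightarrow> \<psi> (reduced_basis.ucoef k v a b) = 0" by blast
      interpret reduced_basis k d v by (rule dv)
      have row: "\<psi> (row a j) = 0" if "a < d" for a
        using that z k by (subst row_expand[symmetric]) (auto simp: functional_sum[OF \<psi>(1)] functional_scale[OF \<psi>(1)])
      have "reduced k (\<lambda>i. \<psi> (coef i j))"
        using less.hyps k by (intro reduced_functional_coef[OF \<psi>(1)]) auto
      from expand[OF this k(2)]
      have "\<psi> (coef i j) = (\<Sum>a<d. v a i * \<psi> (row a j))"
        by (simp add: row_def functional_sum[OF \<psi>(1)] functional_scale[OF \<psi>(1)])
      then show ?thesis by (simp add: row)
    qed
  qed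
qed

text \<open>The condition is two-sided because the comparison of lengths applies the matrix of
  \<phi> to the shorter function and its transpose to the longer one.\<close>

definition scalar_on_reduced :: "('n::finite pol \<Rightarrow> complex) \<Rightarrow> nat \<Rightarrow> complex \<Rightarrow> bool" where
  "scalar_on_reduced \<phi> k c \<longleftrightarrow> (\<forall>f. reduced k f \<longrightarrow>
     (\<forall>i\<in>words k. (\<Sum>j\<in>words k. f j * \<phi> (coef i j)) = c * f i) \<and>
     (\<forall>j\<in>words k. (\<Sum>i\<in>words k. f i * \<phi> (coef i j)) = c * f j))"

lemma (in reduced_basis) scalar_on_reducedI:
  assumes \<phi>: "linear_functional \<phi>"
    and c: "\<And>a b. a < d \<Longrightarrow> b < d \<Longrightarrow> \<phi> (ucoef a b) = (if a = b then c else 0)"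
  shows "scalar_on_reduced \<phi> k c"
proof -
  note lin = functional_sum[OF \<phi>] functional_scale[OF \<phi>]
  have "(\<Sum>j\<in>words k. f j * \<phi> (coef i j)) = c * f i" if f: "reduced k f" and i: "i \<in> words k" for f i
  proof -
    have col: "\<phi> (col b i) = c * v b i" if "b < d" for b
    proof -
      have "\<phi> (col b i) = (\<Sum>a<d. v a i * \<phi> (ucoef a b))"
        using i that by (subst col_expand[symmetric]) (simp_all add: lin)
      also have "\<dots> = (\<Sum>a<d. if a = b then c * v a i else 0)"
        using that c by (intro sum.cong) auto
      finally show ?thesis using that by simp
    qed
    define s where "s = (\<lambda>b. \<Sum>l\<in>words k. cnj (v b l) * f l)"
    have fs: "f j = (\<Sum>b<d. v b j * s b)" if "length j = k" for j
      unfolding s_def by (rule expand[OF f that])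
    have "(\<Sum>j\<in>words k. f j * \<phi> (coef i j))
        = (\<Sum>j\<in>words k. (\<Sum>b<d. v b j * s b) * \<phi> (coef i j))"
      by (simp add: fs)
    also have "\<dots> = (\<Sum>b<d. s b * \<phi> (col b i))"
      unfolding col_def lin sum_distrib_right sum_distrib_left
      by (subst sum.swap) (simp add: mult_ac)
    also have "\<dots> = (\<Sum>b<d. s b * (c * v b i))"
      by (simp add: col)
    also have "\<dots> = c * f i"
      using i by (simp add: fs sum_distrib_left mult_ac)
    finally show ?thesis .
  qed
  moreover have "(\<Sum>i\<in>words k. f i * \<phi> (coef i j)) = c * f j" if f: "reduced k f" and j: "j \<in> words k" for f j
  proof -
    have row: "\<phi> (row a j) = c * cnj (v a j)" if "a < d" for a
    proof -
      have "\<phi> (row a j) = (\<Sum>b<d. cnj (v b j) * \<phi> (ucoef a b))"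
        using j that by (subst row_expand[symmetric]) (simp_all add: lin)
      also have "\<dots> = (\<Sum>b<d. if a = b then c * cnj (v b j) else 0)"
        using that c by (intro sum.cong) auto
      finally show ?thesis using that by simp
    qed
    define s where "s = (\<lambda>a. \<Sum>l\<in>words k. v a l * f l)"
    have fs: "f i = (\<Sum>a<d. cnj (v a i) * s a)" if "length i = k" for i
      unfolding s_def by (rule expand_cnj[OF f that])
    have "(\<Sum>i\<in>words k. f i * \<phi> (coef i j))
        = (\<Sum>i\<in>words k. (\<Sum>a<d. cnj (v a i) * s a) * \<phi> (coef i j))"
      by (simp add: fs)
    also have "\<dots> = (\<Sum>a<d. s a * \<phi> (row a j))"
      unfolding row_def lin sum_distrib_right sum_distrib_left
      by (subst sum.swap) (simp add: mult_ac)
    also have "\<dots> = (\<Sum>a<d. s a * (c * cnj (v a j)))"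
      by (simp add: row)
    also have "\<dots> = c * f j"
      using j by (simp add: fs sum_distrib_left mult_ac)
    finally show ?thesis .
  qed
  ultimately show ?thesis by (auto simp: scalar_on_reduced_def)
qed

section \<open>Tracial functionals\<close>

text \<open>Cyclic rotation moves an outer pair of letters next to each other, so that
  \<open>\<phi>(u\<^bsup>\<otimes>m+2\<^esup>)\<close> acts on the rotation of a doubled reduced function like \<open>\<phi>(u\<^bsup>\<otimes>m\<^esup>)\<close>.\<close>

lemma tracial_scalar_step_two:
  fixes \<phi> :: "'n::finite pol \<Rightarrow> complex" and f g :: "'n list \<Rightarrow> complex"
  assumes \<phi>: "linear_functional \<phi>" "tracial \<phi>"
    and c: "scalar_on_reduced \<phi> m c" and c': "scalar_on_reduced \<phi> (Suc (Suc m)) c'"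
    and g: "reduced m g" and f: "reduced (Suc (Suc m)) f"
    and ne: "(\<Sum>j\<in>words m. \<Sum>y\<in>UNIV. g j * f (y # j @ [y])) \<noteq> 0"
  shows "c' = c"
proof -
  let ?S = "\<Sum>j\<in>words m. \<Sum>y\<in>UNIV. g j * f (y # j @ [y])"
  \<comment> \<open>Traciality carries the first generator \<open>pgen x y\<close> behind the last
    one \<open>pgen z y\<close>, where the column relation forces \<open>x = z\<close>; the
    remaining sum over \<open>y\<close> is one.\<close>
  have rot: "(\<Sum>y\<in>UNIV. \<phi> (coef (x # i @ [z]) (y # j @ [y]))) = (if x = z then \<phi> (coef i j) else 0)"
    if "length i = m" "length j = m" for x z i j
  proof -
    have "\<phi> (coef (x # i @ [z]) (y # j @ [y])) = \<phi> (if x = z then coef i j * pgen z y else 0)" for y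
    proof -
      have "\<phi> (coef (x # i @ [z]) (y # j @ [y])) = \<phi> (pgen x y * (coef i j * pgen z y))"
        using that by (simp add: coef_append)
      also have "\<dots> = \<phi> (coef i j * pgen z y * pgen x y)"
        using \<phi>(2) unfolding tracial_def by blast
      finally show ?thesis by (auto simp: mult.assoc pgen_col)
    qed
    then show ?thesis
      by (simp add: pgen_sum_row functional_zero[OF \<phi>(1)] flip: functional_sum[OF \<phi>(1)] sum_distrib_left)
  qed
  \<comment> \<open>The matrix entries of \<phi> are paired with \<open>f\<close> on the rows and
    with the rotated function on the columns. Summing rows first gives \<open>c'\<close>, summing
    columns first gives \<open>c\<close>.\<close>
  have "c' * ?S = (\<Sum>j\<in>words m. \<Sum>y\<in>UNIV. g j * (\<Sum>I\<in>words (Suc (Suc m)). f I * \<phi> (coef I (y # j @ [y]))))"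
    using c' f by (auto simp: scalar_on_reduced_def sum_distrib_left mult_ac intro!: sum.cong)
  also have "\<dots> = (\<Sum>I\<in>words (Suc (Suc m)). \<Sum>j\<in>words m. \<Sum>y\<in>UNIV. f I * (g j * \<phi> (coef I (y # j @ [y]))))"
    unfolding sum_distrib_left
    by (subst (2) sum.swap, subst sum.swap) (simp add: mult_ac)
  also have "\<dots> = (\<Sum>x\<in>UNIV. \<Sum>i\<in>words m. \<Sum>z\<in>UNIV. f (x # i @ [z]) *
      (\<Sum>j\<in>words m. g j * (\<Sum>y\<in>UNIV. \<phi> (coef (x # i @ [z]) (y # j @ [y])))))"
    by (subst sum_words_Suc, unfold sum_words_snoc) (simp add: sum_distrib_left)
  also have "\<dots> = (\<Sum>x\<in>UNIV. \<Sum>i\<in>words m. \<Sum>z\<in>UNIV. if x = z then f (x # i @ [z]) * (c * g i) else 0)"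
    using c g by (intro sum.cong refl) (auto simp: rot scalar_on_reduced_def simp del: coef_Cons)
  also have "\<dots> = c * ?S"
    by (simp, subst sum.swap, simp add: sum_distrib_left mult_ac)
  finally show ?thesis using ne by simp
qed

text \<open>Here the letter moved to the front repeats the last letter of \<open>g\<close>. After
  rotation the two generators merge into one, which survives as the last generator of a coefficient
  of length \<open>Suc m\<close>; this links lengths of different parity.\<close>

lemma tracial_scalar_step_one:
  fixes \<phi> :: "'n::finite pol \<Rightarrow> complex" and f g :: "'n list \<Rightarrow> complex"
  assumes \<phi>: "linear_functional \<phi>" "tracial \<phi>"
    and c: "scalar_on_reduced \<phi> (Suc m) c" and c': "scalar_on_reduced \<phi> (Suc (Suc m)) c'"
    and g: "reduced (Suc m) g" and f: "reduced (Suc (Suc m)) f"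
    and ne: "(\<Sum>j\<in>words m. \<Sum>y\<in>UNIV. g (j @ [y]) * f (y # j @ [y])) \<noteq> 0"
  shows "c' = c"
proof -
  let ?S = "\<Sum>j\<in>words m. \<Sum>y\<in>UNIV. g (j @ [y]) * f (y # j @ [y])"
  have rot: "\<phi> (coef (x # i @ [z]) (y # j @ [y])) = (if x = z then \<phi> (coef (i @ [z]) (j @ [y])) else 0)"
    if "length i = m" "length j = m" for x y z i j
  proof -
    have "\<phi> (coef (x # i @ [z]) (y # j @ [y])) = \<phi> (pgen x y * (coef i j * pgen z y))"
      using that by (simp add: coef_append)
    also have "\<dots> = \<phi> (coef i j * pgen z y * pgen x y)"
      using \<phi>(2) unfolding tracial_def by blast
    finally show ?thesis using that
      by (auto simp: mult.assoc pgen_col coef_append functional_zero[OF \<phi>(1)])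
  qed
  have "c' * ?S = (\<Sum>j\<in>words m. \<Sum>y\<in>UNIV. g (j @ [y]) * (\<Sum>I\<in>words (Suc (Suc m)). f I * \<phi> (coef I (y # j @ [y]))))"
    using c' f by (auto simp: scalar_on_reduced_def sum_distrib_left mult_ac intro!: sum.cong)
  also have "\<dots> = (\<Sum>I\<in>words (Suc (Suc m)). \<Sum>j\<in>words m. \<Sum>y\<in>UNIV. f I * (g (j @ [y]) * \<phi> (coef I (y # j @ [y]))))"
    unfolding sum_distrib_left
    by (subst (2) sum.swap, subst sum.swap) (simp add: mult_ac)
  also have "\<dots> = (\<Sum>x\<in>UNIV. \<Sum>i\<in>words m. \<Sum>z\<in>UNIV. f (x # i @ [z]) *
      (\<Sum>J\<in>words (Suc m). if x = z then g J * \<phi> (coef (i @ [z]) J) else 0))"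
    by (subst sum_words_Suc, unfold sum_words_snoc, intro sum.cong refl) (auto simp: sum_distrib_left rot simp del: coef_Cons intro!: sum.cong)
  also have "\<dots> = (\<Sum>x\<in>UNIV. \<Sum>i\<in>words m. \<Sum>z\<in>UNIV. if x = z then f (x # i @ [z]) * (c * g (i @ [z])) else 0)"
    using c g by (intro sum.cong refl) (auto simp: scalar_on_reduced_def)
  also have "\<dots> = c * ?S"
    by (simp, subst sum.swap, simp add: sum_distrib_left mult_ac)
  finally show ?thesis using ne by simp
qed

section \<open>Alternating tensors as test functions\<close>

fun alternating :: "('n \<Rightarrow> complex) \<Rightarrow> ('n \<Rightarrow> complex) \<Rightarrow> 'n list \<Rightarrow> complex" where
  "alternating a b [] = 1"
| "alternating a b (x # w) = a x * alternating b a w"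

lemma alternating_append:
  "alternating a b (l @ m) = alternating a b l * (if even (length l) then alternating a b m else alternating b a m)"
  by (induction l arbitrary: a b) auto

text \<open>Zero sums make each letter sum vanish, and disjoint supports kill words with equal
  adjacent letters.\<close>

lemma reduced_alternating:
  fixes a b :: "'n::finite \<Rightarrow> complex"
  assumes "sum a UNIV = 0" "sum b UNIV = 0" "\<And>x. a x * b x = 0"
  shows "reduced k (alternating a b)"
  unfolding reduced_def
proof (intro conjI allI impI)
  fix l m :: "'n list" and x
  show "(\<Sum>x\<in>UNIV. alternating a b (l @ x # m)) = 0"
    by (cases "even (length l)")
      (simp_all add: alternating_append assms(1,2) flip: sum_distrib_left sum_distrib_right)
  show "alternating a b (l @ x # x # m) = 0"
    using assms(3)[of x] by (cases "even (length l)") (auto simp: alternating_append)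
qed

text \<open>The sum factorises letter by letter into the two given sums of squares.\<close>

lemma alternating_norm_nonzero:
  fixes a b :: "'n::finite \<Rightarrow> complex"
  assumes "(\<Sum>x\<in>UNIV. a x * a x) \<noteq> 0" "(\<Sum>x\<in>UNIV. b x * b x) \<noteq> 0"
  shows "(\<Sum>w\<in>words k. alternating a b w * alternating a b w) \<noteq> 0"
  using assms
proof (induction k arbitrary: a b)
  case (Suc k)
  have "(\<Sum>w\<in>words (Suc k). alternating a b w * alternating a b w)
      = (\<Sum>x\<in>UNIV. a x * a x) * (\<Sum>w\<in>words k. alternating b a w * alternating b a w)"
    unfolding sum_words_Suc sum_product by (simp add: mult_ac)
  then show ?case using Suc.IH[of b a] Suc.prems by simp
qed simp

section \<open>Growth of the dimensions\<close>

text \<open>The tensor p \<otimes> q \<otimes> u, as a function on words.\<close>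

definition double_ext :: "('n \<Rightarrow> complex) \<Rightarrow> ('n \<Rightarrow> complex) \<Rightarrow> ('n list \<Rightarrow> complex) \<Rightarrow> 'n list \<Rightarrow> complex" where
  "double_ext p q u w = p (hd w) * q (hd (tl w)) * u (tl (tl w))"

lemma double_ext_simps [simp]: "double_ext p q u (x # y # w) = p x * q y * u w"
  by (simp add: double_ext_def)

lemma reduced_double_ext:
  fixes p q :: "'n::finite \<Rightarrow> complex"
  assumes "sum p UNIV = 0" "sum q UNIV = 0" "\<And>x. p x * q x = 0"
    and u: "reduced k u" and qu: "\<And>x w. q x * u (x # w) = 0"
  shows "reduced (Suc (Suc k)) (double_ext p q u)"
  unfolding reduced_def
proof (intro conjI allI impI)
  fix l m :: "'n list"
  assume len: "length l + length m + 1 = Suc (Suc k)"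
  consider y m' where "l = []" "m = y # m'" | y where "l = [y]" | y z l' where "l = y # z # l'"
    using len by (cases l; cases "tl l"; cases m) auto
  then show "(\<Sum>x\<in>UNIV. double_ext p q u (l @ x # m)) = 0"
    using assms len by cases (auto simp: reducedD_sum[OF u] simp flip: sum_distrib_left sum_distrib_right)
next
  fix l m :: "'n list" and x
  assume len: "length l + length m + 2 = Suc (Suc k)"
  consider "l = []" | y where "l = [y]" | y z l' where "l = y # z # l'"
    by (cases l; cases "tl l") auto
  then show "double_ext p q u (l @ x # x # m) = 0"
    using assms len by cases (auto simp: reducedD_eq[OF u] mult.assoc)
qed

text \<open>An index below \<open>2 * D\<close> encodes a pair: the quotient by \<open>D\<close>
  selects one of the two vectors \<open>A\<close>, the remainder a member of
  \<open>u\<close>.\<close>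

lemma orthonormal_double_ext:
  fixes A :: "nat \<Rightarrow> 'n::finite \<Rightarrow> complex"
  assumes A: "\<And>s t. s < 2 \<Longrightarrow> t < 2 \<Longrightarrow> (\<Sum>x\<in>UNIV. cnj (A s x) * A t x) = (if s = t then 1 else 0)"
    and B: "(\<Sum>x\<in>UNIV. cnj (B x) * B x) = 1"
    and u: "orthonormal (words k) D u"
  shows "orthonormal (words (Suc (Suc k))) (2 * D) (\<lambda>m. double_ext (A (m div D)) B (u (m mod D)))"
  unfolding orthonormal_def
proof (intro allI impI)
  fix m n assume "m < 2 * D" "n < 2 * D"
  then have mn: "m div D < 2" "n div D < 2" "m mod D < D" "n mod D < D"
    by (auto simp: less_mult_imp_div_less intro: mod_less_divisor gr0I)
  have "ip (words (Suc (Suc k))) (double_ext (A (m div D)) B (u (m mod D))) (double_ext (A (n div D)) B (u (n mod D)))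
      = (\<Sum>x\<in>UNIV. cnj (A (m div D) x) * A (n div D) x) * ((\<Sum>y\<in>UNIV. cnj (B y) * B y) *
        ip (words k) (u (m mod D)) (u (n mod D)))"
  proof -
    have "ip (words (Suc (Suc k))) (double_ext (A (m div D)) B (u (m mod D))) (double_ext (A (n div D)) B (u (n mod D)))
      = (\<Sum>x\<in>UNIV. \<Sum>y\<in>UNIV. \<Sum>w\<in>words k. (cnj (A (m div D) x) * A (n div D) x) *
          ((cnj (B y) * B y) * (cnj (u (m mod D) w) * u (n mod D) w)))"
      unfolding ip_def sum_words_Suc by (simp add: mult_ac)
    then show ?thesis by (simp only: ip_def flip: sum_distrib_left sum_distrib_right)
  qed
  also have "\<dots> = (if m div D = n div D \<and> m mod D = n mod D then 1 else 0)"
    using u mn A B by (auto simp: orthonormal_def)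
  also have "\<dots> = (if m = n then 1 else 0)" by (metis div_mult_mod_eq)
  finally show "ip (words (Suc (Suc k))) (double_ext (A (m div D)) B (u (m mod D)))
      (double_ext (A (n div D)) B (u (n mod D))) = (if m = n then 1 else 0)" .
qed

text \<open>Tensors that alternate a free choice between the two vectors \<open>A\<close> with the
  fixed vector \<open>B\<close> give \<open>2 ^ r\<close> orthonormal reduced functions. Keeping the
  first letter off the support of \<open>B\<close> lets the induction prepend another pair.\<close>

lemma reduced_basis_large:
  fixes A :: "nat \<Rightarrow> 'n::finite \<Rightarrow> complex"
  assumes A: "\<And>s t. s < 2 \<Longrightarrow> t < 2 \<Longrightarrow> (\<Sum>x\<in>UNIV. cnj (A s x) * A t x) = (if s = t then 1 else 0)"
    and B: "(\<Sum>x\<in>UNIV. cnj (B x) * B x) = 1"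
    and z: "\<And>s. s < 2 \<Longrightarrow> sum (A s) UNIV = 0" "sum B UNIV = 0"
    and AB: "\<And>s x. A s x * B x = 0"
  shows "\<exists>d v. reduced_basis (2 * r) d (v :: nat \<Rightarrow> 'n list \<Rightarrow> complex) \<and> 2 ^ r \<le> d"
proof -
  have "\<exists>u. orthonormal (words (2 * r)) (2 ^ r) u \<and> (\<forall>m<2 ^ r. reduced (2 * r) (u m)) \<and>
      (\<forall>m<2 ^ r. \<forall>x w. B x * u m (x # w) = 0)"
  proof (induction r)
    case 0
    show ?case
      \<comment> \<open>The start vanishes on nonempty words because the induction requires
        \<open>B x * u m (x # w) = 0\<close> for every \<open>w\<close>, whatever its
        length.\<close>
      by (intro exI[of _ "\<lambda>_ w. if w = [] then 1 else 0"]) (auto simp: orthonormal_def ip_def reduced_def)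
  next
    case (Suc r)
    then obtain u :: "nat \<Rightarrow> 'n list \<Rightarrow> complex"
    where u: "orthonormal (words (2 * r)) (2 ^ r) u" "\<forall>m<2 ^ r. reduced (2 * r) (u m)"
        "\<forall>m<2 ^ r. \<forall>x w. B x * u m (x # w) = 0" by blast
    define u' where "u' = (\<lambda>m. double_ext (A (m div 2 ^ r)) B (u (m mod 2 ^ r)))"
    have "orthonormal (words (2 * Suc r)) (2 ^ Suc r) u'"
      using orthonormal_double_ext[OF A B u(1)] by (simp add: u'_def)
    moreover have "reduced (2 * Suc r) (u' m)" if "m < 2 ^ Suc r" for m
    proof -
      have "m div 2 ^ r < 2" using that by (simp add: less_mult_imp_div_less)
      then show ?thesis
        using reduced_double_ext[of "A (m div 2 ^ r)" B "2 * r" "u (m mod 2 ^ r)"] z AB u(2,3)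
        by (simp add: u'_def)
    qed
    moreover have "B x * u' m (x # w) = 0" for m x w
      using AB[of "m div 2 ^ r" x] by (auto simp: u'_def double_ext_def)
    ultimately show ?case by blast
  qed
  then obtain u :: "nat \<Rightarrow> 'n list \<Rightarrow> complex"
    where u: "orthonormal (words (2 * r)) (2 ^ r) u" "\<forall>m<2 ^ r. reduced (2 * r) (u m)"
    by blast
  from onb_extend[OF finite_words function_subspace_reduced u(1)] u(2) show ?thesis
    by (auto simp: reduced_basis_def)
qed

text \<open>In dimension one, \<open>f\<close> and \<open>g\<close> would be nonzero multiples of
  the same function, whose square would then vanish.\<close>

lemma (in reduced_basis) dim_ge_2:
  fixes f g :: "'n list \<Rightarrow> complex"
  assumes f: "reduced k f" "(\<Sum>w\<in>words k. f w * f w) \<noteq> 0"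
    and g: "reduced k g" "(\<Sum>w\<in>words k. g w * g w) \<noteq> 0"
    and fg: "\<And>w. length w = k \<Longrightarrow> f w * g w = 0"
  shows "2 \<le> d"
proof (rule ccontr)
  assume "\<not> 2 \<le> d"
  then consider "d = 0" | "d = 1" by linarith
  then show False
  proof cases
    case 1
    then show False using expand[OF f(1)] f(2) by simp
  next
    case 2
    define s t where "s = (\<Sum>i\<in>words k. cnj (v 0 i) * f i)" and "t = (\<Sum>i\<in>words k. cnj (v 0 i) * g i)"
    have fw: "f w = v 0 w * s" and gw: "g w = v 0 w * t" if "length w = k" for w
      using expand[OF f(1) that] expand[OF g(1) that] 2 by (simp_all add: s_def t_def)
    have "s \<noteq> 0" "t \<noteq> 0" using f(2) g(2) fw gw by auto
    then have "v 0 w = 0" if "length w = k" for w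
      using fg[OF that] fw[OF that] gw[OF that] by auto
    then show False using f(2) fw by simp
  qed
qed

text \<open>The third moment of \<open>a\<close> links irreducible representations of different parity; this is
  where three points per vector are needed.\<close>

lemma disjoint_vectors:
  assumes "CARD('n) \<ge> 6"
  obtains a a' b :: "'n::finite \<Rightarrow> complex"
  where "sum a UNIV = 0" "sum a' UNIV = 0" "sum b UNIV = 0"
    "\<And>x. a x * b x = 0" "\<And>x. a' x * b x = 0" "\<And>x. cnj (a x) = a x" "\<And>x. cnj (a' x) = a' x" "\<And>x. cnj (b x) = b x"
    "(\<Sum>x\<in>UNIV. a x * a x) = 6" "(\<Sum>x\<in>UNIV. a' x * a' x) = 2" "(\<Sum>x\<in>UNIV. b x * b x) = 6"
    "(\<Sum>x\<in>UNIV. a x * a' x) = 0" "(\<Sum>x\<in>UNIV. a x * a x * a x) = 6"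
proof -
  obtain S :: "'n set" where "card S = 6" using obtain_subset_with_card_n[OF assms] by blast
  obtain xs where xs: "distinct xs" "set xs = S" using finite_distinct_list[of S] by auto
  then have "length xs = 6" using \<open>card S = 6\<close> distinct_card[of xs] by simp
  then obtain x1 x2 x3 x4 x5 x6 where "xs = [x1, x2, x3, x4, x5, x6]"
    by (auto simp: numeral_eq_Suc length_Suc_conv)
  with xs have dist: "distinct [x1, x2, x3, x4, x5, x6]" by simp
  have sum3: "sum f UNIV = f x + f y + f z"
    if "distinct [x, y, z]" "\<And>w. w \<notin> {x, y, z} \<Longrightarrow> f w = 0" for f :: "'n \<Rightarrow> complex" and x y z
  proof -
    have "sum f UNIV = sum f {x, y, z}" using that(2) by (intro sum.mono_neutral_right) auto
    then show ?thesis using that(1) by simp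
  qed
  \<comment> \<open>Values 2, -1, -1 give zero sum and third moment 8 - 1 - 1 = 6; on two points a
    zero-sum vector has third moment zero. The vector \<open>a'\<close> is orthogonal to
    \<open>a\<close> within the same three points and supplies the second choice for the growth of
    dimensions.\<close>
  define a where "a = (\<lambda>x. if x = x1 then 2 else if x = x2 \<or> x = x3 then - 1 else 0 :: complex)"
  define a' where "a' = (\<lambda>x. if x = x2 then 1 else if x = x3 then - 1 else 0 :: complex)"
  define b where "b = (\<lambda>x. if x = x4 then 2 else if x = x5 \<or> x = x6 then - 1 else 0 :: complex)"
  have val: "a x1 = 2" "a x2 = - 1" "a x3 = - 1" "a' x1 = 0" "a' x2 = 1" "a' x3 = - 1"
    "b x4 = 2" "b x5 = - 1" "b x6 = - 1"
    using dist by (auto simp: a_def a'_def b_def)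
  have off: "w \<notin> {x1, x2, x3} \<Longrightarrow> a w = 0" "w \<notin> {x1, x2, x3} \<Longrightarrow> a' w = 0"
    "w \<notin> {x4, x5, x6} \<Longrightarrow> b w = 0" for w
    by (auto simp: a_def a'_def b_def)
  have s1: "sum f UNIV = f x1 + f x2 + f x3" if "\<And>w. w \<notin> {x1, x2, x3} \<Longrightarrow> f w = 0" for f :: "'n \<Rightarrow> complex"
    by (rule sum3[OF _ that]) (use dist in auto)
  have s2: "sum f UNIV = f x4 + f x5 + f x6" if "\<And>w. w \<notin> {x4, x5, x6} \<Longrightarrow> f w = 0" for f :: "'n \<Rightarrow> complex"
    by (rule sum3[OF _ that]) (use dist in auto)
  show thesis
  proof (rule that[of a a' b])
    have "(\<Sum>x\<in>UNIV. a x) = a x1 + a x2 + a x3"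
      by (rule s1) (simp add: off)
    then show "sum a UNIV = 0" by (simp add: val)
    have "(\<Sum>x\<in>UNIV. a' x) = a' x1 + a' x2 + a' x3"
      by (rule s1) (simp add: off)
    then show "sum a' UNIV = 0" by (simp add: val)
    have "(\<Sum>x\<in>UNIV. a x * a x) = a x1 * a x1 + a x2 * a x2 + a x3 * a x3"
      by (rule s1) (simp add: off)
    then show "(\<Sum>x\<in>UNIV. a x * a x) = 6" by (simp add: val)
    have "(\<Sum>x\<in>UNIV. a' x * a' x) = a' x1 * a' x1 + a' x2 * a' x2 + a' x3 * a' x3"
      by (rule s1) (simp add: off)
    then show "(\<Sum>x\<in>UNIV. a' x * a' x) = 2" by (simp add: val)
    have "(\<Sum>x\<in>UNIV. a x * a' x) = a x1 * a' x1 + a x2 * a' x2 + a x3 * a' x3"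
      by (rule s1) (simp add: off)
    then show "(\<Sum>x\<in>UNIV. a x * a' x) = 0" by (simp add: val)
    have "(\<Sum>x\<in>UNIV. a x * a x * a x) = a x1 * a x1 * a x1 + a x2 * a x2 * a x2 + a x3 * a x3 * a x3"
      by (rule s1) (simp add: off)
    then show "(\<Sum>x\<in>UNIV. a x * a x * a x) = 6" by (simp add: val)
    have "(\<Sum>x\<in>UNIV. b x) = b x4 + b x5 + b x6"
      by (rule s2) (simp add: off)
    then show "sum b UNIV = 0" by (simp add: val)
    have "(\<Sum>x\<in>UNIV. b x * b x) = b x4 * b x4 + b x5 * b x5 + b x6 * b x6"
      by (rule s2) (simp add: off)
    then show "(\<Sum>x\<in>UNIV. b x * b x) = 6" by (simp add: val)
    show "\<And>x. a x * b x = 0" "\<And>x. a' x * b x = 0" "\<And>x. cnj (a x) = a x" "\<And>x. cnj (a' x) = a' x"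
      "\<And>x. cnj (b x) = b x"
      using dist by (auto simp: a_def a'_def b_def)
  qed
qed

section \<open>Tracial central states\<close>

theorem theorem5p6:
  fixes \<phi> h :: "'n::finite pol \<Rightarrow> complex"
  assumes "CARD('n) \<ge> 6"
    and "haar_state h"
    and "tracial_central_state \<phi>"
  shows "\<exists>t::real. 0 \<le> t \<and> t \<le> 1 \<and>
    (\<forall>x. \<phi> x = of_real t * counit x + of_real (1 - t) * h x)"
proof -
  obtain a a' b :: "'n \<Rightarrow> complex" where
    sums: "sum a UNIV = 0" "sum a' UNIV = 0" "sum b UNIV = 0"
    and disj: "\<And>x. a x * b x = 0" "\<And>x. a' x * b x = 0"
    and re: "\<And>x. cnj (a x) = a x" "\<And>x. cnj (a' x) = a' x" "\<And>x. cnj (b x) = b x"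
    and sq: "(\<Sum>x\<in>UNIV. a x * a x) = 6" "(\<Sum>x\<in>UNIV. a' x * a' x) = 2" "(\<Sum>x\<in>UNIV. b x * b x) = 6"
    and orth: "(\<Sum>x\<in>UNIV. a x * a' x) = 0" and cube: "(\<Sum>x\<in>UNIV. a x * a x * a x) = 6"
    by (rule disjoint_vectors[OF assms(1)]) (rule that)
  let ?ab = "alternating a b" and ?ba = "alternating b a"
  have red: "reduced k ?ab" "reduced k ?ba" for k
    using sums disj by (auto intro!: reduced_alternating simp: mult.commute[of "b _"])
  have norm: "(\<Sum>w\<in>words k. ?ab w * ?ab w) \<noteq> 0" "(\<Sum>w\<in>words k. ?ba w * ?ba w) \<noteq> 0" for k
    by (rule alternating_norm_nonzero; simp add: sq)+
  \<comment> \<open>The two alternating functions have disjoint supports. Dimension at least two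
    separates U^k from the trivial representation and provides an off-diagonal coefficient.\<close>
  have ge2: "2 \<le> d" if "reduced_basis k d v" "0 < k" for k d and v :: "nat \<Rightarrow> 'n list \<Rightarrow> complex"
  proof (rule reduced_basis.dim_ge_2[OF that(1) red(1) norm(1) red(2) norm(2)])
    show "?ab w * ?ba w = 0" if "length w = k" for w
      using that \<open>0 < k\<close> disj(1) by (cases w) (auto simp: mult_ac)
  qed
  have \<phi>: "linear_functional \<phi>" "\<phi> 1 = 1" "\<And>x. 0 \<le> \<phi> (star x * x)" "tracial \<phi>" "central \<phi>"
    using assms(3) by (auto simp: tracial_central_state_def state_def)
  have h: "linear_functional h" "h 1 = 1"
    using assms(2) by (auto simp: haar_state_def state_def)
  have irrep: "unitary_irrep d (reduced_basis.umat k d v)" "reduced_basis.umat k d v \<noteq> 1\<^sub>m 1"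
    if "reduced_basis k d v" "0 < k" for k d and v :: "nat \<Rightarrow> 'n list \<Rightarrow> complex"
  proof -
    interpret reduced_basis k d v by (rule that(1))
    show "unitary_irrep d umat" using ge2[OF that] by (intro unitary_irrep_umat) simp
    have "dim_row umat \<noteq> 1" using ge2[OF that] by simp
    then show "umat \<noteq> 1\<^sub>m 1" by (metis index_one_mat(2))
  qed
  have h_ucoef: "h (reduced_basis.ucoef k v a b) = 0"
    if "reduced_basis k d v" "0 < k" "a < d" "b < d" for k d a b and v :: "nat \<Rightarrow> 'n list \<Rightarrow> complex"
    using assms(2) irrep[OF that(1,2)] that(3,4) reduced_basis.umat_index[OF that(1,3,4)]
    unfolding haar_state_def by metis
  \<comment> \<open>Both functionals vanish on all coefficients of U^k with \<open>k > 0\<close>;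
    their equality makes Schur orthogonality available for \<open>h\<close>.\<close>
  have h_nc: "h x = nc_fun x" for x
  proof -
    have "h x + (- 1) * nc_fun x = 0"
    proof (rule functional_eq_zero_irreps)
      show "linear_functional (\<lambda>x. h x + (- 1) * nc_fun x)"
        by (rule linear_functional_combination[OF h(1) linear_nc_fun])
      show "h 1 + (- 1) * nc_fun (1 :: 'n pol) = 0"
        using h(2) nc_fun_coef[of "[] :: 'n list" "[]"] by (simp add: nc_proj_Nil)
      show "\<exists>d v. reduced_basis k d v \<and> (\<forall>a<d. \<forall>b<d. h (reduced_basis.ucoef k v a b)
          + (- 1) * nc_fun (reduced_basis.ucoef k v a b) = 0)" if "0 < k" for k
      proof -
        obtain d and v :: "nat \<Rightarrow> 'n list \<Rightarrow> complex" where dv: "reduced_basis k d v"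
          using reduced_basis_exists[of k] by blast
        then show ?thesis
          using h_ucoef[OF dv that] reduced_basis.nc_fun_ucoef[OF dv _ _ that]
          by (intro exI[of _ d] exI[of _ v]) simp
      qed
    qed
    then show ?thesis by simp
  qed
  have "\<exists>c d v. reduced_basis k d (v :: nat \<Rightarrow> 'n list \<Rightarrow> complex) \<and>
      (\<forall>a<d. \<forall>b<d. \<phi> (reduced_basis.ucoef k v a b) = (if a = b then c else 0))" if "0 < k" for k
  proof -
    obtain d and v :: "nat \<Rightarrow> 'n list \<Rightarrow> complex" where dv: "reduced_basis k d v"
      using reduced_basis_exists[of k] by blast
    from \<phi>(5) irrep(1)[OF dv that] obtain c where
      "\<forall>a<d. \<forall>b<d. \<phi> (reduced_basis.umat k d v $$ (a, b)) = (if a = b then c else 0)"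
      unfolding central_def by blast
    then have "\<forall>a<d. \<forall>b<d. \<phi> (reduced_basis.ucoef k v a b) = (if a = b then c else 0)"
      using reduced_basis.umat_index[OF dv] by simp
    with dv show ?thesis by blast
  qed
  then obtain C D V where basis: "\<And>k. 0 < k \<Longrightarrow> reduced_basis k (D k) (V k :: nat \<Rightarrow> 'n list \<Rightarrow> complex)"
    and C: "\<And>k a b. 0 < k \<Longrightarrow> a < D k \<Longrightarrow> b < D k \<Longrightarrow>
      \<phi> (reduced_basis.ucoef k (V k) a b) = (if a = b then C k else 0)"
    by metis
  have scalar: "scalar_on_reduced \<phi> k (C k)" if "0 < k" for k
    by (rule reduced_basis.scalar_on_reducedI[OF basis[OF that] \<phi>(1) C[OF that]])
  \<comment> \<open>For odd \<open>k\<close> the word \<open>y # j @ [y]\<close> carries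
    \<open>a\<close> at both ends and the pattern of \<open>?ba\<close> in between, so the pairing
    splits off the sum of squares of \<open>a\<close>.\<close>
  have odd_step: "C (Suc (Suc k)) = C k" if "odd k" for k
  proof (rule tracial_scalar_step_two[OF \<phi>(1,4) scalar scalar red(2) red(1)])
    have "(\<Sum>j\<in>words k. \<Sum>y\<in>UNIV. ?ba j * ?ab (y # j @ [y]))
        = (\<Sum>j\<in>words k. ?ba j * ?ba j) * (\<Sum>y\<in>UNIV. a y * a y)"
      unfolding sum_product using that by (intro sum.cong refl) (simp add: alternating_append mult_ac)
    then show "(\<Sum>j\<in>words k. \<Sum>y\<in>UNIV. ?ba j * ?ab (y # j @ [y])) \<noteq> 0" using norm(2) by (simp add: sq)
  qed (use that in \<open>auto elim: oddE\<close>)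
  \<comment> \<open>The last letter is now shared with \<open>?ba\<close>, whose last factor is also
    \<open>a\<close> since \<open>k\<close> is odd, so the third moment of \<open>a\<close> appears.
    This ties each even length to the next odd one.\<close>
  have even_step: "C (Suc (Suc k)) = C (Suc k)" if "odd k" for k
  proof (rule tracial_scalar_step_one[OF \<phi>(1,4) scalar scalar red(2) red(1)])
    have "(\<Sum>j\<in>words k. \<Sum>y\<in>UNIV. ?ba (j @ [y]) * ?ab (y # j @ [y]))
        = (\<Sum>j\<in>words k. ?ba j * ?ba j) * (\<Sum>y\<in>UNIV. a y * a y * a y)"
      unfolding sum_product using that by (intro sum.cong refl) (simp add: alternating_append mult_ac)
    then show "(\<Sum>j\<in>words k. \<Sum>y\<in>UNIV. ?ba (j @ [y]) * ?ab (y # j @ [y])) \<noteq> 0" using norm(2) by (simp add: cube)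
  qed simp_all
  define t where "t = C 1"
  have odd: "C (2 * n + 1) = t" for n
    by (induction n) (use odd_step in \<open>auto simp: t_def\<close>)
  have Ct: "C k = t" if "0 < k" for k
  proof (cases "odd k")
    case True
    then show ?thesis using odd by (auto elim!: oddE)
  next
    case False
    then obtain m where "k = 2 * m" by (auto elim: evenE)
    with that obtain n where "k = Suc (2 * n + 1)" by (cases m) auto
    then show ?thesis using even_step[of "2 * n + 1"] odd[of "Suc n"] by simp
  qed
  have main: "\<phi> x = t * counit x + (1 - t) * h x" for x
  proof -
    let ?\<psi> = "\<lambda>x. \<phi> x + (- t) * counit x + (t - 1) * h x"
    have "?\<psi> x = 0"
    proof (rule functional_eq_zero_irreps)
      show "linear_functional ?\<psi>"
        by (intro linear_functional_combination \<phi>(1) h(1) linear_counit)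
      show "?\<psi> 1 = 0" by (simp add: \<phi>(2) h(2) counit_one)
      show "\<exists>d v. reduced_basis k d v \<and> (\<forall>a<d. \<forall>b<d. ?\<psi> (reduced_basis.ucoef k v a b) = 0)"
        if "0 < k" for k
        using C[OF that] h_ucoef[OF basis[OF that] that] reduced_basis.counit_ucoef[OF basis[OF that]] Ct[OF that]
        by (intro exI[of _ "D k"] exI[of _ "V k"] conjI basis[OF that]) simp
    qed
    then show ?thesis by (simp add: algebra_simps eq_neg_iff_add_eq_0)
  qed
  have pos: "0 \<le> \<phi> (x * star x)" for x
    using \<phi>(3)[of "star x"] by (simp add: star_star)
  \<comment> \<open>Positivity is tested on the coefficients at (0, 1) and (0, 0) times their
    adjoints: the counit gives 0 and 1 respectively, and the Haar state gives \<open>1 / d\<close>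
    in both cases.\<close>
  have bound: "0 \<le> (1 - t) / of_nat d" "0 \<le> t + (1 - t) / of_nat d"
    if "reduced_basis k d (v :: nat \<Rightarrow> 'n list \<Rightarrow> complex)" "2 \<le> d" for k d v
  proof -
    interpret reduced_basis k d v by (rule that(1))
    have U: "\<phi> (ucoef 0 c * star (ucoef 0 c)) = t * counit (ucoef 0 c * star (ucoef 0 c)) + (1 - t) / of_nat d"
      if "c < d" for c
      using that by (simp add: main h_nc nc_fun_schur)
    have "counit (ucoef 0 1 * star (ucoef 0 1)) = 0"
      using that(2) by (simp add: counit_mult counit_ucoef)
    then show "0 \<le> (1 - t) / of_nat d" using U[of 1] pos[of "ucoef 0 1"] that(2) by simp
    have "1 = counit (\<Sum>c<d. ucoef 0 c * star (ucoef 0 c))"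
      using that(2) by (simp add: ucoef_mult_star counit_one)
    also have "\<dots> = (\<Sum>c<d. if c = 0 then counit (ucoef 0 c * star (ucoef 0 c)) else 0)"
      unfolding functional_sum[OF linear_counit]
      using that(2) by (intro sum.cong refl) (simp add: counit_mult counit_ucoef)
    also have "\<dots> = counit (ucoef 0 0 * star (ucoef 0 0))" using that(2) by simp
    finally show "0 \<le> t + (1 - t) / of_nat d" using U[of 0] pos[of "ucoef 0 0"] that(2) by simp
  qed
  \<comment> \<open>In the order on complex numbers, nonnegativity also asserts that
    \<open>t\<close> is real.\<close>
  have t1: "Re t \<le> 1" "Im t = 0"
    using bound(1)[OF basis[of 1] ge2[OF basis]] ge2[OF basis[of 1]]
    by (auto simp: less_eq_complex_def zero_le_divide_iff)
  then have t: "t = of_real (Re t)" by (simp add: complex_eq_iff)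
  \<comment> \<open>\<open>a\<close>, \<open>a'\<close> and \<open>b\<close> normalised, their
    squared norms being 6, 2 and 6.\<close>
  define A where "A = (\<lambda>s :: nat. if s = 0 then (\<lambda>x. of_real (1 / sqrt 6) * a x) else (\<lambda>x. of_real (1 / sqrt 2) * a' x :: complex))"
  define B where "B = (\<lambda>x. of_real (1 / sqrt 6) * b x :: complex)"
  have "\<exists>d v. reduced_basis (2 * r) d (v :: nat \<Rightarrow> 'n list \<Rightarrow> complex) \<and> 2 ^ r \<le> d" for r
  proof (rule reduced_basis_large[of A B])
    have six: "(of_real (1 / sqrt 6) * of_real (1 / sqrt 6) * 6 :: complex) = 1"
      and two: "(of_real (1 / sqrt 2) * of_real (1 / sqrt 2) * 2 :: complex) = 1"
      by (simp_all flip: of_real_mult)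
    have sc: "(\<Sum>x\<in>UNIV. (p * f x) * (q * g x)) = p * q * (\<Sum>x\<in>UNIV. f x * g x)"
      for p q and f g :: "'n \<Rightarrow> complex"
      by (simp add: sum_distrib_left mult_ac)
    show "(\<Sum>x\<in>UNIV. cnj (A s x) * A s' x) = (if s = s' then 1 else 0)" if "s < 2" "s' < 2" for s s'
      using that six two orth sq
      by (auto simp: A_def re sc less_2_cases_iff mult.commute[of "a' _" "a _"] simp del: of_real_divide)
    show "(\<Sum>x\<in>UNIV. cnj (B x) * B x) = 1"
      using six sq by (simp add: B_def re sc del: of_real_divide)
    show "sum (A s) UNIV = 0" "sum B UNIV = 0" "A s x * B x = 0" for s x
      using sums disj by (auto simp: A_def B_def simp flip: sum_divide_distrib)
  qed
  then obtain d v where dv: "\<And>r. reduced_basis (2 * r) (d r) (v r :: nat \<Rightarrow> 'n list \<Rightarrow> complex)" "\<And>r. 2 ^ r \<le> d r"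
    by metis
  have "0 \<le> Re t"
  proof (rule ccontr)
    assume neg: "\<not> 0 \<le> Re t"
    \<comment> \<open>For negative \<open>t\<close> the second bound would keep the dimensions at
      most \<open>(1 - Re t) / (- Re t)\<close>. The length belonging to \<open>Suc r\<close> has
      dimension above \<open>r\<close> and at least two, as \<open>bound\<close> demands.\<close>
    obtain r where r: "real r > (1 - Re t) / (- Re t)" using reals_Archimedean2 by blast
    have "Suc r < 2 ^ Suc r" by (rule less_exp)
    then have d: "r < d (Suc r)" "2 \<le> d (Suc r)" using dv(2)[of "Suc r"] by (auto intro: order_trans[of _ "2 ^ Suc r"])
    have "0 \<le> t + (1 - t) / of_nat (d (Suc r))" by (rule bound(2)[OF dv(1) d(2)])
    then have "0 \<le> complex_of_real (Re t + (1 - Re t) / real (d (Suc r)))" by (subst (asm) (1 2) t) simp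
    then have "0 \<le> Re t + (1 - Re t) / real (d (Suc r))" by (simp add: less_eq_complex_def)
    then have "- Re t * real (d (Suc r)) \<le> 1 - Re t" using d by (simp add: field_simps)
    moreover have "1 - Re t < - Re t * real r" using r neg by (simp add: field_simps)
    moreover have "- Re t * real r \<le> - Re t * real (d (Suc r))"
      using neg d by (intro mult_left_mono) auto
    ultimately show False by linarith
  qed
  moreover have "\<phi> x = of_real (Re t) * counit x + of_real (1 - Re t) * h x" for x
    using main[of x] t by (metis of_real_1 of_real_diff)
  ultimately show ?thesis using t1(1) by blast
qed

end
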